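(* Let $p$ be a prime such that $p\equiv\pm1\pmod5$. Then $$\sum_{k=0}^{p-1}\frac{\binom{2k}{k}^2\binom{4k}{2k}}{12^{4k}}\equiv\begin{cases}4x^2\pmod p&\text{if } p=x^2+10y^2\equiv1,9,11,19\pmod{40}\text{ with } x,y\in\mathbb{Z},\\ 0\pmod{p^2}&\text{if } p\equiv21,29,31,39\pmod{40}.\end{cases}$$
   Context: Congruences between rational numbers modulo $p$ or $p^2$ are taken in the ring of rationals whose denominators are coprime to $p$. *)

theory Defs
  imports Complex_Main "HOL-Number_Theory.Number_Theory"
begin

text \<open>The ring of rationals whose denominator in lowest terms is coprime to \<open>p\<close>.\<close>

definition p_integral :: "nat \<Rightarrow> rat set" where
  "p_integral p = {q. coprime (snd (quotient_of q)) (int p)}"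

text \<open>
  Congruence modulo the ideal generated by \<open>m\<close> in that ring. Both sides are required to lie
  in the ring; the quotient \<open>c\<close> must lie in it too, so this is not the trivial divisibility
  in the field of rationals.
\<close>

definition rat_cong :: "nat \<Rightarrow> nat \<Rightarrow> rat \<Rightarrow> rat \<Rightarrow> bool" where
  "rat_cong p m a b \<longleftrightarrow>
     a \<in> p_integral p \<and> b \<in> p_integral p \<and> (\<exists>c \<in> p_integral p. a - b = of_nat m * c)"

end

theory Submission
  imports Defs "Berlekamp_Zassenhaus.Finite_Field" "HOL-Computational_Algebra.Computational_Algebra"
begin

text \<open>
  Let \<open>b k = binom(2k,k) binom(4k,2k)\<close> and choose \<open>s\<close> with \<open>s\<^sup>2 \<equiv> 5\<close> and \<open>z = (9 + 4 s) / 1152\<close>, so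
  that \<open>z (1 - 64 z) = 12\<^sup>-\<^sup>4\<close>. By Clausen's identity and the divisibility of the late
  coefficients, the sum in question is congruent modulo \<open>p\<^sup>2\<close> to the square of
  \<open>\<Sum>k<p. b k z\<^sup>k\<close>, and modulo \<open>p\<close> the latter sum is, up to a unit of square 1, the Hasse
  invariant of the curve \<open>y\<^sup>2 = f x = x\<^sup>3 + 12 x\<^sup>2 + (18 + 8 s) x\<close>, which has complex
  multiplication by \<open>sqrt (-10)\<close>.

  An endomorphism multiplying the invariant differential by \<open>\<alpha>\<close> with \<open>\<alpha>\<^sup>2 = - 10\<close> multiplies the
  Hasse invariant by the Legendre symbol of \<open>- 10\<close>. Hence the invariant vanishes modulo \<open>p\<close>, and
  its square modulo \<open>p\<^sup>2\<close>, if \<open>- 10\<close> is not a square.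

  If \<open>p = x\<^sup>2 + 10 y\<^sup>2\<close>, let \<open>G\<close> be the generic point and \<open>H\<close> its image under \<open>sqrt (-10)\<close>, both
  points over the rational function field of the twist \<open>f(t) Y\<^sup>2 = f(X)\<close>. As in Manin's proof of
  Hasse's bound, the degree of the abscissa satisfies the parallelogram law, so
  \<open>n G + y H\<close> has height \<open>n\<^sup>2 + b n + 10 y\<^sup>2\<close> for some \<open>b\<close> with \<open>\<bar>b\<bar> < p\<close>. For a suitable sign of
  \<open>\<alpha>\<close> the point \<open>x G + y H\<close> is inseparable, so \<open>p\<close> divides its height, which forces \<open>b = 0\<close> and
  height \<open>p\<close>. Then this point is the Frobenius point up to sign, and the height
  \<open>p + 1 + 2 x\<close> of the next point counts the points of the curve: the Hasse invariant
  is \<open>\<plusminus> 2 x\<close> modulo \<open>p\<close>.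
\<close>

section \<open>Twisted elliptic curves over a field with a derivation\<close>

text \<open>The constants belong together. The equation z (1 - 64 z) = 12^-4 has discriminant 1 -
  256 / 12^4 = 80 / 81, whence sqrt 5, and B = 16 A^2 z with A = 12 gives B = 18 + 8 s. The
  2-isogenous curve is, up to a twist by - 2, the conjugate curve with 18 - 8 s; a 5-isogeny joins
  the two curves as well, and the loop formed by both isogenies is sqrt (-10). The reason for the
  twist: a point (X(t), Y(t)) of f(t) Y^2 = f(X) is the map (t, w) -> (X(t), w Y(t)) of the curve
  w^2 = f(t) to itself. Endomorphisms thus become points over a field of rational functions in one
  variable: the identity is (t, 1), Frobenius is (t^p, f^((p-1)/2)), and the degree of a map is the
  degree of a numerator. Since the degree alone does not detect inseparability, every point also
  carries its multiplier, found by differentiating the abscissa. The group law enters through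
  cancellation (P + S) - S = P, additivity of multipliers and the parallelogram law. Degenerate
  positions are avoided by working with points that have a pole at t = infinity: this class is
  closed under addition and contains no point of order two.\<close>

datatype 'k point = Infinity | Affine 'k 'k

text \<open>The derivation kills \<open>A\<close> and \<open>B\<close> but not \<open>d\<close>: in
  the application \<open>d\<close> is f(t) and \<open>der\<close> is d/dt, and the derivative of
  \<open>d\<close> has to cancel out of every statement about multipliers.\<close>

locale twisted_curve =
  fixes A B d :: "'k :: field" and der :: "'k \<Rightarrow> 'k"
  assumes two_nonzero: "(2 :: 'k) \<noteq> 0"
    and d_nonzero: "d \<noteq> 0"
    and nonsingular: "B * (A\<^sup>2 - 4 * B) \<noteq> 0"
    and der_add: "der (x + y) = der x + der y"
    and der_mult: "der (x * y) = der x * y + x * der y"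
    and der_A: "der A = 0"
    and der_B: "der B = 0"
begin

definition cubic :: "'k \<Rightarrow> 'k" where
  "cubic x = x ^ 3 + A * x\<^sup>2 + B * x"

fun on_curve :: "'k point \<Rightarrow> bool" where
  "on_curve Infinity \<longleftrightarrow> True"
| "on_curve (Affine x y) \<longleftrightarrow> d * y\<^sup>2 = cubic x"

fun neg :: "'k point \<Rightarrow> 'k point" where
  "neg Infinity = Infinity"
| "neg (Affine x y) = Affine x (- y)"

text \<open>For points of the curve, equal abscissas outside the \<open>Infinity\<close> branch of
  \<open>add\<close> mean equal points with nonzero ordinate, so the tangent slope is taken only
  where its denominator is nonzero.\<close>

definition slope :: "'k \<Rightarrow> 'k \<Rightarrow> 'k \<Rightarrow> 'k \<Rightarrow> 'k" where
  "slope x y x' y' =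
     (if x = x' then (3 * x\<^sup>2 + 2 * A * x + B) / (2 * d * y) else (y - y') / (x - x'))"

fun add :: "'k point \<Rightarrow> 'k point \<Rightarrow> 'k point" where
  "add Infinity Q = Q"
| "add P Infinity = P"
| "add (Affine x y) (Affine x' y') =
     (if x = x' \<and> y = - y' then Infinity
      else let l = slope x y x' y'; z = d * l\<^sup>2 - A - x - x' in Affine z (- (y + l * (z - x))))"

lemma add_Infinity_right [simp]: "add P Infinity = P"
  by (cases P) auto

text \<open>The line of slope \<open>l\<close> and intercept \<open>n\<close> meets the curve in three points with the given
  abscissas, counted with multiplicity (Vieta).\<close>

definition collinear :: "'k \<Rightarrow> 'k \<Rightarrow> 'k \<Rightarrow> 'k \<Rightarrow> 'k \<Rightarrow> bool" where
  "collinear l n x y z \<longleftrightarrow> d * l\<^sup>2 = A + x + y + z \<and> B - 2 * d * l * n = x * y + x * z + y * z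
     \<and> d * n\<^sup>2 = x * y * z"

text \<open>A common root of the cubic and its derivative would make the discriminant B^2 (A^2 - 4
  B) vanish.\<close>

lemma cubic_double_root:
  assumes "cubic x = 0" "3 * x\<^sup>2 + 2 * A * x + B = 0"
  shows False
proof -
  have "x * (x\<^sup>2 + A * x + B) = 0"
    using assms(1) by (simp add: cubic_def power2_eq_square power3_eq_cube algebra_simps)
  then consider "x = 0" | "x\<^sup>2 + A * x + B = 0" by auto
  then show False
  proof cases
    case 1 then show False using assms(2) nonsingular by simp
  next
    case 2
    have "x * (2 * x + A) = 0" using 2 assms(2) by Groebner_Basis.algebra
    then consider "x = 0" | "2 * x + A = 0" by auto
    then show False
    proof cases
      case 1 then show False using 2 nonsingular by simp
    next
      case 2
      then have "A\<^sup>2 - 4 * B = 0" using \<open>x\<^sup>2 + A * x + B = 0\<close> by Groebner_Basis.algebra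
      then show False using nonsingular by simp
    qed
  qed
qed

lemma same_abscissa:
  assumes "d * y\<^sup>2 = cubic x" "d * y'\<^sup>2 = cubic x"
  shows "y = y' \<or> y = - y'"
proof -
  have "d * y\<^sup>2 = d * y'\<^sup>2" using assms by simp
  then have "y\<^sup>2 = y'\<^sup>2" using d_nonzero by simp
  then show ?thesis by (simp add: power2_eq_iff)
qed

lemma neq_uminus_self:
  assumes "(y :: 'k) \<noteq> 0"
  shows "y \<noteq> - y"
proof
  assume "y = - y"
  then have "2 * y = 0" by (metis add.right_inverse mult_2)
  then show False using assms two_nonzero by simp
qed

lemma collinear_exists:
  assumes "d * y\<^sup>2 = cubic x" "d * y'\<^sup>2 = cubic x'" "\<not> (x = x' \<and> y = - y')"
  obtains l n z where "collinear l n x x' z" "y = l * x + n" "y' = l * x' + n"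
    "add (Affine x y) (Affine x' y') = Affine z (- (l * z + n))"
proof -
  define l where "l = slope x y x' y'"
  define n where "n = y - l * x"
  define z where "z = d * l\<^sup>2 - A - x - x'"
  have y: "y = l * x + n" by (simp add: n_def)
  have y': "y' = l * x' + n \<and> B - 2 * d * l * n = x * x' + x * z + x' * z \<and> d * n\<^sup>2 = x * x' * z"
  proof (cases "x = x'")
    case True
    then have yy: "y = y'" using same_abscissa assms by blast
    have y0: "y \<noteq> 0" using assms(3) True yy by auto
    have l: "l * (2 * d * y) = 3 * x\<^sup>2 + 2 * A * x + B"
      using True y0 d_nonzero two_nonzero by (simp add: l_def slope_def)
    have c: "d * y\<^sup>2 = x ^ 3 + A * x\<^sup>2 + B * x" using assms(1) by (simp add: cubic_def)
    have e2: "B - 2 * d * l * n = x * x + x * z + x * z"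
      using l y z_def True by Groebner_Basis.algebra
    have e3: "d * n\<^sup>2 = x * x * z"
      using c l y z_def True by Groebner_Basis.algebra
    show ?thesis using yy y e2 e3 True by simp
  next
    case False
    then have l: "l * (x - x') = y - y'" by (simp add: l_def slope_def)
    have y': "y' = l * x' + n" using l y by Groebner_Basis.algebra
    have c: "d * y\<^sup>2 = x ^ 3 + A * x\<^sup>2 + B * x" "d * y'\<^sup>2 = x' ^ 3 + A * x'\<^sup>2 + B * x'"
      using assms by (simp_all add: cubic_def)
    \<comment> \<open>Subtracting the two curve equations leaves a multiple of x - x', which is
      cancelled.\<close>
    have "(x - x') * (B - 2 * d * l * n - (x * x' + x * z + x' * z)) = 0"
      using c y y' z_def by Groebner_Basis.algebra
    then have e2: "B - 2 * d * l * n = x * x' + x * z + x' * z" using False by auto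
    have "d * n\<^sup>2 = x * x' * z"
      using c(1) y e2 z_def by Groebner_Basis.algebra
    then show ?thesis using e2 y' by simp
  qed
  have "collinear l n x x' z" using y' by (auto simp: collinear_def z_def)
  moreover have "add (Affine x y) (Affine x' y') = Affine z (- (l * z + n))"
  proof -
    have "- (y + l * (z - x)) = - (l * z + n)" by (simp add: n_def algebra_simps)
    then show ?thesis using assms(3) by (simp only: add.simps Let_def l_def[symmetric] z_def[symmetric] if_False)
  qed
  ultimately show ?thesis using that y y' by blast
qed

text \<open>Converse of \<open>collinear_exists\<close>: Vieta's relations determine the slope, so a
  sum can be read off from any known line, in particular from a reflected one.\<close>

lemma add_collinear:
  assumes "collinear l n x x' z" "y = l * x + n" "y' = l * x' + n" "\<not> (x = x' \<and> y = - y')"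
  shows "add (Affine x y) (Affine x' y') = Affine z (- (l * z + n))"
proof -
  have c: "d * l\<^sup>2 = A + x + x' + z" "B - 2 * d * l * n = x * x' + x * z + x' * z"
    using assms(1) by (auto simp: collinear_def)
  have l: "slope x y x' y' = l"
  proof (cases "x = x'")
    case True
    have y0: "y \<noteq> 0" using assms(2-4) True by (metis neg_0_equal_iff_equal)
    have "3 * x\<^sup>2 + 2 * A * x + B = l * (2 * d * y)"
      using c True assms(2) by Groebner_Basis.algebra
    then show ?thesis using True y0 d_nonzero two_nonzero by (simp add: slope_def)
  next
    case False
    have "y - y' = l * (x - x')" using assms by Groebner_Basis.algebra
    then show ?thesis using False by (simp add: slope_def)
  qed
  have z: "z = d * l\<^sup>2 - A - x - x'" using c(1) by simp
  show ?thesis using assms(2-4) unfolding add.simps Let_def l z[symmetric]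
    by (auto simp: algebra_simps)
qed

lemma on_curve_collinear:
  assumes "collinear l n x x' z"
  shows "d * (l * z + n)\<^sup>2 = cubic z"
  using assms unfolding collinear_def cubic_def by Groebner_Basis.algebra

lemma on_curve_neg [simp]: "on_curve (neg P) \<longleftrightarrow> on_curve P"
  by (cases P) auto

lemma on_curve_add:
  assumes "on_curve P" "on_curve Q"
  shows "on_curve (add P Q)"
proof (cases P; cases Q)
  fix x y x' y' assume P: "P = Affine x y" and Q: "Q = Affine x' y'"
  show ?thesis
  proof (cases "x = x' \<and> y = - y'")
    case False
    then obtain l n z where "collinear l n x x' z" "add P Q = Affine z (- (l * z + n))"
      using collinear_exists[of y x y' x'] assms P Q by (metis on_curve.simps(2))
    then show ?thesis using on_curve_collinear[of l n x x' z] by (simp only: on_curve.simps power2_minus)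
  qed (use P Q in auto)
qed (use assms in auto)

text \<open>Negating \<open>l\<close> and \<open>n\<close> reflects the line through P, S and -(P +
  S) into the line through P + S, -S and -P.\<close>

lemma add_cancel_right:
  assumes "on_curve P" "on_curve S"
  shows "add (add P S) (neg S) = P"
proof (cases P; cases S)
  fix x y assume P: "P = Infinity" and S: "S = Affine x y"
  show ?thesis using P S by simp
next
  fix x y x' y' assume P: "P = Affine x y" and S: "S = Affine x' y'"
  have on: "d * y\<^sup>2 = cubic x" "d * y'\<^sup>2 = cubic x'" using assms P S by auto
  show ?thesis
  proof (cases "x = x' \<and> y = - y'")
    case False
    then obtain l n z where l: "collinear l n x x' z" "y = l * x + n" "y' = l * x' + n"
        and R: "add P S = Affine z (- (l * z + n))"
      using collinear_exists[OF on] P S by metis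
    have l': "collinear (- l) (- n) z x' x"
      using l(1) unfolding collinear_def by (auto simp: algebra_simps)
    \<comment> \<open>In the exceptional case P + S = S, the point S would have ordinate 0 and the
      line would meet the curve there twice, giving a double root of the cubic.\<close>
    have "\<not> (z = x' \<and> - (l * z + n) = - (- y'))"
    proof
      assume *: "z = x' \<and> - (l * z + n) = - (- y')"
      then have "y' = - y'" using l(3) by (metis minus_minus)
      then have y0: "y' = 0" using neq_uminus_self by blast
      have "3 * x'\<^sup>2 + 2 * A * x' + B = 0"
        using l(1,3) y0 * unfolding collinear_def by Groebner_Basis.algebra
      then show False using cubic_double_root on(2) y0 by simp
    qed
    then have "add (Affine z (- (l * z + n))) (Affine x' (- y')) = Affine x (- (- l * x + - n))"
      using l by (intro add_collinear[OF l']) auto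
    then show ?thesis using R P S l by simp
  qed (use P S in auto)
qed auto

text \<open>The multiplier \<open>c\<close> is the factor by which the invariant differential of the curve is
  multiplied under pullback along the point. The value at infinity makes it additive.\<close>

fun multiplier :: "'k point \<Rightarrow> 'k \<Rightarrow> bool" where
  "multiplier Infinity c \<longleftrightarrow> c = 0"
| "multiplier (Affine x y) c \<longleftrightarrow> y \<noteq> 0 \<and> der x = c * y"

section \<open>The invariant differential under addition\<close>

lemma multiplier_neg: "multiplier P c \<Longrightarrow> multiplier (neg P) (- c)"
  by (cases P) auto

lemma der_0 [simp]: "der 0 = 0"
  using der_add[of 0 0] by (metis add.right_neutral add_cancel_right_right)

lemma der_minus: "der (- x) = - der x"
  using der_add[of x "- x"] by (simp add: eq_neg_iff_add_eq_0 add.commute)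

lemma der_diff: "der (x - y) = der x - der y"
  using der_add[of x "- y"] by (simp add: der_minus)

lemma der_power2: "der (x\<^sup>2) = 2 * x * der x"
  by (simp add: power2_eq_square der_mult algebra_simps)

lemma der_cubic: "der (cubic x) = (3 * x\<^sup>2 + 2 * A * x + B) * der x"
  by (simp add: cubic_def power2_eq_square power3_eq_cube der_add der_mult der_A der_B algebra_simps)

text \<open>Differentiating d l^2 = A + x + x' + z expresses the derivative of z by those of x, x'
  and the slope, so everything reduces to the derivative of the slope.\<close>

lemma multiplier_line:
  assumes "collinear l n x x' z" "y = l * x + n" "y' = l * x' + n"
    and "der x = c * y" "der x' = c' * y'" "y \<noteq> 0" "y' \<noteq> 0" "\<not> (x = x' \<and> y = - y')"
  shows "der z = - (c + c') * (l * z + n)"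
proof -
  have col: "d * l\<^sup>2 = A + x + x' + z" "B - 2 * d * l * n = x * x' + x * z + x' * z"
    "d * n\<^sup>2 = x * x' * z"
    using assms(1) by (auto simp: collinear_def)
  have on: "d * y\<^sup>2 = cubic x" "d * y'\<^sup>2 = cubic x'"
    using col assms(2,3) unfolding cubic_def by Groebner_Basis.algebra+
  have dy: "2 * d * der y = c * (3 * x\<^sup>2 + 2 * A * x + B) - der d * y"
    if "d * y\<^sup>2 = cubic x" "der x = c * y" "y \<noteq> 0" for x y c
  proof -
    have "der (d * y\<^sup>2) = der (cubic x)" using that by simp
    then have "y * (2 * d * der y - (c * (3 * x\<^sup>2 + 2 * A * x + B) - der d * y)) = 0"
      by (simp only: der_mult der_power2 der_cubic that(2)) Groebner_Basis.algebra
    then show ?thesis using that by simp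
  qed
  note dy1 = dy[OF on(1) assms(4,6)] and dy2 = dy[OF on(2) assms(5,7)]
  \<comment> \<open>The left side times \<open>l\<close> is the derivative of d l^2. For distinct
    abscissas the chord equation is differentiated, in the tangent case the equation 3 x^2 + 2 A x +
    B = 2 d l y.\<close>
  have g: "der d * l + 2 * d * der l = c * (x - z) + c' * (x' - z)"
  proof (cases "x = x'")
    case True
    have "y = y'" using True assms by auto
    then have cc: "c = c'" using assms True by auto
    have e: "3 * x\<^sup>2 + 2 * A * x + B = 2 * (d * (l * y))"
      using col True assms(2) by Groebner_Basis.algebra
    have e1: "2 * d * der y = c * (2 * (d * (l * y))) - der d * y"
      using dy1 unfolding e .
    have "der (3 * x\<^sup>2 + 2 * A * x + B) = (6 * x + 2 * A) * der x"
    proof -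
      have *: "3 * x\<^sup>2 + 2 * A * x + B = x\<^sup>2 + x\<^sup>2 + x\<^sup>2 + (A * x + A * x) + B"
        by Groebner_Basis.algebra
      show ?thesis unfolding * by (simp only: der_add der_mult der_power2 der_A der_B) Groebner_Basis.algebra
    qed
    moreover have "der (2 * (d * (l * y))) = 2 * der d * l * y + 2 * d * der l * y + l * (2 * d * der y)"
    proof -
      have *: "2 * (d * (l * y)) = d * (l * y) + d * (l * y)" by (rule mult_2)
      show ?thesis unfolding * by (simp only: der_add der_mult) Groebner_Basis.algebra
    qed
    ultimately have "(6 * x + 2 * A) * (c * y)
        = 2 * der d * l * y + 2 * d * der l * y + l * (c * (2 * (d * (l * y))) - der d * y)"
      unfolding e e1 assms(4) by metis
    then have "y * ((6 * x + 2 * A) * c) = y * (der d * l + 2 * d * der l + 2 * c * (d * l\<^sup>2))"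
      by Groebner_Basis.algebra
    then have "(6 * x + 2 * A) * c = der d * l + 2 * d * der l + 2 * c * (d * l\<^sup>2)"
      using assms(6) by simp
    then have "der d * l + 2 * d * der l = (6 * x + 2 * A) * c - 2 * c * (A + x + x' + z)"
      unfolding col(1) by (simp add: algebra_simps)
    then show ?thesis unfolding cc[symmetric] True[symmetric] by Groebner_Basis.algebra
  next
    case False
    have "der (l * x + n - (l * x' + n)) = der y - der y'"
      using assms(2,3) der_diff by metis
    then have "der (l * (x - x')) = der y - der y'" by (simp add: algebra_simps)
    then have "der l * (x - x') + l * (c * y - c' * y') = der y - der y'"
      by (simp only: der_mult der_diff assms(4,5))
    then have "2 * d * der l * (x - x') = 2 * d * der y - 2 * d * der y' - 2 * d * l * (c * y - c' * y')"
      by Groebner_Basis.algebra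
    also have "\<dots> = c * (3 * x\<^sup>2 + 2 * A * x + B - 2 * d * l * y)
        - c' * (3 * x'\<^sup>2 + 2 * A * x' + B - 2 * d * l * y') - der d * (y - y')"
      unfolding dy1 dy2 by (simp add: algebra_simps)
    also have "3 * x\<^sup>2 + 2 * A * x + B - 2 * d * l * y = (x - x') * (x - z)"
      unfolding assms(2) using col(1,2) by Groebner_Basis.algebra
    also have "3 * x'\<^sup>2 + 2 * A * x' + B - 2 * d * l * y' = (x' - x) * (x' - z)"
      unfolding assms(3) using col(1,2) by Groebner_Basis.algebra
    also have "y - y' = l * (x - x')" unfolding assms(2,3) by (simp add: algebra_simps)
    finally have "(x - x') * (der d * l + 2 * d * der l) = (x - x') * (c * (x - z) + c' * (x' - z))"
      by (simp add: algebra_simps)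
    then show ?thesis using False by simp
  qed
  have "der (d * l\<^sup>2) = der (A + x + x' + z)" using col by simp
  then have "der d * l\<^sup>2 + d * (2 * l * der l) = c * y + c' * y' + der z"
    by (simp only: der_mult der_power2 der_add der_A assms(4,5)) simp
  then have "der z = l * (der d * l + 2 * d * der l) - c * y - c' * y'" by Groebner_Basis.algebra
  then show ?thesis unfolding g assms(2,3) by Groebner_Basis.algebra
qed

text \<open>The last hypothesis excludes sums of order two, at which \<open>multiplier\<close> is
  false by definition. Polar points satisfy it by \<open>polar_ordinate_nonzero\<close>.\<close>

lemma multiplier_add:
  assumes "on_curve P" "on_curve S" "multiplier P c" "multiplier S c'"
    and "\<And>x. add P S \<noteq> Affine x 0"
  shows "multiplier (add P S) (c + c')"
proof (cases P; cases S)
  fix x y x' y' assume P: "P = Affine x y" and S: "S = Affine x' y'"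
  have on: "d * y\<^sup>2 = cubic x" "d * y'\<^sup>2 = cubic x'" using assms P S by auto
  have m: "der x = c * y" "der x' = c' * y'" "y \<noteq> 0" "y' \<noteq> 0" using assms P S by auto
  show ?thesis
  proof (cases "x = x' \<and> y = - y'")
    case True
    have "c * y = c' * y'" using True m(1,2) by simp
    then have "y' * (c + c') = 0" using True by Groebner_Basis.algebra
    then have "c + c' = 0" using m(4) by simp
    moreover have "add P S = Infinity" using True P S by simp
    ultimately show ?thesis by simp
  next
    case False
    then obtain l n z where l: "collinear l n x x' z" "y = l * x + n" "y' = l * x' + n"
        and R: "add P S = Affine z (- (l * z + n))"
      using collinear_exists[OF on] P S by metis
    have "der z = - (c + c') * (l * z + n)"
      by (rule multiplier_line[OF l m False])
    moreover have "- (l * z + n) \<noteq> 0" using R assms(5) by metis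
    ultimately show ?thesis unfolding R by (simp add: algebra_simps)
  qed
qed (use assms in auto)

text \<open>After multiplication by (x - x')^2 the abscissas of P + S and P - S differ only in the
  sign of the term in y y'. Their symmetric functions therefore contain the ordinates only through d
  y^2 and d y'^2, which the curve equation eliminates.\<close>

lemma parallelogram_distinct:
  assumes "d * y\<^sup>2 = cubic x" "d * y'\<^sup>2 = cubic x'" "x \<noteq> x'"
    and "add (Affine x y) (Affine x' y') = Affine u v"
    and "add (Affine x y) (neg (Affine x' y')) = Affine u' v'"
  shows "(x - x')\<^sup>2 * (u + u') = 2 * ((x * x' + B) * (x + x') + 2 * A * x * x')"
    and "(x - x')\<^sup>2 * (u * u') = (x * x' - B)\<^sup>2"
proof -
  define l l' where "l = (y - y') / (x - x')" and "l' = (y + y') / (x - x')"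
  have l: "l * (x - x') = y - y'" "l' * (x - x') = y + y'"
    using assms(3) by (auto simp: l_def l'_def)
  have u: "u = d * l\<^sup>2 - A - x - x'" "u' = d * l'\<^sup>2 - A - x - x'"
    using assms(3-5) by (auto simp: Let_def slope_def l_def l'_def)
  have c: "d * y\<^sup>2 = x ^ 3 + A * x\<^sup>2 + B * x" "d * y'\<^sup>2 = x' ^ 3 + A * x'\<^sup>2 + B * x'"
    using assms by (auto simp: cubic_def)
  define D where "D = x - x'"
  have uD: "D\<^sup>2 * u = d * (y - y')\<^sup>2 - (A + x + x') * D\<^sup>2" "D\<^sup>2 * u' = d * (y + y')\<^sup>2 - (A + x + x') * D\<^sup>2"
    using l u unfolding D_def by Groebner_Basis.algebra+
  show "(x - x')\<^sup>2 * (u + u') = 2 * ((x * x' + B) * (x + x') + 2 * A * x * x')"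
    using uD c unfolding D_def by Groebner_Basis.algebra
  have "D\<^sup>2 * (D\<^sup>2 * (u * u')) = (D\<^sup>2 * u) * (D\<^sup>2 * u')" by (simp add: algebra_simps)
  also have "\<dots> = (d * y\<^sup>2 - d * y'\<^sup>2)\<^sup>2 - 2 * ((A + x + x') * D\<^sup>2) * (d * y\<^sup>2 + d * y'\<^sup>2)
      + ((A + x + x') * D\<^sup>2)\<^sup>2"
    unfolding uD by Groebner_Basis.algebra
  also have "\<dots> = D\<^sup>2 * (x * x' - B)\<^sup>2"
    unfolding c D_def by Groebner_Basis.algebra
  finally have "D\<^sup>2 * ((x - x')\<^sup>2 * (u * u') - (x * x' - B)\<^sup>2) = 0"
    unfolding D_def by (simp add: algebra_simps)
  then show "(x - x')\<^sup>2 * (u * u') = (x * x' - B)\<^sup>2"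
    using assms(3) by (simp add: D_def)
qed

text \<open>The duplication formula, which replaces the parallelogram formulas when the two
  abscissas agree.\<close>

lemma double_abscissa:
  assumes "d * y\<^sup>2 = cubic x" "y \<noteq> 0" "add (Affine x y) (Affine x y) = Affine u v"
  shows "4 * cubic x * u = (x\<^sup>2 - B)\<^sup>2"
proof -
  obtain l n z where l: "collinear l n x x z" "y = l * x + n"
    and R: "add (Affine x y) (Affine x y) = Affine z (- (l * z + n))"
    using collinear_exists[OF assms(1,1)] neq_uminus_self[OF assms(2)] by metis
  have "u = z" using R assms(3) by simp
  have c: "B - 2 * d * l * n = x * x + x * u + x * u" "d * n\<^sup>2 = x * x * u"
    using l(1) \<open>u = z\<close> by (auto simp: collinear_def)
  have "4 * (d * y\<^sup>2) * u = 4 * ((d * l\<^sup>2) * (x * x * u) + 2 * d * l * n * x * u + (d * n\<^sup>2) * u)"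
    unfolding l(2) by Groebner_Basis.algebra
  also have "\<dots> = 4 * ((d * l\<^sup>2) * (d * n\<^sup>2) + 2 * d * l * n * x * u + (x * x * u) * u)"
    by (simp only: c(2))
  also have "\<dots> = 4 * (d * l * n + x * u)\<^sup>2" by Groebner_Basis.algebra
  also have "\<dots> = (x\<^sup>2 - B)\<^sup>2" using c(1) by Groebner_Basis.algebra
  finally show ?thesis using assms(1) by simp
qed

end

section \<open>Rational functions\<close>

definition fract_deriv :: "'a :: field_gcd poly fract \<Rightarrow> 'a poly fract" where
  "fract_deriv q = (case quot_of_fract q of (a, b) \<Rightarrow>
     to_fract (pderiv a * b - a * pderiv b) / to_fract (b\<^sup>2))"

text \<open>The quotient rule is valid for every representation, not just the reduced one in the
  definition: the relation u b = a v together with its derivative identifies the two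
  quotients.\<close>

lemma fract_deriv_divide:
  assumes "b \<noteq> 0"
  shows "fract_deriv (to_fract a / to_fract b)
    = to_fract (pderiv a * b - a * pderiv b) / to_fract (b\<^sup>2)"
proof -
  define q where "q = to_fract a / to_fract b"
  obtain u v where uv: "quot_of_fract q = (u, v)" by (cases "quot_of_fract q")
  have v: "v \<noteq> 0" using uv snd_quot_of_fract_nonzero[of q] by simp
  have "to_fract u / to_fract v = to_fract a / to_fract b"
    using uv to_fract_quot_of_fract[of q] Fract_quot_of_fract[of q]
    by (simp add: q_def Fract_conv_to_fract)
  then have "to_fract (u * b) = to_fract (a * v)" using assms v by (simp add: field_simps)
  then have e: "u * b = a * v" by (simp only: to_fract_eq_iff)
  then have "pderiv (u * b) = pderiv (a * v)" by simp
  then have e': "u * pderiv b + b * pderiv u = a * pderiv v + v * pderiv a"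
    by (simp add: pderiv_mult algebra_simps)
  have "b * v * ((pderiv u * v - u * pderiv v) * b\<^sup>2 - (pderiv a * b - a * pderiv b) * v\<^sup>2) = 0"
    using e e' by Groebner_Basis.algebra
  then have "(pderiv u * v - u * pderiv v) * b\<^sup>2 = (pderiv a * b - a * pderiv b) * v\<^sup>2"
    using assms v by simp
  then have "to_fract ((pderiv u * v - u * pderiv v) * b\<^sup>2) = to_fract ((pderiv a * b - a * pderiv b) * v\<^sup>2)"
    by simp
  then show ?thesis
    using assms v uv unfolding fract_deriv_def q_def[symmetric]
    by (simp add: frac_eq_eq del: to_fract_diff)
qed

lemma fract_cases:
  obtains a b where "q = to_fract a / to_fract b" "b \<noteq> 0"
  by (cases q rule: Fract_cases) (auto simp: Fract_conv_to_fract)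

lemma fract_deriv_to_fract: "fract_deriv (to_fract a) = to_fract (pderiv a)"
  using fract_deriv_divide[of 1 a] by simp

lemma fract_deriv_add: "fract_deriv (x + y) = fract_deriv x + fract_deriv y"
proof (cases x rule: fract_cases; cases y rule: fract_cases)
  fix a b c d :: "'a poly"
  assume x: "x = to_fract a / to_fract b" "b \<noteq> 0" and y: "y = to_fract c / to_fract d" "d \<noteq> 0"
  have s: "x + y = to_fract (a * d + b * c) / to_fract (b * d)"
    using x y by (simp add: field_simps)
  have "pderiv (a * d + b * c) * (b * d) - (a * d + b * c) * pderiv (b * d)
      = (pderiv a * b - a * pderiv b) * d\<^sup>2 + (pderiv c * d - c * pderiv d) * b\<^sup>2"
    by (simp add: pderiv_mult pderiv_add power2_eq_square algebra_simps)
  then have "fract_deriv (x + y) =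
      to_fract ((pderiv a * b - a * pderiv b) * d\<^sup>2 + (pderiv c * d - c * pderiv d) * b\<^sup>2) / to_fract ((b * d)\<^sup>2)"
    using x y unfolding s by (subst fract_deriv_divide) (auto simp del: to_fract_diff to_fract_add to_fract_mult)
  also have "\<dots> = fract_deriv x + fract_deriv y"
    using x(2) y(2) unfolding x(1) y(1) by (simp add: fract_deriv_divide field_simps power2_eq_square)
  finally show ?thesis .
qed

lemma fract_deriv_mult: "fract_deriv (x * y) = fract_deriv x * y + x * fract_deriv y"
proof (cases x rule: fract_cases; cases y rule: fract_cases)
  fix a b c d :: "'a poly"
  assume x: "x = to_fract a / to_fract b" "b \<noteq> 0" and y: "y = to_fract c / to_fract d" "d \<noteq> 0"
  have s: "x * y = to_fract (a * c) / to_fract (b * d)"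
    using x y by (simp add: field_simps)
  have "pderiv (a * c) * (b * d) - (a * c) * pderiv (b * d)
      = (pderiv a * b - a * pderiv b) * c * d + (pderiv c * d - c * pderiv d) * a * b"
    by (simp add: pderiv_mult pderiv_add power2_eq_square algebra_simps)
  then have "fract_deriv (x * y) =
      to_fract ((pderiv a * b - a * pderiv b) * c * d + (pderiv c * d - c * pderiv d) * a * b) / to_fract ((b * d)\<^sup>2)"
    using x y unfolding s by (subst fract_deriv_divide) (auto simp del: to_fract_diff to_fract_add to_fract_mult)
  also have "\<dots> = fract_deriv x * y + x * fract_deriv y"
    using x(2) y(2) unfolding x(1) y(1) by (simp add: fract_deriv_divide field_simps power2_eq_square)
  finally show ?thesis .
qed

section \<open>Primitive triples of polynomials\<close>

lemma normalize_eq_if_proportional: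
  fixes u1 u2 u3 v1 v2 v3 :: "'a :: field_gcd poly"
  assumes "gcd u1 (gcd u2 u3) = 1" "gcd v1 (gcd v2 v3) = 1"
    and "u1 * v2 = u2 * v1" "u1 * v3 = u3 * v1" "u2 * v3 = u3 * v2"
  shows "normalize u1 = normalize v1" "normalize u2 = normalize v2" "normalize u3 = normalize v3"
proof -
  have g: "normalize (w * gcd a (gcd b c)) = gcd (w * a) (gcd (w * b) (w * c))" for w a b c :: "'a poly"
    by (simp add: gcd_mult_left)
  \<comment> \<open>A primitive triple multiplied by x has gcd x up to units. By proportionality,
    u_i times the triple v has the same entries as v_i times the triple u.\<close>
  have n: "normalize x = gcd (x * a) (gcd (x * b) (x * c))"
    if "gcd a (gcd b c) = 1" for x a b c :: "'a poly"
    using g[of x a b c] that by simp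
  show "normalize u1 = normalize v1"
    using n[OF assms(1), of v1] n[OF assms(2), of u1] assms(3-5) by (simp add: mult.commute)
  show "normalize u2 = normalize v2"
    using n[OF assms(1), of v2] n[OF assms(2), of u2] assms(3-5) by (simp add: mult.commute)
  show "normalize u3 = normalize v3"
    using n[OF assms(1), of v3] n[OF assms(2), of u3] assms(3-5) by (simp add: mult.commute)
qed

lemma degree_normalize_poly: "degree (normalize p) = degree (p :: 'a :: field_gcd poly)"
proof (cases "p = 0")
  case False
  then show ?thesis by (intro antisym dvd_imp_degree_le) auto
qed simp

lemma gcd3_eq_1I:
  fixes u v w :: "'a :: field_gcd poly"
  assumes "\<And>q. prime q \<Longrightarrow> q dvd u \<Longrightarrow> q dvd v \<Longrightarrow> q dvd w \<Longrightarrow> False" "u \<noteq> 0"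
  shows "gcd u (gcd v w) = 1"
proof (rule ccontr)
  assume "gcd u (gcd v w) \<noteq> 1"
  then have "\<not> is_unit (gcd u (gcd v w))" using is_unit_gcd_iff by blast
  moreover have "gcd u (gcd v w) \<noteq> 0" using assms(2) by simp
  ultimately obtain q where "q dvd gcd u (gcd v w)" "prime q" using prime_divisor_exists by blast
  then show False using assms(1)[of q] by simp
qed

lemma prime_dvd_coprime:
  fixes a b q :: "'a :: field_gcd poly"
  assumes "prime q" "coprime a b" "q dvd a" "q dvd b"
  shows False
  using assms coprime_common_divisor not_prime_unit by blast

text \<open>Gauss's lemma: the three entries are the coefficients of (a + b T) (c + e T), a product
  of two primitive polynomials in T.\<close>

lemma gcd_product_triple:
  fixes a b c e :: "'a :: field_gcd poly"
  assumes "coprime a b" "coprime c e" "a * c \<noteq> 0"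
  shows "gcd (a * c) (gcd (a * e + b * c) (b * e)) = 1"
proof (rule gcd3_eq_1I[OF _ assms(3)])
  fix q assume q: "prime q" "q dvd a * c" "q dvd a * e + b * c" "q dvd b * e"
  note pd = prime_dvd_mult_iff[OF q(1)]
  from q(2) have "q dvd a \<or> q dvd c" by (simp add: pd)
  then show False
  proof
    assume qa: "q dvd a"
    then have "q dvd b * c" using q(3) by (simp add: dvd_add_right_iff)
    moreover have "\<not> q dvd b" using prime_dvd_coprime[OF q(1) assms(1) qa] by blast
    ultimately have "q dvd c" "q dvd e" using q(4) by (auto simp: pd)
    then show False using prime_dvd_coprime[OF q(1) assms(2)] by blast
  next
    assume qc: "q dvd c"
    then have "q dvd a * e" using q(3) by (simp add: dvd_add_left_iff)
    moreover have "\<not> q dvd e" using prime_dvd_coprime[OF q(1) assms(2) qc] by blast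
    ultimately have "q dvd a" "q dvd b" using q(4) by (auto simp: pd)
    then show False using prime_dvd_coprime[OF q(1) assms(1)] by blast
  qed
qed

text \<open>Modulo a common prime factor the first and the last form give a e = b c and c^2 = B e^2.
  The middle form then becomes 4 b^2 c (2 B e + A c), with b and c nonzero, and together these force
  (A^2 - 4 B) c^2 = 0, against the discriminant.\<close>

lemma gcd_parallelogram_triple:
  fixes a b c e :: "'a :: field_gcd poly" and A B :: 'a
  assumes "coprime a b" "coprime c e" "B * (A\<^sup>2 - 4 * B) \<noteq> 0" "(2 :: 'a) \<noteq> 0"
    and "a * c - [:B:] * b * e \<noteq> 0"
  shows "gcd ((a * c - [:B:] * b * e)\<^sup>2)
    (gcd (2 * ((a * c + [:B:] * b * e) * (a * e + b * c) + 2 * [:A:] * a * b * c * e)) ((a * e - b * c)\<^sup>2)) = 1"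
proof (rule gcd3_eq_1I)
  fix q assume q: "prime q" "q dvd (a * c - [:B:] * b * e)\<^sup>2" "q dvd (a * e - b * c)\<^sup>2"
    "q dvd 2 * ((a * c + [:B:] * b * e) * (a * e + b * c) + 2 * [:A:] * a * b * c * e)"
  note pd = prime_dvd_mult_iff[OF q(1)]
  have unit: "\<not> q dvd [:k:]" if "k \<noteq> 0" for k
    using that q(1) by (metis is_unit_pCons_iff dvd_trans not_prime_unit is_unit_const_poly_iff dvd_field_iff)
  have "q dvd a * c - [:B:] * b * e" using q(1,2) prime_dvd_power by blast
  then obtain r where r: "a * c - [:B:] * b * e = q * r" by (elim dvdE)
  have "q dvd a * e - b * c" using q(1,3) prime_dvd_power by blast
  then obtain s where s: "a * e - b * c = q * s" by (elim dvdE)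
  have "b * (c\<^sup>2 - [:B:] * e\<^sup>2) = q * (r * e - s * c)" using r s by Groebner_Basis.algebra
  then have 1: "q dvd b * (c\<^sup>2 - [:B:] * e\<^sup>2)" by simp
  have "a * (c\<^sup>2 - [:B:] * e\<^sup>2) = q * (r * c - [:B:] * e * s)" using r s by Groebner_Basis.algebra
  then have 2: "q dvd a * (c\<^sup>2 - [:B:] * e\<^sup>2)" by simp
  have "q dvd c\<^sup>2 - [:B:] * e\<^sup>2"
    using 1 2 prime_dvd_coprime[OF q(1) assms(1)] by (auto simp: pd)
  then obtain t where t: "c\<^sup>2 - [:B:] * e\<^sup>2 = q * t" by (elim dvdE)
  have B0: "B \<noteq> 0" using assms(3) by auto
  have c: "\<not> q dvd c"
  proof
    assume "q dvd c"
    then have "q dvd [:B:] * e\<^sup>2" using \<open>q dvd c\<^sup>2 - [:B:] * e\<^sup>2\<close>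
      by (metis dvd_diff_right_iff dvd_power dvd_trans zero_less_numeral dvd_diff_commute)
    then have "q dvd e\<^sup>2" using unit[OF B0] pd by blast
    then have "q dvd e" using q(1) prime_dvd_power by blast
    then show False using \<open>q dvd c\<close> prime_dvd_coprime[OF q(1) assms(2)] by blast
  qed
  have b: "\<not> q dvd b"
  proof
    assume "q dvd b"
    then have "q dvd a * e" "q dvd a * c"
      using r s by (metis dvd_add_right_iff dvd_mult dvd_mult2 dvd_triv_left diff_add_cancel mult.assoc)+
    then show False using c \<open>q dvd b\<close> prime_dvd_coprime[OF q(1) assms(1)] pd by blast
  qed
  have "2 * ((a * c + [:B:] * b * e) * (a * e + b * c) + 2 * [:A:] * a * b * c * e)
    = 4 * (b\<^sup>2 * c * (2 * [:B:] * e + [:A:] * c))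
      + q * (2 * (2 * [:B:] * b * e * s + r * (a * e + b * c) + 2 * [:A:] * b * c * s))"
    using r s by Groebner_Basis.algebra
  then have "q dvd 4 * (b\<^sup>2 * c * (2 * [:B:] * e + [:A:] * c))"
    using q(4) by (metis dvd_add_left_iff dvd_triv_left)
  moreover have "(4 :: 'a poly) = [:2 * 2:]" by (simp add: numeral_poly)
  ultimately have "q dvd 2 * [:B:] * e + [:A:] * c"
    using unit[of "2 * 2"] assms(4) b c q(1) by (metis mult_eq_0_iff pd prime_dvd_power)
  then obtain w where w: "2 * [:B:] * e + [:A:] * c = q * w" by (elim dvdE)
  have AB: "[:A\<^sup>2 - 4 * B:] = [:A:]\<^sup>2 - 4 * [:B:]"
    by (simp add: power2_eq_square numeral_poly)
  have "([:A:]\<^sup>2 - 4 * [:B:]) * c\<^sup>2 = q * (w * ([:A:] * c - 2 * [:B:] * e) - 4 * [:B:] * t)"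
    using w t by Groebner_Basis.algebra
  then have "q dvd [:A\<^sup>2 - 4 * B:] * c\<^sup>2" unfolding AB by simp
  moreover have "A\<^sup>2 - 4 * B \<noteq> 0" using assms(3) by auto
  ultimately have "q dvd c\<^sup>2" using unit pd by blast
  then show False using c q(1) prime_dvd_power by blast
qed (use assms(5) in auto)

section \<open>Heights\<close>

lemma const_poly_fract_deriv: "fract_deriv (to_fract [:c:]) = 0"
  by (simp add: fract_deriv_to_fract pderiv_pCons)

text \<open>\<open>Infinity\<close> has the homogeneous abscissa (1 : 0), so that the forms below
  also apply to it.\<close>

fun num :: "'a :: field_gcd poly fract point \<Rightarrow> 'a poly" where
  "num Infinity = 1"
| "num (Affine x y) = fst (quot_of_fract x)"

fun den :: "'a :: field_gcd poly fract point \<Rightarrow> 'a poly" where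
  "den Infinity = 0"
| "den (Affine x y) = snd (quot_of_fract x)"

definition height :: "'a :: field_gcd poly fract point \<Rightarrow> nat" where
  "height P = degree (num P)"

text \<open>Points that reduce to the point at infinity at the place \<open>t = \<infinity>\<close>. For them the height
  is the degree of the numerator alone.\<close>

definition polar :: "'a :: field_gcd poly fract point \<Rightarrow> bool" where
  "polar P \<longleftrightarrow> den P = 0 \<or> degree (den P) < degree (num P)"

lemma coprime_num_den: "coprime (num P) (den P)"
  by (cases P) (auto simp: coprime_quot_of_fract)

lemma den_Affine_nonzero: "den (Affine x y) \<noteq> 0"
  by simp

lemma Affine_abscissa: "x = to_fract (num (Affine x y)) / to_fract (den (Affine x y))"
  using Fract_quot_of_fract[of x] by (simp add: Fract_conv_to_fract)

lemma abscissa_times_den: "x * to_fract (den (Affine x y)) = to_fract (num (Affine x y))"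
  using Affine_abscissa[of x y] den_Affine_nonzero[of x y]
  by (metis nonzero_divide_eq_eq to_fract_eq_0_iff)

lemma degree_num_den:
  assumes "x = to_fract a / to_fract b" "coprime a b" "b \<noteq> 0"
  shows "degree (num (Affine x y)) = degree a" "degree (den (Affine x y)) = degree b"
proof -
  define u v where "u = num (Affine x y)" and "v = den (Affine x y)"
  have v: "v \<noteq> 0" and c: "coprime u v" using coprime_num_den[of "Affine x y"] by (auto simp: u_def v_def)
  have "to_fract u / to_fract v = to_fract a / to_fract b"
    using Affine_abscissa[of x y] assms(1) by (simp add: u_def v_def)
  then have "to_fract (u * b) = to_fract (a * v)" using v assms(3) by (simp add: frac_eq_eq)
  then have e: "u * b = a * v" by (simp only: to_fract_eq_iff)
  have "b dvd v"
    using e assms(2) by (metis coprime_commute coprime_dvd_mult_right_iff dvd_triv_right)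
  moreover have "v dvd b"
    using e c by (metis coprime_commute coprime_dvd_mult_right_iff dvd_triv_right)
  ultimately show d: "degree v = degree b" using v assms(3) by (intro antisym dvd_imp_degree_le) auto
  show "degree u = degree a"
  proof (cases "u = 0")
    case True
    then show ?thesis using e v by auto
  next
    case False
    then have "a \<noteq> 0" using e assms(3) by auto
    then show ?thesis using arg_cong[OF e, of degree] d False v assms(3) by (simp add: degree_mult_eq)
  qed
qed

locale twisted_by_itself =
  fixes A B :: "'a :: field_gcd"
  assumes char_not_2: "(2 :: 'a) \<noteq> 0"
    and disc_nonzero: "B * (A\<^sup>2 - 4 * B) \<noteq> 0"
begin

definition f :: "'a poly" where "f = [:0, B, A, 1:]"

lemma f_nonzero: "f \<noteq> 0"
  by (simp add: f_def)

sublocale twisted_curve "to_fract [:A:]" "to_fract [:B:]" "to_fract f" fract_deriv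
proof
  have two: "(2 :: 'a poly) = [:2:]" by (simp add: numeral_poly)
  have four: "(4 :: 'a poly) = [:4:]" by (simp add: numeral_poly)
  have "(2 :: 'a poly) \<noteq> 0" unfolding two using char_not_2 by simp
  then have "to_fract (2 :: 'a poly) \<noteq> 0" by simp
  then show "(2 :: 'a poly fract) \<noteq> 0"
    by (metis one_add_one to_fract_1 to_fract_add)
  show "to_fract f \<noteq> 0" by (simp add: f_nonzero)
  have "to_fract ([:B:] * ([:A:]\<^sup>2 - 4 * [:B:])) \<noteq> 0"
    using disc_nonzero by (simp add: four power2_eq_square mult.commute del: to_fract_mult to_fract_diff)
  moreover have four': "to_fract (4 :: 'a poly) = 4"
    by (metis numeral_Bit0 one_add_one to_fract_1 to_fract_add)
  ultimately show "to_fract [:B:] * ((to_fract [:A:])\<^sup>2 - 4 * to_fract [:B:]) \<noteq> 0"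
    by (simp only: to_fract_mult to_fract_diff power2_eq_square four' not_False_eq_True)
qed (simp_all add: fract_deriv_add fract_deriv_mult const_poly_fract_deriv)

lemma to_fract_numeral_2: "to_fract (2 :: 'a poly) = 2"
  by (metis one_add_one to_fract_1 to_fract_add)

lemma to_fract_numeral_4: "to_fract (4 :: 'a poly) = 4"
  by (metis numeral_Bit0 one_add_one to_fract_1 to_fract_add)

lemma to_fract_power: "to_fract (x ^ n) = to_fract x ^ n" for x :: "'a poly"
  by (induction n) simp_all

lemmas to_fract_hom = to_fract_mult to_fract_add to_fract_diff to_fract_power
  to_fract_numeral_2 to_fract_numeral_4

text \<open>A zero ordinate makes the abscissa a root of a monic cubic with constant coefficients.
  For a / b with deg b < deg a, the term a^3 of the cleared equation has strictly the largest
  degree.\<close>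

lemma polar_ordinate_nonzero:
  assumes "on_curve (Affine x y)" "polar (Affine x y)"
  shows "y \<noteq> 0"
proof
  assume "y = 0"
  define a b where "a = num (Affine x y)" and "b = den (Affine x y)"
  have b: "b \<noteq> 0" "degree b < degree a" using assms(2) by (auto simp: a_def b_def polar_def)
  have x: "x * to_fract b = to_fract a" using abscissa_times_den[of x y] by (simp only: a_def b_def)
  have "x ^ 3 + to_fract [:A:] * x\<^sup>2 + to_fract [:B:] * x = 0"
    using assms(1) \<open>y = 0\<close> by (simp add: cubic_def)
  then have "(x * to_fract b) * ((x * to_fract b)\<^sup>2 + to_fract b * (to_fract [:A:] * (x * to_fract b) + to_fract [:B:] * to_fract b)) = 0"
    by Groebner_Basis.algebra
  then have "to_fract (a * (a\<^sup>2 + b * ([:A:] * a + [:B:] * b))) = 0"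
    unfolding x by (simp only: to_fract_hom)
  then have "a * (a\<^sup>2 + b * ([:A:] * a + [:B:] * b)) = 0" by (simp only: to_fract_eq_0_iff)
  moreover have "a \<noteq> 0" using b(2) by auto
  ultimately have "a\<^sup>2 = - (b * ([:A:] * a + [:B:] * b))" by (simp add: eq_neg_iff_add_eq_0)
  then have "degree (a\<^sup>2) = degree (b * ([:A:] * a + [:B:] * b))" by simp
  also have "\<dots> \<le> degree b + degree (smult A a + smult B b)"
    using degree_mult_le[of b "smult A a + smult B b"] by simp
  also have "degree (smult A a + smult B b) \<le> degree a"
    using b(2) degree_smult_le[of A a] degree_smult_le[of B b] by (intro degree_add_le) auto
  finally show False using b(2) \<open>a \<noteq> 0\<close> by (simp add: power2_eq_square degree_mult_eq)
qed

lemma num_den_neg [simp]: "num (neg P) = num P" "den (neg P) = den P"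
  by (cases P; simp)+

lemma height_neg [simp]: "height (neg P) = height P"
  by (simp add: height_def)

lemma polar_neg [simp]: "polar (neg P) \<longleftrightarrow> polar P"
  by (simp add: polar_def)

text \<open>If \<open>P\<close> and \<open>S\<close> have abscissas \<open>a / b\<close> and \<open>c / e\<close>, the product and the sum of the
  abscissas of \<open>P + S\<close> and \<open>P - S\<close> have these numerators over the denominator
  \<open>(a e - b c)\<^sup>2\<close>. The three forms have no common prime factor.\<close>

definition product_form :: "'a poly \<Rightarrow> 'a poly \<Rightarrow> 'a poly \<Rightarrow> 'a poly \<Rightarrow> 'a poly" where
  "product_form a b c e = (a * c - [:B:] * b * e)\<^sup>2"

definition sum_form :: "'a poly \<Rightarrow> 'a poly \<Rightarrow> 'a poly \<Rightarrow> 'a poly \<Rightarrow> 'a poly" where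
  "sum_form a b c e = 2 * ((a * c + [:B:] * b * e) * (a * e + b * c) + 2 * [:A:] * a * b * c * e)"

lemma proportional_double:
  assumes "on_curve (Affine x y)" "y \<noteq> 0"
    and "add (Affine x y) (Affine x y) = Q" "num (Affine x y) = a" "den (Affine x y) = b"
  shows "num Q * sum_form a b a b = den Q * product_form a b a b"
proof -
  obtain l n z where R: "Q = Affine z (- (l * z + n))"
    using collinear_exists[of y x y x] neq_uminus_self[OF assms(2)] assms(1,3)
    by (metis on_curve.simps(2))
  have b: "b \<noteq> 0" using assms(5) by auto
  have x: "x * to_fract b = to_fract a" using abscissa_times_den[of x y] assms(4,5) by simp
  define a1 b1 where "a1 = num Q" and "b1 = den Q"
  have b1: "b1 \<noteq> 0" using R by (simp add: b1_def)
  have z: "z * to_fract b1 = to_fract a1" using abscissa_times_den[of z] R by (simp only: a1_def b1_def)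
  have "4 * cubic x * z = (x\<^sup>2 - to_fract [:B:])\<^sup>2"
    using double_abscissa[of y x z] assms(1-3) R by simp
  then have "4 * ((x * to_fract b) * ((x * to_fract b)\<^sup>2 * to_fract b + to_fract [:A:] * (x * to_fract b) * to_fract b * to_fract b
      + to_fract [:B:] * to_fract b * to_fract b * to_fract b)) * (z * to_fract b1)
    = ((x * to_fract b)\<^sup>2 - to_fract [:B:] * (to_fract b)\<^sup>2)\<^sup>2 * to_fract b1"
    unfolding cubic_def by Groebner_Basis.algebra
  then have "to_fract (4 * (a * (a\<^sup>2 * b + [:A:] * a * b * b + [:B:] * b * b * b)) * a1)
    = to_fract ((a\<^sup>2 - [:B:] * b\<^sup>2)\<^sup>2 * b1)"
    unfolding x z by (simp only: to_fract_hom)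
  then have "4 * (a * (a\<^sup>2 * b + [:A:] * a * b * b + [:B:] * b * b * b)) * a1 = (a\<^sup>2 - [:B:] * b\<^sup>2)\<^sup>2 * b1"
    by (simp only: to_fract_eq_iff)
  then show ?thesis unfolding a1_def[symmetric] b1_def[symmetric] sum_form_def product_form_def
    by Groebner_Basis.algebra
qed

text \<open>Stated through the 2x2 minors of the two triples, so that it covers points at infinity
  and coinciding abscissas as well. The first triple consists of the coefficients of (a1 + b1 T) (a2
  + b2 T). Polarity supplies the nonzero ordinates for doubling.\<close>

lemma proportional:
  assumes "on_curve P" "on_curve S" "polar P" "polar S"
    and "num P = a" "den P = b" "num S = c" "den S = e"
    and "num (add P S) = a1" "den (add P S) = b1"
    and "num (add P (neg S)) = a2" "den (add P (neg S)) = b2"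
  shows "(a1 * a2) * sum_form a b c e = (a1 * b2 + b1 * a2) * product_form a b c e
    \<and> (a1 * a2) * (a * e - b * c)\<^sup>2 = (b1 * b2) * product_form a b c e
    \<and> (a1 * b2 + b1 * a2) * (a * e - b * c)\<^sup>2 = (b1 * b2) * sum_form a b c e"
proof (cases "P = Infinity \<or> S = Infinity")
  case True
  then show ?thesis
  proof
    assume "P = Infinity"
    then have "a = 1" "b = 0" "a1 = c" "b1 = e" "a2 = c" "b2 = e"
    using assms(5-12) by (auto simp: num_den_neg)
  then show ?thesis
    unfolding sum_form_def product_form_def by (auto simp: power2_eq_square algebra_simps)
next
    assume "S = Infinity"
    then have "c = 1" "e = 0" "a1 = a" "b1 = b" "a2 = a" "b2 = b"
    using assms(5-12) by auto
  then show ?thesis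
    unfolding sum_form_def product_form_def by (auto simp: power2_eq_square algebra_simps)
  qed
next
  case False
  then obtain x y x' y' where P: "P = Affine x y" and S: "S = Affine x' y'"
    by (meson point.exhaust)
  have on: "to_fract f * y\<^sup>2 = cubic x" "to_fract f * y'\<^sup>2 = cubic x'" using assms P S by auto
  have y0: "y \<noteq> 0" "y' \<noteq> 0" using polar_ordinate_nonzero assms P S by auto
  have b: "b \<noteq> 0" "e \<noteq> 0" using assms P S by auto
  have x: "x * to_fract b = to_fract a" using abscissa_times_den[of x y] assms P by simp
  have x': "x' * to_fract e = to_fract c" using abscissa_times_den[of x' y'] assms S by simp
  show ?thesis
  proof (cases "x = x'")
    case True
    then have ac: "c = a" "e = b" using assms P S by auto
    have "y = y' \<or> y = - y'" using same_abscissa on True by blast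
    then show ?thesis
    proof
      assume y: "y = y'"
      have "num (add P S) * sum_form a b a b = den (add P S) * product_form a b a b"
        by (rule proportional_double[of x y]) (use assms P S True y y0 in auto)
      moreover have "add P (neg S) = Infinity" using P S True y by simp
      then have "a2 = 1" "b2 = 0" using assms by auto
      ultimately show ?thesis unfolding ac using assms(9,10) by (simp add: mult.commute)
    next
      assume y: "y = - y'"
      have "num (add P (neg S)) * sum_form a b a b = den (add P (neg S)) * product_form a b a b"
        by (rule proportional_double[of x y]) (use assms P S True y y0 in auto)
      moreover have "add P S = Infinity" using P S True y by simp
      then have "a1 = 1" "b1 = 0" using assms by auto
      ultimately show ?thesis unfolding ac using assms(11,12) by (simp add: mult.commute)
    qed
  next
    case False
    then obtain u v u' v' where uv: "add P S = Affine u v" "add P (neg S) = Affine u' v'"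
      using P S by (auto simp: Let_def)
    have b12: "b1 \<noteq> 0" "b2 \<noteq> 0" using assms uv by auto
    have u: "u * to_fract b1 = to_fract a1" using abscissa_times_den[of u v] assms uv by simp
    have u': "u' * to_fract b2 = to_fract a2" using abscissa_times_den[of u' v'] assms uv by simp
    note par = parallelogram_distinct[OF on False uv[unfolded P S]]
    define bb ee bb1 bb2 where "bb = to_fract b" "ee = to_fract e" "bb1 = to_fract b1" "bb2 = to_fract b2"
    note eqs = bb_ee_bb1_bb2_def
    have "((x * bb) * ee - bb * (x' * ee))\<^sup>2 * ((u * bb1) * bb2 + bb1 * (u' * bb2))
        = bb\<^sup>2 * ee\<^sup>2 * bb1 * bb2 * ((x - x')\<^sup>2 * (u + u'))" by Groebner_Basis.algebra
    also have "\<dots> = (bb1 * bb2) * (2 * (((x * bb) * (x' * ee) + to_fract [:B:] * bb * ee) * ((x * bb) * ee + bb * (x' * ee))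
        + 2 * to_fract [:A:] * (x * bb) * bb * (x' * ee) * ee))"
      unfolding par(1) by Groebner_Basis.algebra
    finally have "to_fract ((a * e - b * c)\<^sup>2 * (a1 * b2 + b1 * a2)) = to_fract ((b1 * b2) * sum_form a b c e)"
      unfolding eqs x x' u u' by (simp only: sum_form_def to_fract_hom)
    then have 3: "(a1 * b2 + b1 * a2) * (a * e - b * c)\<^sup>2 = (b1 * b2) * sum_form a b c e"
      by (simp only: to_fract_eq_iff mult.commute)
    have "((x * bb) * ee - bb * (x' * ee))\<^sup>2 * ((u * bb1) * (u' * bb2))
        = bb\<^sup>2 * ee\<^sup>2 * bb1 * bb2 * ((x - x')\<^sup>2 * (u * u'))" by Groebner_Basis.algebra
    also have "\<dots> = (bb1 * bb2) * ((x * bb) * (x' * ee) - to_fract [:B:] * bb * ee)\<^sup>2"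
      unfolding par(2) by Groebner_Basis.algebra
    finally have "to_fract ((a * e - b * c)\<^sup>2 * (a1 * a2)) = to_fract ((b1 * b2) * product_form a b c e)"
      unfolding eqs x x' u u' by (simp only: product_form_def to_fract_hom)
    then have 2: "(a1 * a2) * (a * e - b * c)\<^sup>2 = (b1 * b2) * product_form a b c e"
      by (simp only: to_fract_eq_iff mult.commute)
    have "a * e - b * c \<noteq> 0"
    proof
      assume "a * e - b * c = 0"
      then have "to_fract (a * e) = to_fract (b * c)" by simp
      then have "x * to_fract b * to_fract e = to_fract b * (x' * to_fract e)"
        unfolding x x' by (simp only: to_fract_hom)
      then have "x * (to_fract b * to_fract e) = x' * (to_fract b * to_fract e)"
        by (simp only: mult_ac)
      then show False using False b by simp
    qed
    \<comment> \<open>The remaining minor follows from the other two once it is multiplied by (a e -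
      b c)^2, which is nonzero because the abscissas differ.\<close>
    moreover have "(a1 * a2 * sum_form a b c e) * (a * e - b * c)\<^sup>2
        = (a1 * b2 + b1 * a2) * product_form a b c e * (a * e - b * c)\<^sup>2"
    proof -
      have "u1 * v2 * v3 = u2 * v1 * v3" if "u1 * v3 = u3 * v1" "u2 * v3 = u3 * v2"
        for u1 u2 u3 v1 v2 v3 :: "'a poly"
        using that by Groebner_Basis.algebra
      then show ?thesis using 2 3 .
    qed
    ultimately show ?thesis using 2 3 by simp
  qed
qed

text \<open>With poles at infinity only the term (a c)^2 reaches the degree 2 (deg a + deg c). The
  zero polynomial is listed separately because its degree is 0 and the bound may be 0 too, namely
  for \<open>Infinity\<close>.\<close>

lemma degree_forms:
  assumes "b = 0 \<and> a \<noteq> 0 \<or> degree b < degree a" "e = 0 \<and> c \<noteq> 0 \<or> degree e < degree c"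
  shows "a * c - [:B:] * b * e \<noteq> 0"
    and "degree (product_form a b c e) = 2 * (degree a + degree c)"
    and "(a * e - b * c)\<^sup>2 = 0 \<or> degree ((a * e - b * c)\<^sup>2) < 2 * (degree a + degree c)"
    and "sum_form a b c e = 0 \<or> degree (sum_form a b c e) < 2 * (degree a + degree c)"
proof -
  have nz: "a \<noteq> 0" "c \<noteq> 0" using assms by auto
  have less: "u * v = 0 \<or> degree (u * v) < m + n"
    if "u = 0 \<or> degree u \<le> m" "v = 0 \<or> degree v < n" for u v :: "'a poly" and m n
    using that degree_mult_le[of u v] by fastforce
  have le: "u * v = 0 \<or> degree (u * v) \<le> m + n"
    if "u = 0 \<or> degree u \<le> m" "v = 0 \<or> degree v \<le> n" for u v :: "'a poly" and m n
    using that degree_mult_le[of u v] by fastforce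
  have add_less: "u + v = 0 \<or> degree (u + v) < n"
    if "u = 0 \<or> degree u < n" "v = 0 \<or> degree v < n" for u v :: "'a poly" and n
    using that degree_add_le_max[of u v] by fastforce
  have b: "b = 0 \<or> degree b < degree a" and e: "e = 0 \<or> degree e < degree c" using assms by auto
  have small: "[:B:] * b * e = 0 \<or> degree ([:B:] * b * e) < degree a + degree c"
    using less[of "[:B:] * b" "degree a" e "degree c"] le[of "[:B:]" 0 b "degree a"] b e
    by auto
  then have "degree (a * c - [:B:] * b * e) = degree (a * c) \<and> a * c - [:B:] * b * e \<noteq> 0"
  proof
    assume "degree ([:B:] * b * e) < degree a + degree c"
    then have l: "degree (- ([:B:] * b * e)) < degree (a * c)" using nz by (simp add: degree_mult_eq)
    have "degree (a * c + - ([:B:] * b * e)) = degree (a * c)" by (rule degree_add_eq_left[OF l])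
    then have d: "degree (a * c - [:B:] * b * e) = degree (a * c)" by simp
    then show ?thesis using l by auto
  qed (use nz in auto)
  then show "a * c - [:B:] * b * e \<noteq> 0"
    and "degree (product_form a b c e) = 2 * (degree a + degree c)"
    using nz by (auto simp: product_form_def power2_eq_square degree_mult_eq)
  have ae: "a * e = 0 \<or> degree (a * e) < degree a + degree c"
    using less[of a "degree a" e "degree c"] e by auto
  have bc: "b * c = 0 \<or> degree (b * c) < degree a + degree c"
    using less[of c "degree c" b "degree a"] b by (auto simp: mult.commute add.commute)
  have diff: "a * e - b * c = 0 \<or> degree (a * e - b * c) < degree a + degree c"
    using add_less[of "a * e" _ "- (b * c)"] ae bc by auto
  show "(a * e - b * c)\<^sup>2 = 0 \<or> degree ((a * e - b * c)\<^sup>2) < 2 * (degree a + degree c)"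
    using less[of "a * e - b * c" "degree a + degree c" "a * e - b * c" "degree a + degree c"] diff
    by (auto simp: power2_eq_square)
  have s: "a * e + b * c = 0 \<or> degree (a * e + b * c) < degree a + degree c"
    using add_less[OF ae bc] .
  have p: "a * c + [:B:] * b * e = 0 \<or> degree (a * c + [:B:] * b * e) \<le> degree a + degree c"
    using degree_add_le[of "a * c" "degree a + degree c" "[:B:] * b * e"] degree_mult_le[of a c] small by auto
  have 1: "(a * c + [:B:] * b * e) * (a * e + b * c) = 0
      \<or> degree ((a * c + [:B:] * b * e) * (a * e + b * c)) < 2 * (degree a + degree c)"
    using less[OF p s] by (simp only: mult_2)
  have 2: "[:A:] * ((a * e) * (b * c)) = 0 \<or> degree ([:A:] * ((a * e) * (b * c))) < 2 * (degree a + degree c)"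
    using less[of "a * e" "degree a + degree c" "b * c" "degree a + degree c"] ae bc
      less[of "[:A:]" 0 "(a * e) * (b * c)" "2 * (degree a + degree c)"] by auto
  have two: "2 * x = 0 \<or> degree (2 * x) < n" if h: "x = 0 \<or> degree x < n" for x :: "'a poly" and n
    unfolding mult_2[of x] by (rule add_less[OF h h])
  have "sum_form a b c e = 2 * ((a * c + [:B:] * b * e) * (a * e + b * c) + 2 * ([:A:] * ((a * e) * (b * c))))"
    by (simp add: sum_form_def algebra_simps)
  then show "sum_form a b c e = 0 \<or> degree (sum_form a b c e) < 2 * (degree a + degree c)"
    using two[OF add_less[OF 1 two[OF 2]]] by simp
qed

lemma polar_nonzero: "polar P \<Longrightarrow> den P = 0 \<and> num P \<noteq> 0 \<or> degree (den P) < degree (num P)"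
  using coprime_num_den[of P] by (auto simp: polar_def)

text \<open>Suppose deg a \<le> deg b. If e is small against c, then b c dominates a e + b c and has
  degree at least deg (a c); otherwise b e has such a degree.\<close>

lemma polar_from_triple:
  fixes a b c e :: "'a poly"
  assumes "a * c \<noteq> 0" "a * e + b * c = 0 \<or> degree (a * e + b * c) < degree (a * c)"
    "b * e = 0 \<or> degree (b * e) < degree (a * c)"
  shows "b = 0 \<or> degree b < degree a"
proof (rule ccontr)
  assume "\<not> (b = 0 \<or> degree b < degree a)"
  then have b: "b \<noteq> 0" "degree a \<le> degree b" by auto
  have ac: "a \<noteq> 0" "c \<noteq> 0" using assms(1) by auto
  show False
  proof (cases "e = 0 \<or> degree e < degree c")
    case True
    have bc: "degree (a * c) \<le> degree (b * c)" using b ac by (simp add: degree_mult_eq)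
    have "a * e + b * c \<noteq> 0 \<and> degree (a * e + b * c) = degree (b * c)"
    proof (cases "e = 0")
      case False
      then have l: "degree (a * e) < degree (b * c)" using True b ac by (simp add: degree_mult_eq)
      then have "degree (a * e + b * c) = degree (b * c)" by (rule degree_add_eq_right)
      then show ?thesis using l by auto
    qed (use b ac in auto)
    then show False using assms(2) bc by auto
  next
    case False
    then show False using assms(3) b ac by (auto simp: degree_mult_eq)
  qed
qed

text \<open>Two primitive proportional triples agree up to units. Hence a1 a2 has the degree of
  \<open>product_form\<close>, which is the sum of heights wanted, and the smaller degrees of the
  other entries pass polarity on to both new points.\<close>

lemma parallelogram:
  assumes "on_curve P" "on_curve S" "polar P" "polar S"
  shows "polar (add P S) \<and> polar (add P (neg S))
    \<and> height (add P S) + height (add P (neg S)) = 2 * (height P + height S)"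
proof -
  define a b c e where "a = num P" "b = den P" "c = num S" "e = den S"
  define a1 b1 a2 b2 where "a1 = num (add P S)" "b1 = den (add P S)"
    "a2 = num (add P (neg S))" "b2 = den (add P (neg S))"
  note eqs = a_b_c_e_def a1_b1_a2_b2_def
  note cross = proportional[OF assms eqs[symmetric]]
  have cop: "coprime a b" "coprime c e" "coprime a1 b1" "coprime a2 b2"
    unfolding eqs by (rule coprime_num_den)+
  have bd: "b = 0 \<and> a \<noteq> 0 \<or> degree b < degree a" "e = 0 \<and> c \<noteq> 0 \<or> degree e < degree c"
    using polar_nonzero assms(3,4) unfolding eqs by blast+
  note deg = degree_forms[OF bd]
  have v: "gcd (product_form a b c e) (gcd (sum_form a b c e) ((a * e - b * c)\<^sup>2)) = 1"
    unfolding product_form_def sum_form_def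
    by (rule gcd_parallelogram_triple[OF cop(1,2) disc_nonzero char_not_2 deg(1)])
  \<comment> \<open>If a1 a2 = 0, proportionality makes the whole triple vanish, which contradicts
    its two factors being primitive.\<close>
  have nz: "a1 * a2 \<noteq> 0"
  proof
    assume 0: "a1 * a2 = 0"
    have pf: "product_form a b c e \<noteq> 0" using deg(1) by (simp add: product_form_def)
    have "(a1 * b2 + b1 * a2) * product_form a b c e = 0" using cross 0 by simp
    then have "a1 * b2 + b1 * a2 = 0" using pf by simp
    moreover have "(b1 * b2) * product_form a b c e = 0" using cross 0 by simp
    then have "b1 * b2 = 0" using pf by simp
    ultimately have "a1 = 0 \<and> b1 = 0 \<or> a2 = 0 \<and> b2 = 0" using 0 by auto
    then show False using cop(3,4) by auto
  qed
  have u: "gcd (a1 * a2) (gcd (a1 * b2 + b1 * a2) (b1 * b2)) = 1"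
    by (rule gcd_product_triple[OF cop(3,4) nz])
  have n: "normalize (a1 * a2) = normalize (product_form a b c e)"
    "normalize (a1 * b2 + b1 * a2) = normalize (sum_form a b c e)"
    "normalize (b1 * b2) = normalize ((a * e - b * c)\<^sup>2)"
    using normalize_eq_if_proportional[OF u v] cross by auto
  have d1: "degree (a1 * a2) = 2 * (degree a + degree c)"
    using n(1) deg(2) degree_normalize_poly by metis
  have d2: "a1 * b2 + b1 * a2 = 0 \<or> degree (a1 * b2 + b1 * a2) < degree (a1 * a2)"
    using n(2) deg(4) d1 degree_normalize_poly normalize_eq_0_iff by metis
  have d3: "b1 * b2 = 0 \<or> degree (b1 * b2) < degree (a1 * a2)"
    using n(3) deg(3) d1 degree_normalize_poly normalize_eq_0_iff by metis
  have "b1 = 0 \<or> degree b1 < degree a1"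
    by (rule polar_from_triple[OF nz d2 d3])
  moreover have "b2 = 0 \<or> degree b2 < degree a2"
    by (rule polar_from_triple[of a2 a1 b1 b2]) (use nz d2 d3 in \<open>auto simp: mult.commute add.commute\<close>)
  moreover have "degree a1 + degree a2 = 2 * (degree a + degree c)"
    using d1 nz by (auto simp: degree_mult_eq)
  ultimately show ?thesis unfolding polar_def height_def eqs by blast
qed

end

section \<open>Walks on the curve\<close>

lemma coprime_linear_iff:
  fixes q :: "'a :: field_gcd poly"
  shows "coprime [:- c, 1:] q \<longleftrightarrow> poly q c \<noteq> 0"
proof
  assume "coprime [:- c, 1:] q"
  moreover have "\<not> is_unit [:- c, 1:]" using is_unit_iff_degree[of "[:- c, 1:]"] by simp
  ultimately have "\<not> [:- c, 1:] dvd q" by (meson coprime_common_divisor dvd_refl)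
  then show "poly q c \<noteq> 0" by (simp add: poly_eq_0_iff_dvd)
next
  assume "poly q c \<noteq> 0"
  then have "\<not> [:- c, 1:] dvd q" by (simp add: poly_eq_0_iff_dvd)
  moreover have "prime_elem [:- c, 1:]" by (rule prime_elem_linear_field_poly) simp
  ultimately show "coprime [:- c, 1:] q" by (rule prime_elem_imp_coprime[rotated])
qed

lemma prod_linear_dvd:
  fixes q :: "'a :: field_gcd poly"
  assumes "finite S" "\<And>c. c \<in> S \<Longrightarrow> poly q c = 0"
  shows "(\<Prod>c\<in>S. [:- c, 1:]) dvd q"
  using assms
proof (induction S)
  case (insert c S)
  have "coprime [:- c, 1:] (\<Prod>c\<in>S. [:- c, 1:])"
    using insert.hyps by (auto simp: coprime_linear_iff poly_prod)
  moreover have "[:- c, 1:] dvd q" using insert.prems by (simp add: poly_eq_0_iff_dvd)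
  moreover have "(\<Prod>c\<in>S. [:- c, 1:]) dvd q" using insert by simp
  ultimately have "[:- c, 1:] * (\<Prod>c\<in>S. [:- c, 1:]) dvd q" by (metis divides_mult)
  then show ?case by (subst prod.insert[OF insert.hyps])
qed simp

lemma degree_prod_linear:
  "finite S \<Longrightarrow> degree (\<Prod>c\<in>S. [:- c, 1 :: 'a :: field_gcd:]) = card S"
  by (subst degree_prod_eq_sum_degree) auto

lemma lead_coeff_prod_linear: "lead_coeff (\<Prod>c\<in>S. [:- c, 1 :: 'a :: field_gcd:]) = 1"
  by (simp add: lead_coeff_prod)

lemma prod_linear_UNIV:
  "(\<Prod>c\<in>UNIV. [:- c, 1 :: 'a :: {field_gcd, finite_field}:])
    = monom 1 CARD('a) - monom 1 1"
proof -
  let ?q = "monom 1 CARD('a) - monom 1 1 :: 'a poly"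
  have n: "1 < CARD('a)"
    using card_mono[of UNIV "{0, 1 :: 'a}"] by auto
  have "degree (- monom 1 1 :: 'a poly) < degree (monom 1 CARD('a) :: 'a poly)"
    using n by (simp add: degree_monom_eq)
  then have d: "degree ?q = CARD('a)"
    using degree_add_eq_left[of "- monom 1 1 :: 'a poly" "monom 1 CARD('a)"] by (simp add: degree_monom_eq)
  then have q0: "?q \<noteq> 0" using n by auto
  have "(\<Prod>c\<in>UNIV. [:- c, 1 :: 'a:]) dvd ?q"
    by (rule prod_linear_dvd) (auto simp: poly_monom finite_field_power_card_eq_same)
  then obtain r where r: "?q = (\<Prod>c\<in>UNIV. [:- c, 1 :: 'a:]) * r" by (elim dvdE)
  have nz: "(\<Prod>c\<in>UNIV. [:- c, 1 :: 'a:]) \<noteq> 0" "r \<noteq> 0" using r q0 by auto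
  have "degree ?q = CARD('a) + degree r"
    unfolding r using nz degree_prod_linear[of "UNIV :: 'a set"] by (subst degree_mult_eq) auto
  then have "degree r = 0" using d by simp
  then obtain k where k: "r = [:k:]" by (rule degree_eq_zeroE)
  have "lead_coeff ?q = 1" using d n by simp
  moreover have "lead_coeff ?q = k"
    unfolding r k lead_coeff_mult lead_coeff_prod_linear by simp
  ultimately show ?thesis using r k by (simp add: one_pCons)
qed

lemma pderiv_eq_0D:
  fixes q :: "'a :: idom poly"
  assumes "pderiv q = 0"
  shows "CHAR('a) dvd degree q" "\<And>i. \<not> CHAR('a) dvd i \<Longrightarrow> coeff q i = 0"
proof -
  show c: "coeff q i = 0" if "\<not> CHAR('a) dvd i" for i
  proof -
    have "i \<noteq> 0" using that by (metis dvd_0_right)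
    then have "of_nat i * coeff q i = coeff (pderiv q) (i - 1)" by (simp add: coeff_pderiv)
    then show ?thesis using assms that by (simp add: of_nat_eq_0_iff_char_dvd)
  qed
  show "CHAR('a) dvd degree q"
    using c[of "degree q"] by (cases "q = 0") auto
qed

lemma dvd_pderiv_imp:
  fixes q :: "'a :: idom poly"
  assumes "q dvd pderiv q"
  shows "pderiv q = 0"
proof (rule ccontr)
  assume n: "pderiv q \<noteq> 0"
  then have "degree q \<le> degree (pderiv q)" using assms by (rule dvd_imp_degree_le[rotated])
  moreover have "degree (pderiv q) \<le> degree q - 1"
    by (rule degree_le) (auto simp: coeff_pderiv coeff_eq_0)
  ultimately have "degree q = 0" by simp
  then show False using n by (elim degree_eq_zeroE) (simp add: pderiv_pCons)
qed

lemma squarefree_dvd_power_imp: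
  fixes q :: "'a :: field_gcd poly"
  assumes "squarefree q" "q dvd r ^ n" "r \<noteq> 0"
  shows "q dvd r"
proof (rule multiplicity_le_imp_dvd)
  show q0: "q \<noteq> 0" using assms(1) by auto
  fix s :: "'a poly" assume s: "prime s"
  show "multiplicity s q \<le> multiplicity s r"
  proof (cases "s dvd q")
    case True
    then have "s dvd r" using assms(2) s prime_dvd_power by (metis dvd_trans)
    moreover have "\<not> is_unit s" using s not_prime_unit by blast
    ultimately have "multiplicity s r \<ge> 1"
      by (intro multiplicity_geI assms(3)) (simp_all only: power_one_right not_False_eq_True)
    moreover have "multiplicity s q \<le> 1"
      using assms(1) q0 s by (simp add: squarefree_factorial_semiring'')
    ultimately show ?thesis by simp
  qed (simp add: not_dvd_imp_multiplicity_0)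
qed

context twisted_by_itself
begin

definition good :: "'a poly fract point \<Rightarrow> 'a poly fract \<Rightarrow> bool" where
  "good P c \<longleftrightarrow> on_curve P \<and> polar P \<and> multiplier P c"

lemma good_Infinity: "good Infinity 0"
  by (simp add: good_def polar_def)

lemma good_add:
  assumes "good P c" "good S c'"
  shows "good (add P S) (c + c')"
  using assms polar_ordinate_nonzero parallelogram[of P S] on_curve_add[of P S]
  unfolding good_def by (metis multiplier_add)

lemma good_neg: "good P c \<Longrightarrow> good (neg P) (- c)"
  by (simp add: good_def multiplier_neg)

definition walk :: "'a poly fract point \<Rightarrow> 'a poly fract point \<Rightarrow> nat \<Rightarrow> 'a poly fract point" where
  "walk P S n = ((\<lambda>R. add R S) ^^ n) P"

lemma walk_simps [simp]: "walk P S 0 = P" "walk P S (Suc n) = add (walk P S n) S"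
  by (simp_all add: walk_def)

lemma good_walk:
  assumes "good P c" "good S c'"
  shows "good (walk P S n) (c + of_nat n * c')"
proof (induction n)
  case (Suc n)
  then show ?case using good_add[OF Suc assms(2)] by (simp add: algebra_simps)
qed (use assms in auto)

text \<open>The parallelogram law for the n-th point of the walk and S makes the second difference
  of the heights constant, equal to twice the height of S. So the height is a quadratic polynomial
  in n, fixed by its values at 0 and 1.\<close>

lemma height_walk:
  assumes "good P c" "good S c'"
  shows "int (height (walk P S n)) = int (height P)
    + int n * (int (height (add P S)) - int (height P) - int (height S)) + (int n)\<^sup>2 * int (height S)"
proof (induction n rule: less_induct)
  case (less n)
  show ?case
  proof (cases n)
    case (Suc m)
    show ?thesis
    proof (cases m)
      case (Suc k)
      have g: "good (walk P S m) (c + of_nat m * c')" "good (walk P S k) (c + of_nat k * c')"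
        using good_walk[OF assms] by blast+
      have "add (walk P S m) (neg S) = walk P S k"
        using add_cancel_right[of "walk P S k" S] g(2) assms(2) Suc by (simp add: good_def)
      then have "height (walk P S n) + height (walk P S k) = 2 * (height (walk P S m) + height S)"
        using parallelogram[of "walk P S m" S] g(1) assms(2) \<open>n = Suc m\<close> by (simp add: good_def)
      then have "int (height (walk P S n)) = 2 * (int (height (walk P S m)) + int (height S)) - int (height (walk P S k))"
        by simp
      also have "int (height (walk P S m)) = int (height P)
          + int m * (int (height (add P S)) - int (height P) - int (height S)) + (int m)\<^sup>2 * int (height S)"
        using less.IH[of m] \<open>n = Suc m\<close> by simp
      also have "int (height (walk P S k)) = int (height P)
          + int k * (int (height (add P S)) - int (height P) - int (height S)) + (int k)\<^sup>2 * int (height S)"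
        using less.IH[of k] \<open>n = Suc m\<close> Suc by simp
      finally show ?thesis using \<open>n = Suc m\<close> Suc by (simp add: power2_eq_square algebra_simps)
    qed (use \<open>n = Suc m\<close> in \<open>simp add: algebra_simps\<close>)
  qed simp
qed

lemma height_Infinity [simp]: "height Infinity = 0"
  by (simp add: height_def)

lemma height_multiple:
  assumes "good S c"
  shows "height (walk Infinity S n) = n\<^sup>2 * height S"
proof -
  have "int (height (walk Infinity S n)) = int (n\<^sup>2 * height S)"
    using height_walk[OF good_Infinity assms, of n] by simp
  then show ?thesis by (simp only: of_nat_eq_iff)
qed

text \<open>For a reduced fraction a / b with derivative 0, b divides a b' and hence b', which is
  impossible for degree reasons unless b' = 0.\<close>

lemma good_0_pderiv:
  assumes "good P 0"
  shows "pderiv (num P) = 0" "pderiv (den P) = 0"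
proof -
  have "pderiv (num P) = 0 \<and> pderiv (den P) = 0"
  proof (cases P)
    case (Affine x y)
    define a b where "a = num P" "b = den P"
    have b: "b \<noteq> 0" and c: "coprime a b"
      using Affine coprime_num_den[of P] by (auto simp: a_b_def)
    have x: "x = to_fract a / to_fract b" using Affine_abscissa[of x y] Affine by (simp add: a_b_def)
    have "fract_deriv x = 0" using assms Affine by (simp add: good_def)
    then have "to_fract (pderiv a * b - a * pderiv b) = 0"
      unfolding x fract_deriv_divide[OF b] using b by (simp del: to_fract_diff)
    then have "pderiv a * b - a * pderiv b = 0" by (simp only: to_fract_eq_0_iff)
    then have e: "pderiv a * b = a * pderiv b" by simp
    have "b dvd pderiv b"
      using e c by (metis coprime_commute coprime_dvd_mult_right_iff dvd_triv_right)
    then have "pderiv b = 0" by (rule dvd_pderiv_imp)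
    then show ?thesis using e b by (simp add: a_b_def)
  qed simp
  then show "pderiv (num P) = 0" "pderiv (den P) = 0" by auto
qed

definition generic_point :: "'a poly fract point" where
  "generic_point = Affine (to_fract [:0, 1:]) 1"

lemma to_fract_f: "to_fract f = cubic (to_fract [:0, 1:])"
proof -
  have "f = [:0, 1:] ^ 3 + [:A:] * [:0, 1:]\<^sup>2 + [:B:] * [:0, 1:]"
    by (simp add: f_def power2_eq_square power3_eq_cube)
  then show ?thesis by (simp only: cubic_def to_fract_hom)
qed

lemma good_generic_point: "good generic_point 1"
proof -
  have "degree (num generic_point) = 1" "degree (den generic_point) = 0"
    using degree_num_den[of "to_fract [:0, 1:]" "[:0, 1:]" 1] by (auto simp: generic_point_def)
  then have "polar generic_point" by (simp add: polar_def)
  moreover have "on_curve generic_point" 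
    by (simp only: generic_point_def on_curve.simps) (simp add: to_fract_f)
  moreover have "multiplier generic_point 1"
    by (simp add: generic_point_def fract_deriv_to_fract pderiv_pCons flip: one_pCons)
  ultimately show ?thesis by (simp only: good_def)
qed

lemma height_generic_point: "height generic_point = 1"
  using degree_num_den[of "to_fract [:0, 1:]" "[:0, 1:]" 1] by (auto simp: height_def generic_point_def)

lemma prime_dvd_const:
  fixes q :: "'a poly"
  assumes "prime q" "q dvd [:k:]"
  shows "k = 0"
  using assms by (metis is_unit_pCons_iff dvd_trans not_prime_unit is_unit_const_poly_iff dvd_field_iff)

lemma prime_dvd_f_pderiv:
  assumes "prime q" "q dvd f" "q dvd pderiv f"
  shows False
proof -
  define t :: "'a poly" where "t = [:0, 1:]"
  define g where "g = t\<^sup>2 + [:A:] * t + [:B:]"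
  note pd = prime_dvd_mult_iff[OF assms(1)]
  have f: "f = t * g" by (simp add: f_def t_def g_def power2_eq_square)
  have two: "(2 :: 'a poly) = [:2:]" by (simp add: numeral_poly)
  have f': "pderiv f = g + t * (2 * t + [:A:])"
    by (simp add: f t_def g_def two pderiv_mult pderiv_pCons power2_eq_square)
  have t: "\<not> q dvd t"
  proof
    assume qt: "q dvd t"
    then have "q dvd g" using assms(3) unfolding f' by (simp add: dvd_add_left_iff)
    then have "q dvd [:B:]" using qt unfolding g_def
      by (metis add.assoc dvd_add_right_iff dvd_mult dvd_power_le dvd_mult2 power2_eq_square)
    then show False using prime_dvd_const[OF assms(1)] disc_nonzero by auto
  qed
  then have g: "q dvd g" using assms(2) f pd by auto
  then have "q dvd t * (2 * t + [:A:])" using assms(3) unfolding f' by (simp add: dvd_add_right_iff)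
  then have "q dvd 2 * t + [:A:]" using t pd by blast
  then have "q dvd (2 * t + [:A:]) * (2 * t + [:A:]) - 4 * g" using g by (intro dvd_diff) auto
  moreover have "(2 * t + [:A:]) * (2 * t + [:A:]) - 4 * g = [:A\<^sup>2 - 4 * B:]"
  proof -
    have "[:A\<^sup>2 - 4 * B:] = [:A:]\<^sup>2 - 4 * [:B:]"
      by (simp add: power2_eq_square numeral_poly)
    then show ?thesis unfolding g_def by Groebner_Basis.algebra
  qed
  ultimately have "A\<^sup>2 - 4 * B = 0" using prime_dvd_const[OF assms(1)] by metis
  then show False using disc_nonzero by auto
qed

lemma squarefree_f: "squarefree f"
  unfolding squarefree_factorial_semiring[OF f_nonzero]
proof (intro allI impI notI)
  fix q assume q: "prime q" "q\<^sup>2 dvd f"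
  then obtain r where r: "f = q * (q * r)" by (auto simp: power2_eq_square elim!: dvdE)
  have "pderiv f = q * (pderiv (q * r) + r * pderiv q)"
    unfolding r by (subst pderiv_mult) (simp add: algebra_simps)
  then show False using prime_dvd_f_pderiv[OF q(1)] r by (metis dvd_triv_left)
qed

end

section \<open>The Frobenius point\<close>

text \<open>Rigidity says that \<open>f (c t + e)\<close> is a multiple of \<open>f\<close> only if \<open>c = 1\<close> and
  \<open>e = 0\<close>.\<close>

locale rigid_curve = twisted_by_itself A B
  for A B :: "'a :: {field_gcd, finite_field}" +
  fixes p :: nat
  assumes card_UNIV: "CARD('a) = p" and char_p: "CHAR('a) = p" and p_gt_3: "p > 3"
    and rigid: "\<And>c e. c \<noteq> 0 \<Longrightarrow> 3 * c\<^sup>2 * e + A * c\<^sup>2 = c ^ 3 * A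
      \<Longrightarrow> 3 * c * e\<^sup>2 + 2 * A * c * e + B * c = c ^ 3 * B
      \<Longrightarrow> e ^ 3 + A * e\<^sup>2 + B * e = 0 \<Longrightarrow> c = 1 \<and> e = 0"
begin

lemma prime_p: "prime p"
  using CHAR_prime[where ?'a = 'a] char_p by simp

lemma odd_p: "odd p"
  using prime_p p_gt_3 by (intro prime_odd_nat) auto

lemma power_p [simp]: "x ^ p = x" for x :: 'a
  using finite_field_power_card_eq_same[of x] card_UNIV by simp

lemma frobenius_poly_add: "(q + r) ^ p = q ^ p + r ^ p" for q r :: "'a poly"
  using freshmans_dream[where x = q and y = r] prime_p char_p by simp

lemma const_poly_power_p: "[:k:] ^ p = [:k :: 'a:]"
  by (simp add: poly_const_pow)

lemma linear_power_p: "[:e, c:] ^ p = [:e:] + monom c p" for e c :: 'a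
proof -
  have "[:e, c:] = [:e:] + [:c:] * [:0, 1:]" by simp
  also have "\<dots> ^ p = [:e:] ^ p + [:c:] ^ p * [:0, 1:] ^ p"
    by (simp only: frobenius_poly_add power_mult_distrib)
  also have "[:0, 1:] ^ p = (monom 1 p :: 'a poly)"
    by (simp add: monom_altdef)
  finally show ?thesis by (simp add: const_poly_power_p smult_monom)
qed

lemma pderiv_eq_0_degree_p:
  assumes "pderiv q = 0" "degree q = p"
  obtains e c :: 'a where "c \<noteq> 0" "q = [:e, c:] ^ p"
proof -
  have "q = [:coeff q 0:] + monom (coeff q p) p"
  proof (rule poly_eqI)
    fix i
    consider "i = 0" | "i = p" | "0 < i" "i < p" | "i > p" by linarith
    then show "coeff q i = coeff ([:coeff q 0:] + monom (coeff q p) p) i"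
    proof cases
      case 3
      then have "\<not> p dvd i" using dvd_imp_le by auto
      then show ?thesis using pderiv_eq_0D(2)[OF assms(1), of i] char_p 3
        by (simp add: coeff_pCons split: nat.split)
    qed (use p_gt_3 assms(2) in \<open>auto simp: coeff_pCons coeff_eq_0 split: nat.split\<close>)
  qed
  moreover have "coeff q p \<noteq> 0" using assms(2) p_gt_3 by (metis degree_0 leading_coeff_0_iff less_nat_zero_code)
  ultimately show ?thesis using that[of "coeff q p" "coeff q 0"] linear_power_p by metis
qed

lemma degree_f: "degree f = 3"
  by (simp add: f_def)

text \<open>An inseparable point of height \<open>p\<close> is the Frobenius point up to sign: its abscissa is
  \<open>(c t + e)\<^sup>p\<close>, and squarefreeness of \<open>f\<close> turns \<open>t \<mapsto> c t + e\<close> into an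
  automorphism of the curve.\<close>

lemma inseparable_height_p:
  assumes "good P 0" "height P = p"
  obtains \<epsilon> where "\<epsilon> = 1 \<or> \<epsilon> = - 1"
    "P = Affine (to_fract (monom 1 p)) (to_fract ([:\<epsilon>:] * f ^ ((p - 1) div 2)))"
proof -
  obtain x y where P: "P = Affine x y"
    using assms(2) p_gt_3 by (cases P) auto
  define a b where "a = num P" "b = den P"
  have b: "b \<noteq> 0" "degree b < p" and da: "degree a = p"
    using P assms by (auto simp: a_b_def good_def polar_def height_def)
  have pd: "pderiv a = 0" "pderiv b = 0" using good_0_pderiv[OF assms(1)] by (auto simp: a_b_def)
  \<comment> \<open>The degree of \<open>b\<close> is a multiple of p below p.\<close>
  have "degree b = 0"
    using pderiv_eq_0D(1)[OF pd(2)] char_p b(2) by (metis dvd_imp_le not_less neq0_conv)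
  then obtain k where k: "b = [:k:]" by (rule degree_eq_zeroE)
  have k0: "k \<noteq> 0" using k b by auto
  define a' where "a' = smult (inverse k) a"
  have "pderiv a' = 0" "degree a' = p" using pd da k0 by (auto simp: a'_def pderiv_smult)
  then obtain e c where ec: "c \<noteq> 0" "a' = [:e, c:] ^ p" by (rule pderiv_eq_0_degree_p)
  have ab: "a = a' * b" using k k0 by (simp add: a'_def)
  have x: "x = to_fract ([:e, c:] ^ p)"
    using Affine_abscissa[of x y] P ab b unfolding ec(2)[symmetric] by (simp add: a_b_def)
  define g where "g = [:e, c:]"
  define h where "h = g ^ 3 + [:A:] * g\<^sup>2 + [:B:] * g"
  have h: "h ^ p = (g ^ p) ^ 3 + [:A:] * (g ^ p)\<^sup>2 + [:B:] * g ^ p"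
    unfolding h_def by (simp only: frobenius_poly_add power_mult_distrib const_poly_power_p power_commutes
        flip: power_mult) (simp only: mult.commute)
  have "cubic x = to_fract (h ^ p)"
    unfolding h x g_def[symmetric] cubic_def by (simp only: to_fract_hom)
  then have curve: "to_fract f * y\<^sup>2 = to_fract (h ^ p)"
    using assms(1) P by (simp add: good_def)
  define \<alpha> \<beta> where "\<alpha> = fst (quot_of_fract y)" and "\<beta> = snd (quot_of_fract y)"
  have \<beta>: "\<beta> \<noteq> 0" and cop: "coprime \<alpha> \<beta>"
    by (auto simp: \<alpha>_def \<beta>_def coprime_quot_of_fract)
  have y: "y * to_fract \<beta> = to_fract \<alpha>"
    using abscissa_times_den[of y 0] by (simp add: \<alpha>_def \<beta>_def)
  have "to_fract f * (y * to_fract \<beta>)\<^sup>2 = to_fract (h ^ p) * (to_fract \<beta>)\<^sup>2"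
    using curve by (simp add: power_mult_distrib)
  then have "to_fract (f * \<alpha>\<^sup>2) = to_fract (h ^ p * \<beta>\<^sup>2)" unfolding y by (simp only: to_fract_hom)
  then have e1: "f * \<alpha>\<^sup>2 = h ^ p * \<beta>\<^sup>2" by (simp only: to_fract_eq_iff)
  have "\<beta>\<^sup>2 dvd f * \<alpha>\<^sup>2" using e1 by simp
  moreover have "coprime (\<beta>\<^sup>2) (\<alpha>\<^sup>2)" using cop by (simp add: coprime_commute)
  \<comment> \<open>The squared denominator of the ordinate divides the squarefree \<open>f\<close>,
    so the ordinate is a polynomial; then \<open>f\<close> divides h^p and, being squarefree,
    h.\<close>
  ultimately have "\<beta>\<^sup>2 dvd f" by (simp add: coprime_dvd_mult_left_iff)
  then have "is_unit \<beta>" by (rule squarefreeD[OF squarefree_f])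
  then have "is_unit (\<beta>\<^sup>2)" using is_unit_power_iff by blast
  then have "f dvd h ^ p" using e1 by (metis dvd_triv_left dvd_mult_unit_iff)
  have coeffs: "h = [:e ^ 3 + A * e\<^sup>2 + B * e, 3 * c * e\<^sup>2 + 2 * A * c * e + B * c, 3 * c\<^sup>2 * e + A * c\<^sup>2, c ^ 3:]"
    by (simp add: h_def g_def power2_eq_square power3_eq_cube algebra_simps)
  have h0: "h \<noteq> 0" and dh: "degree h = 3" using ec(1) by (auto simp: coeffs)
  have "f dvd h" by (rule squarefree_dvd_power_imp[OF squarefree_f \<open>f dvd h ^ p\<close> h0])
  then obtain \<kappa> where \<kappa>: "h = f * \<kappa>" by (elim dvdE)
  have "degree \<kappa> = 0" using dh degree_f h0 unfolding \<kappa> by (simp add: degree_mult_eq)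
  then obtain k' where "\<kappa> = [:k':]" by (rule degree_eq_zeroE)
  then have hk: "h = smult k' f" using \<kappa> by simp
  \<comment> \<open>The leading coefficients give k' = c^3; the other three comparisons of
    coefficients are the hypotheses of \<open>rigid\<close>.\<close>
  have "c = 1 \<and> e = 0"
    by (rule rigid[OF ec(1)]) (use hk in \<open>auto simp: coeffs f_def\<close>)
  then have g: "g = [:0, 1:]" by (simp add: g_def)
  have hf: "h = f" by (simp add: h_def g f_def power2_eq_square power3_eq_cube)
  have x': "x = to_fract (monom 1 p)" unfolding x g_def[symmetric] g by (simp add: monom_altdef)
  define m where "m = (p - 1) div 2"
  have m: "p = Suc (2 * m)" using odd_p by (auto simp: m_def elim!: oddE)
  have "to_fract f * y\<^sup>2 = to_fract f * (to_fract (f ^ m))\<^sup>2"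
    unfolding curve hf by (simp add: m to_fract_power power_mult_distrib mult.commute flip: power_mult)
  then have "y\<^sup>2 = (to_fract (f ^ m))\<^sup>2" using f_nonzero by simp
  then have "y = to_fract (f ^ m) \<or> y = - to_fract (f ^ m)" by (simp add: power2_eq_iff)
  then have "y = to_fract ([:1:] * f ^ m) \<or> y = to_fract ([:-1:] * f ^ m)" by simp
  then show ?thesis using that P x' unfolding m_def by blast
qed

text \<open>The sum of the quadratic characters of f(c), read in the field: the number of affine
  points minus p.\<close>

definition char_sum :: 'a where
  "char_sum = (\<Sum>c\<in>UNIV. poly f c ^ ((p - 1) div 2))"

text \<open>The chord formula gives the abscissa N / D^2 with D = t^p - t and deg N = 2 p + 1. The
  linear factor at c cancels once if f(c) = 0 and twice if \<epsilon> f(c)^m = 1, so the height that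
  remains counts these c.\<close>

lemma height_frobenius_plus_generic:
  assumes "\<epsilon> = 1 \<or> \<epsilon> = - 1"
    and "R = add (Affine (to_fract (monom 1 p)) (to_fract ([:\<epsilon>:] * f ^ ((p - 1) div 2)))) generic_point"
  shows "char_sum = \<epsilon> * (of_nat p + 1 - of_nat (height R))"
proof -
  define m where "m = (p - 1) div 2"
  have m: "p = Suc (2 * m)" using odd_p by (auto simp: m_def elim!: oddE)
  have e2: "\<epsilon> * \<epsilon> = 1" using assms(1) by auto
  define F where "F = [:\<epsilon>:] * f ^ m - 1"
  define D where "D = monom 1 p - [:0, 1 :: 'a:]"
  define N where "N = f * F\<^sup>2 - ([:A:] + [:0, 1:] + monom 1 p) * D\<^sup>2"
  have D: "D = (\<Prod>c\<in>UNIV. [:- c, 1 :: 'a:])"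
    unfolding prod_linear_UNIV card_UNIV D_def by (simp add: monom_altdef)
  have D0: "D \<noteq> 0" unfolding D by simp
  have xx: "to_fract (monom 1 p) \<noteq> to_fract [:0, 1 :: 'a:]"
  proof
    assume "to_fract (monom 1 p) = to_fract [:0, 1 :: 'a:]"
    then have "D = 0" by (simp add: D_def)
    then show False using D0 by simp
  qed
  obtain z v where R: "R = Affine z v" and z: "z = to_fract N / to_fract (D\<^sup>2)"
  proof -
    have "R = (let l = slope (to_fract (monom 1 p)) (to_fract ([:\<epsilon>:] * f ^ m)) (to_fract [:0, 1:]) 1;
        z = to_fract f * l\<^sup>2 - to_fract [:A:] - to_fract (monom 1 p) - to_fract [:0, 1:]
      in Affine z (- (to_fract ([:\<epsilon>:] * f ^ m) + l * (z - to_fract (monom 1 p)))))"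
      unfolding assms(2) m_def[symmetric] generic_point_def add.simps using xx by simp
    moreover have "slope (to_fract (monom 1 p)) (to_fract ([:\<epsilon>:] * f ^ m)) (to_fract [:0, 1:]) 1
      = to_fract F / to_fract D"
      using xx unfolding slope_def F_def D_def to_fract_diff to_fract_1 by simp
    moreover have "to_fract f * (to_fract F / to_fract D)\<^sup>2 - to_fract [:A:] - to_fract (monom 1 p) - to_fract [:0, 1:]
      = to_fract N / to_fract (D\<^sup>2)"
    proof -
      have "to_fract f * (to_fract F / to_fract D)\<^sup>2 - u - v - w
         = (to_fract f * (to_fract F)\<^sup>2 - (u + w + v) * (to_fract D)\<^sup>2) / (to_fract D)\<^sup>2" for u v w
        using D0 by (simp add: field_simps power2_eq_square)
      then show ?thesis unfolding N_def by (simp only: to_fract_hom)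
    qed
    ultimately show ?thesis using that by (simp only: Let_def)
  qed
  define Z where "Z = {c. poly f c = 0}"
  define E1 where "E1 = {c. \<epsilon> * poly f c ^ m = 1}"
  define E2 where "E2 = {c. \<epsilon> * poly f c ^ m = - 1}"
  have two: "(1 :: 'a) \<noteq> - 1"
    using char_not_2 by (metis add.right_inverse one_add_one)
  have m0: "m \<noteq> 0" using m p_gt_3 by auto
  have sq: "c = 0 \<or> \<epsilon> * c ^ m = 1 \<or> \<epsilon> * c ^ m = - 1" for c :: 'a
  proof (cases "c = 0")
    case False
    have "c * (c ^ m)\<^sup>2 = c" using power_p[of c] unfolding m by (simp add: mult.commute flip: power_mult)
    then have "(c ^ m)\<^sup>2 = 1" using False by simp
    then have "(\<epsilon> * c ^ m)\<^sup>2 = 1" using e2 by (simp add: power2_eq_square mult_ac)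
    then show ?thesis by (simp add: power2_eq_1_iff)
  qed simp
  have part: "UNIV = Z \<union> E1 \<union> E2" using sq by (auto simp: Z_def E1_def E2_def)
  have disj: "Z \<inter> E1 = {}" "Z \<inter> E2 = {}" "E1 \<inter> E2 = {}"
    using two m0 by (auto simp: Z_def E1_def E2_def power_0_left)
  have fin: "finite Z" "finite E1" "finite E2" by auto
  define L where "L S = (\<Prod>c\<in>S. [:- c, 1 :: 'a:])" for S
  have L0: "L S \<noteq> 0" for S by (simp add: L_def)
  have Dp: "D = L Z * L E1 * L E2"
    unfolding D part L_def using disj fin
    by (subst prod.union_disjoint) (auto simp: prod.union_disjoint)
  have cards: "card Z + card E1 + card E2 = p"
  proof -
    have "card (Z \<union> E1 \<union> E2) = card Z + card E1 + card E2"
      using disj by (subst card_Un_disjoint) (auto simp: card_Un_disjoint)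
    then show ?thesis using card_UNIV part by simp
  qed
  have "L Z dvd f" unfolding L_def by (rule prod_linear_dvd) (auto simp: Z_def)
  then obtain s where s: "f = L Z * s" by (elim dvdE)
  have "L E1 dvd F" unfolding L_def by (rule prod_linear_dvd) (auto simp: E1_def F_def)
  then obtain r where r: "F = L E1 * r" by (elim dvdE)
  define M where "M = s * r\<^sup>2 - ([:A:] + [:0, 1:] + monom 1 p) * (L Z * (L E2)\<^sup>2)"
  have N: "N = (L Z * (L E1)\<^sup>2) * M"
    unfolding N_def M_def Dp s r by Groebner_Basis.algebra
  have DD: "D\<^sup>2 = (L Z * (L E1)\<^sup>2) * (L Z * (L E2)\<^sup>2)"
    unfolding Dp by Groebner_Basis.algebra
  \<comment> \<open>Nothing else cancels. On Z and E2 the polynomial F takes the values - 1 and - 2,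
    so r has no zero there; a zero of s in Z would be a double root of f, and f has no zero in
    E2.\<close>
  have rc: "poly r c \<noteq> 0" if "c \<in> Z \<union> E2" for c
  proof
    assume "poly r c = 0"
    then have "poly F c = 0" by (simp add: r)
    then have "\<epsilon> * poly f c ^ m = 1" by (simp add: F_def)
    then show False using that disj by (auto simp: E1_def)
  qed
  have sc: "poly s c \<noteq> 0" if "c \<in> Z \<union> E2" for c
  proof
    assume sc: "poly s c = 0"
    then have "poly f c = 0" by (subst s) simp
    then have cZ: "c \<in> Z" by (simp add: Z_def)
    have "[:- c, 1:] dvd s" using sc by (simp add: poly_eq_0_iff_dvd)
    moreover have "[:- c, 1:] dvd L Z" unfolding L_def using cZ fin by (intro dvd_prodI) auto
    ultimately have "[:- c, 1:]\<^sup>2 dvd f" by (subst s) (simp only: power2_eq_square mult_dvd_mono)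
    then have "is_unit [:- c, 1:]" by (rule squarefreeD[OF squarefree_f])
    then show False using is_unit_iff_degree[of "[:- c, 1:]"] by simp
  qed
  have "coprime (L Z * (L E2)\<^sup>2) (s * r\<^sup>2)"
    using rc sc by (auto simp: L_def coprime_linear_iff intro!: prod_coprime_left)
  then have cop: "coprime M (L Z * (L E2)\<^sup>2)"
  proof -
    assume c: "coprime (L Z * (L E2)\<^sup>2) (s * r\<^sup>2)"
    have "gcd (L Z * (L E2)\<^sup>2) (M + ([:A:] + [:0, 1:] + monom 1 p) * (L Z * (L E2)\<^sup>2)) = gcd (L Z * (L E2)\<^sup>2) M"
      by (metis gcd_add_mult add.commute)
    moreover have "M + ([:A:] + [:0, 1:] + monom 1 p) * (L Z * (L E2)\<^sup>2) = s * r\<^sup>2" by (simp add: M_def)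
    ultimately show ?thesis using c by (simp add: coprime_iff_gcd_eq_1 gcd.commute)
  qed
  have "z = to_fract M / to_fract (L Z * (L E2)\<^sup>2)"
    unfolding z N DD using L0 by (simp add: to_fract_power field_simps)
  then have hR: "height R = degree M"
    using degree_num_den(1)[OF _ cop] L0 unfolding height_def R by simp
  \<comment> \<open>With T = t^p, the terms T^3 and A T^2 of f^p cancel against those of (A + t + T)
    (T - t)^2. What remains is led by T^2 t, and \<rho> collects the rest.\<close>
  define \<rho> where "\<rho> = [:B:] * monom 1 p + 2 * [:A:] * monom 1 (p + 1) - [:A:] * [:0, 1:]\<^sup>2 + monom 1 (p + 2)
    - [:0, 1:] ^ 3 - 2 * [:\<epsilon>:] * f ^ (m + 1) + f"
  have fp: "f ^ p = monom 1 p ^ 3 + [:A:] * (monom 1 p)\<^sup>2 + [:B:] * monom 1 p"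
  proof -
    have "f = [:0, 1:] ^ 3 + [:A:] * [:0, 1:]\<^sup>2 + [:B:] * [:0, 1:]"
      by (simp add: f_def power2_eq_square power3_eq_cube)
    also have "\<dots> ^ p = ([:0, 1:] ^ p) ^ 3 + [:A:] * ([:0, 1:] ^ p)\<^sup>2 + [:B:] * [:0, 1:] ^ p"
      by (simp only: frobenius_poly_add power_mult_distrib const_poly_power_p power_commutes
        flip: power_mult) (simp only: mult.commute)
    also have "[:0, 1:] ^ p = (monom 1 p :: 'a poly)" by (simp add: monom_altdef)
    finally show ?thesis .
  qed
  have N\<rho>: "N = monom 1 (2 * p + 1) + \<rho>"
  proof -
    define t T where "t = [:0, 1 :: 'a:]" and "T = (monom 1 p :: 'a poly)"
    have e2': "[:\<epsilon>:] * [:\<epsilon>:] = 1" using e2 by (simp add: one_pCons)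
    have mon: "monom 1 (2 * p + 1) = T\<^sup>2 * t" "monom 1 (p + 1) = T * t" "monom 1 (p + 2) = T * t\<^sup>2"
      by (simp_all add: T_def t_def monom_altdef power_add mult.commute[of _ "[:0, 1:]"] power2_eq_square mult_2)
    have "f * F\<^sup>2 = ([:\<epsilon>:] * [:\<epsilon>:]) * (f * f ^ m * f ^ m) - 2 * [:\<epsilon>:] * (f * f ^ m) + f"
      unfolding F_def by Groebner_Basis.algebra
    also have "f * f ^ m * f ^ m = f ^ p" unfolding m by (simp add: power_add mult_2)
    finally have "f * F\<^sup>2 = f ^ p - 2 * [:\<epsilon>:] * f ^ (m + 1) + f" unfolding e2' by simp
    moreover have "f * F\<^sup>2 - ([:A:] + t + T) * (T - t)\<^sup>2 = T\<^sup>2 * t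
        + ([:B:] * T + 2 * [:A:] * (T * t) - [:A:] * t\<^sup>2 + T * t\<^sup>2 - t ^ 3 - 2 * [:\<epsilon>:] * w + f)"
      if "f * F\<^sup>2 = T ^ 3 + [:A:] * T\<^sup>2 + [:B:] * T - 2 * [:\<epsilon>:] * w + f" for w
      using that by Groebner_Basis.algebra
    ultimately show ?thesis unfolding N_def \<rho>_def mon D_def fp t_def[symmetric] T_def[symmetric] by blast
  qed
  have "degree \<rho> < 2 * p + 1"
  proof -
    have "degree (f ^ (m + 1)) < 2 * p + 1"
      using m0 unfolding degree_power_eq[OF f_nonzero] degree_f m by simp
    then have 1: "degree (2 * [:\<epsilon>:] * f ^ (m + 1)) < 2 * p + 1"
      using degree_mult_le[of "2 * [:\<epsilon>:]" "f ^ (m + 1)"] by (simp add: numeral_poly)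
    have 2: "degree ([:B:] * monom 1 p) < 2 * p + 1" "degree (2 * [:A:] * monom 1 (p + 1)) < 2 * p + 1"
      "degree (monom 1 (p + 2) :: 'a poly) < 2 * p + 1"
      using p_gt_3 by (auto simp: smult_monom numeral_poly intro: le_less_trans[OF degree_monom_le])
    have 3: "degree ([:A:] * [:0, 1:]\<^sup>2) < 2 * p + 1" "degree ([:0, 1 :: 'a:] ^ 3) < 2 * p + 1" "degree f < 2 * p + 1"
      using p_gt_3 by (auto simp: degree_power_eq degree_f intro: le_less_trans[OF degree_smult_le])
    show ?thesis unfolding \<rho>_def
      by (intro degree_add_less degree_diff_less 1 2 3)
  qed
  then have "degree N = 2 * p + 1"
    unfolding N\<rho> by (subst degree_add_eq_left) (simp_all add: degree_monom_eq)
  moreover have "M \<noteq> 0" using \<open>degree N = 2 * p + 1\<close> N by auto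
  then have "degree N = card Z + 2 * card E1 + degree M"
    unfolding N using L0 degree_prod_linear[OF fin(1)] degree_prod_linear[OF fin(2)]
    by (simp add: degree_mult_eq degree_power_eq L_def[symmetric])
  ultimately have count: "card Z + 2 * card E1 + height R = 2 * p + 1" using hR by simp
  have "\<epsilon> * char_sum = (\<Sum>c\<in>UNIV. \<epsilon> * poly f c ^ m)"
    by (simp add: char_sum_def m_def sum_distrib_left)
  also have "\<dots> = (\<Sum>c\<in>Z. \<epsilon> * poly f c ^ m) + (\<Sum>c\<in>E1. \<epsilon> * poly f c ^ m) + (\<Sum>c\<in>E2. \<epsilon> * poly f c ^ m)"
    unfolding part using disj fin by (subst sum.union_disjoint) (auto simp: sum.union_disjoint)
  also have "(\<Sum>c\<in>Z. \<epsilon> * poly f c ^ m) = 0" using m0 by (intro sum.neutral) (auto simp: Z_def)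
  also have "(\<Sum>c\<in>E1. \<epsilon> * poly f c ^ m) = of_nat (card E1)" by (simp add: E1_def)
  also have "(\<Sum>c\<in>E2. \<epsilon> * poly f c ^ m) = - of_nat (card E2)" by (simp add: E2_def)
  finally have "\<epsilon> * char_sum = of_int (int (card E1) - int (card E2))" by simp
  also have "int (card E1) - int (card E2) = int p + 1 - int (height R)"
    using count cards by linarith
  finally have "\<epsilon> * (\<epsilon> * char_sum) = \<epsilon> * (of_nat p + 1 - of_nat (height R))" by simp
  then show ?thesis using e2 by (simp flip: mult.assoc)
qed

theorem char_sum_square:
  assumes H: "good H \<alpha>" "height H = n"
    and rep: "p = x\<^sup>2 + n * y\<^sup>2" "x > 0" "y > 0"
    and lin: "of_nat x + of_nat y * \<alpha> = 0"
  shows "char_sum\<^sup>2 = of_nat (4 * x\<^sup>2)"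
proof -
  define Q where "Q = walk Infinity H y"
  have Q: "good Q (of_nat y * \<alpha>)" using good_walk[OF good_Infinity H(1), of y] by (simp add: Q_def)
  have hQ: "int (height Q) = int n * (int y)\<^sup>2" using height_multiple[OF H(1), of y] H(2) by (simp add: Q_def)
  define b where "b = int (height (add Q generic_point)) - int (height Q) - 1"
  define G' where "G' = neg generic_point"
  have G': "good G' (- 1)" "height G' = 1"
    using good_neg[OF good_generic_point] by (simp_all add: G'_def height_generic_point)
  have h1: "int (height (walk Q generic_point k)) = int n * (int y)\<^sup>2 + int k * b + (int k)\<^sup>2" for k
    using height_walk[OF Q good_generic_point, of k] by (simp add: hQ b_def height_generic_point)
  \<comment> \<open>The parallelogram law turns b into - b for the opposite direction, so a single b
    governs both walks.\<close>
  have "int (height (add Q G')) - int (height Q) - 1 = - b"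
    using parallelogram[of Q generic_point] Q good_generic_point
    by (simp add: good_def b_def G'_def height_generic_point)
  then have h2: "int (height (walk Q G' k)) = int n * (int y)\<^sup>2 - int k * b + (int k)\<^sup>2" for k
    using height_walk[OF Q G'(1), of k] by (simp add: hQ G'(2))
  have ip: "int p = (int x)\<^sup>2 + int n * (int y)\<^sup>2" using rep(1) by simp
  have x2: "1 \<le> (int x)\<^sup>2" "int x \<le> (int x)\<^sup>2"
    using rep(2) by (simp, intro self_le_power) auto
  \<comment> \<open>The heights two steps away from Q in either direction are nonnegative, so 2
    \<bar>b\<bar> \<le> n y^2 + 4 \<le> p + 3 < 2 p.\<close>
  have "\<bar>b\<bar> < int p" using h1[of 2] h2[of 2] ip x2 p_gt_3 by (auto simp: abs_if)
  define P where "P = walk Q generic_point x"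
  have gP: "good P 0" using good_walk[OF Q good_generic_point, of x] lin by (simp add: P_def add.commute)
  have "p dvd height P" using pderiv_eq_0D(1)[OF good_0_pderiv(1)[OF gP]] char_p by (simp add: height_def)
  then have "int p dvd int p + int x * b"
    using h1[of x] ip by (metis P_def add.assoc add.commute int_dvd_int_iff)
  then have "int p dvd int x * b" by simp
  moreover have "\<not> int p dvd int x"
  proof
    assume "int p dvd int x"
    then have "int p \<le> int x" using rep(2) by (intro zdvd_imp_le) auto
    moreover have "(int x)\<^sup>2 \<le> int p" using ip by simp
    ultimately have "int x = int p" "(int x)\<^sup>2 = int p" using x2 by auto
    then have "int p * int p = int p" by (simp add: power2_eq_square)
    then show False using p_gt_3 by simp
  qed
  ultimately have "int p dvd b" using prime_p by (simp add: prime_dvd_mult_iff)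
  then have b0: "b = 0" using \<open>\<bar>b\<bar> < int p\<close> zdvd_not_zless[of "\<bar>b\<bar>" "int p"] by force
  have "int (height P) = int p" using h1[of x] ip b0 by (simp add: P_def)
  then have "height P = p" by simp
  with gP obtain \<epsilon> where \<epsilon>: "\<epsilon> = 1 \<or> \<epsilon> = - 1"
    "P = Affine (to_fract (monom 1 p)) (to_fract ([:\<epsilon>:] * f ^ ((p - 1) div 2)))"
    by (rule inseparable_height_p)
  define R where "R = walk Q generic_point (Suc x)"
  have "int (height R) = int p + 1 + 2 * int x"
    using h1[of "Suc x"] ip b0 by (simp add: R_def power2_eq_square algebra_simps)
  then have "height R = p + 1 + 2 * x" by simp
  moreover have "char_sum = \<epsilon> * (of_nat p + 1 - of_nat (height R))"
    by (rule height_frobenius_plus_generic[OF \<epsilon>(1)]) (simp add: R_def P_def[symmetric] \<epsilon>(2))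
  ultimately have "char_sum = - (\<epsilon> * of_nat (2 * x))" by simp
  then show ?thesis using \<epsilon>(1) by (auto simp: power2_eq_square)
qed

end

section \<open>A curve with multiplication by \<open>sqrt (-10)\<close>\<close>

locale curve_sqrt5 =
  fixes s :: "'a :: field_gcd"
  assumes s_square: "s * s = 5" and two_neq_0: "(2 :: 'a) \<noteq> 0" and five_neq_0: "(5 :: 'a) \<noteq> 0"
begin

lemma s_square_left: "s * (s * x) = 5 * x"
  using s_square by (simp flip: mult.assoc)

lemmas ss = s_square s_square_left

text \<open>9 + 4 s is the square of the unit 2 + s. So 18 + 8 s and its conjugate are units up to
  the factor 2.\<close>

lemma unit_9_4s: "(9 + 4 * s) * (9 - 4 * s) = 1"
  by (simp add: algebra_simps ss)

lemma unit_2_s: "(2 + s) * (2 - s) = - 1"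
  by (simp add: algebra_simps ss)

lemma B_nonzero: "18 + 8 * s \<noteq> 0"
proof
  assume "18 + 8 * s = 0"
  then have "2 * ((9 + 4 * s) * (9 - 4 * s)) = 0" by Groebner_Basis.algebra
  then show False using unit_9_4s two_neq_0 by simp
qed

lemma B'_nonzero: "18 - 8 * s \<noteq> 0"
proof
  assume "18 - 8 * s = 0"
  then have "2 * ((9 + 4 * s) * (9 - 4 * s)) = 0" by Groebner_Basis.algebra
  then show False using unit_9_4s two_neq_0 by simp
qed

sublocale twisted_by_itself 12 "18 + 8 * s"
proof
  show "(2 :: 'a) \<noteq> 0" by (rule two_neq_0)
  have "12\<^sup>2 - 4 * (18 + 8 * s) = 2 * 2 * (18 - 8 * s)" by Groebner_Basis.algebra
  then show "(18 + 8 * s) * (12\<^sup>2 - 4 * (18 + 8 * s)) \<noteq> 0"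
    using B_nonzero B'_nonzero two_neq_0 by (metis mult_eq_0_iff)
qed

text \<open>The map \<open>x \<mapsto> x (q1 / q2)\<^sup>2\<close> is a 5-isogeny onto the conjugate curve
  \<open>y\<^sup>2 = x\<^sup>3 + 12 x\<^sup>2 + (18 - 8 s) x\<close>, and \<open>x \<mapsto> - (x\<^sup>2 + 12 x + 18 - 8 s) / (2 x)\<close>
  is a 2-isogeny back. The composite \<open>endo_num / endo_den\<close> is multiplication by
  \<open>sqrt (-10)\<close>.\<close>

definition q1 :: "'a poly" where "q1 = [:10 + 4 * s, 4 * s, 1:]"
definition q2 :: "'a poly" where "q2 = [:76 + 34 * s, 20 + 8 * s, s:]"
definition iso_num :: "'a poly" where "iso_num = [:0, 1:] * q1\<^sup>2"
definition iso_den :: "'a poly" where "iso_den = q2\<^sup>2"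
definition endo_num :: "'a poly" where
  "endo_num = - (iso_num\<^sup>2 + 12 * iso_num * iso_den + [:18 - 8 * s:] * iso_den\<^sup>2)"
definition endo_den :: "'a poly" where "endo_den = 2 * iso_num * iso_den"
definition endo_wronskian :: "'a poly" where
  "endo_wronskian = pderiv endo_num * endo_den - endo_num * pderiv endo_den"

text \<open>With X = \<open>iso_num\<close> / \<open>iso_den\<close> and g the conjugate cubic, this
  is 5 g(X) = f X'^2 cleared of denominators: the isogeny multiplies dx / y by a square root of
  5.\<close>

lemma five_isogeny:
  "5 * (iso_num\<^sup>2 + 12 * iso_num * iso_den + [:18 - 8 * s:] * iso_den\<^sup>2) * (iso_num * iso_den)
    = f * (pderiv iso_num * iso_den - iso_num * pderiv iso_den)\<^sup>2"
proof -
  define x S where "x = [:0, 1 :: 'a:]" and "S = [:s:]"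
  have f: "f = x * (x\<^sup>2 + 12 * x + 18 + 8 * S)" and B': "[:18 - 8 * s:] = 18 - 8 * S"
    by (simp_all add: f_def x_def S_def power2_eq_square numeral_poly)
  have d: "pderiv q1 = 2 * x + 4 * S" "pderiv q2 = 2 * S * x + 20 + 8 * S"
    by (simp_all add: q1_def q2_def x_def S_def pderiv_pCons numeral_poly)
  define w where "w = q1 * q2 + 2 * x * (pderiv q1 * q2 - q1 * pderiv q2)"
  have "pderiv iso_num * iso_den - iso_num * pderiv iso_den = q1 * q2 * w"
    unfolding iso_num_def iso_den_def w_def x_def[symmetric]
    by (simp add: pderiv_mult pderiv_power_Suc power2_eq_square x_def[symmetric]) (simp add: x_def pderiv_pCons algebra_simps one_pCons)
  moreover have "5 * (x\<^sup>2 * q1 ^ 4 + 12 * x * q1\<^sup>2 * q2\<^sup>2 + (18 - 8 * S) * q2 ^ 4)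
      = (x\<^sup>2 + 12 * x + 18 + 8 * S) * w\<^sup>2"
  proof -
    \<comment> \<open>The common expansion of both sides, with s^2 replaced by 5.\<close>
    let ?R = "[:148839840 + 66563200 * s, 397214400 + 177639680 * s, 423549200 + 189416960 * s,
      238006400 + 106439680 * s, 79374800 + 35497280 * s, 16598560 + 7422080 * s,
      2213800 + 988160 * s, 186400 + 81920 * s, 9650 + 3880 * s, 300 + 80 * s, 5:]"
    have w: "w = [:1440 + 644 * s, 1680 + 752 * s, 480 + 220 * s, 40 + 24 * s, s:]"
      unfolding w_def d unfolding q1_def q2_def x_def S_def by (simp add: numeral_poly algebra_simps ss)
    have q1_2: "q1\<^sup>2 = [:180 + 80 * s, 160 + 80 * s, 100 + 8 * s, 8 * s, 1:]"
      by (simp add: q1_def power2_eq_square algebra_simps ss)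
    have q2_2: "q2\<^sup>2 = [:11556 + 5168 * s, 5760 + 2576 * s, 1060 + 472 * s, 80 + 40 * s, 5:]"
      by (simp add: q2_def power2_eq_square algebra_simps ss)
    have "5 * (x\<^sup>2 * (q1\<^sup>2 * q1\<^sup>2) + 12 * x * (q1\<^sup>2 * q2\<^sup>2) + (18 - 8 * S) * (q2\<^sup>2 * q2\<^sup>2)) = ?R"
      unfolding q1_2 q2_2 by (simp add: x_def S_def power2_eq_square numeral_poly algebra_simps ss)
    moreover have "(x\<^sup>2 + 12 * x + 18 + 8 * S) * w\<^sup>2 = ?R"
      unfolding w by (simp add: x_def S_def power2_eq_square numeral_poly algebra_simps ss)
    ultimately show ?thesis by (simp add: mult.assoc flip: power_add)
  qed
  ultimately show ?thesis
    unfolding f B' iso_num_def iso_den_def x_def[symmetric] by Groebner_Basis.algebra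
qed

text \<open>The 2-isogeny contributes the factor - 2 to the square of the multiplier. The derivative
  of - (X^2 + 12 X + B') / (2 X) is - (X^2 - B') / (2 X^2), which explains the factorisation of the
  Wronskian.\<close>

lemma endo_equation:
  "- 10 * (endo_num ^ 3 + 12 * endo_num\<^sup>2 * endo_den + [:18 + 8 * s:] * endo_num * endo_den\<^sup>2) * endo_den
    = f * endo_wronskian\<^sup>2"
proof -
  define u v B' where "u = iso_num" "v = iso_den" "B' = [:18 - 8 * s:]"
  have B: "[:18 + 8 * s:] = 36 - B'" by (simp add: u_v_B'_def numeral_poly)
  define w where "w = pderiv u * v - u * pderiv v"
  have iso: "5 * (u\<^sup>2 + 12 * u * v + B' * v\<^sup>2) * (u * v) = f * w\<^sup>2"
    using five_isogeny by (simp add: u_v_B'_def w_def)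
  have n: "endo_num = - (u\<^sup>2 + 12 * u * v + B' * v\<^sup>2)" "endo_den = 2 * u * v"
    by (simp_all add: endo_num_def endo_den_def u_v_B'_def)
  have c: "pderiv B' = 0" "pderiv (2 :: 'a poly) = 0" "pderiv (12 :: 'a poly) = 0"
    by (simp_all add: u_v_B'_def pderiv_pCons numeral_poly)
  have dn: "pderiv endo_num = - (2 * u * pderiv u + 12 * (pderiv u * v + u * pderiv v) + 2 * B' * v * pderiv v)"
    unfolding n by (simp only: power2_eq_square pderiv_minus pderiv_add pderiv_mult c) Groebner_Basis.algebra
  have dd: "pderiv endo_den = 2 * (pderiv u * v + u * pderiv v)"
    unfolding n by (simp only: pderiv_mult c) Groebner_Basis.algebra
  have W: "endo_wronskian = - 2 * (u\<^sup>2 - B' * v\<^sup>2) * w"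
    unfolding endo_wronskian_def dn dd unfolding n w_def by Groebner_Basis.algebra
  have "f * endo_wronskian\<^sup>2 = 4 * (u\<^sup>2 - B' * v\<^sup>2)\<^sup>2 * (f * w\<^sup>2)"
    unfolding W by Groebner_Basis.algebra
  also have "\<dots> = - 10 * (endo_num ^ 3 + 12 * endo_num\<^sup>2 * endo_den + [:18 + 8 * s:] * endo_num * endo_den\<^sup>2) * endo_den"
    unfolding iso[symmetric] B n by Groebner_Basis.algebra
  finally show ?thesis by simp
qed

text \<open>No cancellation occurs in the composite, so its height is the full degree 10. A common
  prime would divide \<open>q2\<close> and one of x and \<open>q1\<close>; eliminating x leaves in
  either case a product of 2 and powers of the unit 2 + s.\<close>

lemma prime_dvd_isogeny:
  assumes "prime q" "q dvd endo_num" "q dvd endo_den"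
  shows False
proof -
  note pd = prime_dvd_mult_iff[OF assms(1)]
  define x S where "x = [:0, 1 :: 'a:]" and "S = [:s:]"
  have two: "2 = [:2 :: 'a:]" and eight: "8 = [:2 * 2 * 2 :: 'a:]" by (simp_all add: numeral_poly)
  have unit2: "\<not> q dvd 2" using prime_dvd_const[OF assms(1)] two_neq_0 two by metis
  have unit8: "\<not> q dvd 8" using prime_dvd_const[OF assms(1), of "2 * 2 * 2"] two_neq_0 eight by (metis mult_eq_0_iff)
  have unitB': "\<not> q dvd [:18 - 8 * s:]" using prime_dvd_const[OF assms(1)] B'_nonzero by blast
  have unit_eps: "\<not> q dvd 2 + S"
  proof
    assume "q dvd 2 + S"
    then have "q dvd (2 + S) * (2 - S)" by simp
    moreover have "(2 + S) * (2 - S) = [:-1:]" using unit_2_s by (simp add: S_def numeral_poly mult.commute)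
    ultimately have "(- 1 :: 'a) = 0" using prime_dvd_const[OF assms(1)] by metis
    then show False by simp
  qed
  have "q dvd iso_num \<or> q dvd iso_den"
    using assms(3) unit2 unfolding endo_den_def by (simp add: pd)
  moreover have "q dvd iso_num\<^sup>2 + 12 * iso_num * iso_den + [:18 - 8 * s:] * iso_den\<^sup>2"
    using assms(2) unfolding endo_num_def by (simp only: dvd_minus_iff)
  ultimately have both: "q dvd iso_num" "q dvd iso_den"
  proof -
    assume *: "q dvd iso_num \<or> q dvd iso_den"
      "q dvd iso_num\<^sup>2 + 12 * iso_num * iso_den + [:18 - 8 * s:] * iso_den\<^sup>2"
    have "q dvd iso_num \<longleftrightarrow> q dvd iso_den"
    proof
      assume n: "q dvd iso_num"
      then have "q dvd iso_num\<^sup>2 + 12 * iso_num * iso_den" by (simp add: power2_eq_square)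
      then have "q dvd [:18 - 8 * s:] * iso_den\<^sup>2" using *(2) dvd_add_right_iff by blast
      then show "q dvd iso_den" using unitB' pd prime_dvd_power[OF assms(1)] by blast
    next
      assume n: "q dvd iso_den"
      then have "q dvd 12 * iso_num * iso_den + [:18 - 8 * s:] * iso_den\<^sup>2"
        unfolding power2_eq_square by (intro dvd_add dvd_mult)
      then have "q dvd iso_num\<^sup>2" using *(2) by (metis add.assoc dvd_add_left_iff)
      then show "q dvd iso_num" using prime_dvd_power[OF assms(1)] by blast
    qed
    then show "q dvd iso_num" "q dvd iso_den" using *(1) by auto
  qed
  have q2: "q dvd q2" using both(2) prime_dvd_power[OF assms(1)] unfolding iso_den_def by blast
  have "q dvd x \<or> q dvd q1"
    using both(1) prime_dvd_power[OF assms(1)] unfolding iso_num_def x_def[symmetric] pd by blast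
  then show False
  proof
    assume "q dvd x"
    then have "q dvd q2 - (S * x + 20 + 8 * S) * x" using q2 by (intro dvd_diff) auto
    moreover have "q2 - (S * x + 20 + 8 * S) * x = 2 * ((2 + S) * (2 + S) * (2 + S))"
      by (simp add: q2_def x_def S_def numeral_poly algebra_simps ss)
    ultimately show False using unit2 unit_eps by (simp add: pd)
  next
    assume q1: "q dvd q1"
    \<comment> \<open>Euclid's algorithm for \<open>q1\<close> and \<open>q2\<close>: the remainder
      is 8 (s x + 7 + 3 s), and dividing 5 \<open>q1\<close> by its linear factor leaves 2 (2 +
      s).\<close>
    then have "q dvd q2 - S * q1" using q2 by simp
    moreover have "q2 - S * q1 = 8 * (S * x + 7 + 3 * S)"
      by (simp add: q1_def q2_def x_def S_def numeral_poly algebra_simps ss)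
    ultimately have "q dvd 8 * (S * x + 7 + 3 * S)" by (simp only:)
    then have l: "q dvd S * x + 7 + 3 * S" using unit8 unfolding pd by blast
    have "q dvd 5 * q1 - (S * x + 7 + 3 * S) * (S * x + 13 - 3 * S)"
      using q1 l by (intro dvd_diff) auto
    moreover have "5 * q1 - (S * x + 7 + 3 * S) * (S * x + 13 - 3 * S) = 2 * (2 + S)"
      by (simp add: q1_def x_def S_def numeral_poly algebra_simps ss)
    ultimately have "q dvd 2 * (2 + S)" by (simp only:)
    then show False using unit2 unit_eps unfolding pd by blast
  qed
qed

lemma degree_endo: "degree endo_num = 10" "degree endo_den = 9" "endo_den \<noteq> 0"
proof -
  have s0: "s \<noteq> 0"
  proof
    assume "s = 0"
    then show False using s_square five_neq_0 by simp
  qed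
  have q: "degree q1 = 2" "degree q2 = 2" "q1 \<noteq> 0" "q2 \<noteq> 0" using s0 by (auto simp: q1_def q2_def)
  have i: "degree iso_num = 5" "degree iso_den = 4" "iso_num \<noteq> 0" "iso_den \<noteq> 0"
    using q by (auto simp: iso_num_def iso_den_def degree_mult_eq degree_power_eq)
  have two: "2 = [:2 :: 'a:]" and twelve: "12 = [:12 :: 'a:]" by (simp_all add: numeral_poly)
  show "endo_den \<noteq> 0" "degree endo_den = 9"
    using i two_neq_0 unfolding endo_den_def two by (auto simp: degree_mult_eq)
  have "degree (12 * iso_num * iso_den + [:18 - 8 * s:] * iso_den\<^sup>2) < degree (iso_num\<^sup>2)"
    using i degree_smult_le[of 12 "iso_num * iso_den"] degree_smult_le[of "18 - 8 * s" "iso_den\<^sup>2"] unfolding twelve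
    by (intro degree_add_less) (auto simp: degree_mult_eq degree_power_eq)
  then have "degree (iso_num\<^sup>2 + (12 * iso_num * iso_den + [:18 - 8 * s:] * iso_den\<^sup>2)) = degree (iso_num\<^sup>2)"
    by (rule degree_add_eq_left)
  then show "degree endo_num = 10"
    using i unfolding endo_num_def degree_minus add.assoc by (simp add: degree_power_eq)
qed

lemma s_nonzero: "s \<noteq> 0"
  using s_square five_neq_0 by auto

lemma coeff_0_endo: "coeff endo_num 0 \<noteq> 0" "coeff (2 * q1\<^sup>2 * q2\<^sup>2) 0 \<noteq> 0"
proof -
  have e: "2 + s \<noteq> 0" using unit_2_s by auto
  have q: "76 + 34 * s = 2 * ((2 + s) * (2 + s) * (2 + s))" "10 + 4 * s = 2 * (s * (2 + s))"
    by (simp_all add: algebra_simps ss)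
  have q0: "coeff q1 0 \<noteq> 0" "coeff q2 0 \<noteq> 0"
    using e two_neq_0 s_nonzero unfolding q1_def q2_def coeff_pCons_0 q by auto
  then show "coeff (2 * q1\<^sup>2 * q2\<^sup>2) 0 \<noteq> 0"
    using two_neq_0 by (simp add: coeff_mult_0 power2_eq_square numeral_poly)
  have "coeff endo_num 0 = - ((18 - 8 * s) * (coeff q2 0) ^ 4)"
    by (simp add: endo_num_def iso_num_def iso_den_def coeff_mult_0 power2_eq_square power4_eq_xxxx mult.assoc)
  then show "coeff endo_num 0 \<noteq> 0" using q0 B'_nonzero by simp
qed

lemma endo_den_eq: "endo_den = [:0, 1:] * (2 * q1\<^sup>2 * q2\<^sup>2)"
  by (simp add: endo_den_def iso_num_def iso_den_def)

text \<open>The ordinate X' / \<alpha>, for the abscissa X, is the one forced by the multiplier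
  \<alpha>; the curve equation is then \<open>endo_equation\<close> with \<alpha>^2 = - 10.\<close>

lemma endo_point:
  assumes "\<alpha> * \<alpha> = - 10"
  defines "H \<equiv> Affine (to_fract endo_num / to_fract endo_den)
    (to_fract endo_wronskian / to_fract ([:\<alpha>:] * endo_den\<^sup>2))"
  shows "good H (to_fract [:\<alpha>:])" "height H = 10"
proof -
  have \<alpha>0: "\<alpha> \<noteq> 0"
  proof
    assume "\<alpha> = 0"
    then have "2 * (5 :: 'a) = 0" using assms(1) by simp
    then show False using two_neq_0 five_neq_0 by (metis mult_eq_0_iff)
  qed
  have cop: "coprime endo_num endo_den"
  proof -
    have "gcd endo_num (gcd endo_den 0) = 1"
      by (rule gcd3_eq_1I) (use prime_dvd_isogeny degree_endo in auto)
    then show ?thesis by (simp add: coprime_iff_gcd_eq_1)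
  qed
  note deg = degree_num_den[OF refl cop degree_endo(3)]
  show "height H = 10" using deg degree_endo by (simp add: H_def height_def)
  have polar: "polar H" using deg degree_endo by (simp add: H_def polar_def)
  define n e w a where "n = to_fract endo_num" "e = to_fract endo_den" "w = to_fract endo_wronskian"
    "a = to_fract [:\<alpha>:]"
  note defs' = n_e_w_a_def
  have e0: "e \<noteq> 0" using degree_endo by (simp add: defs')
  have a: "a * a = - 10"
  proof -
    have "[:\<alpha>:] * [:\<alpha>:] = - (2 * 5 :: 'a poly)" using assms(1) by (simp add: numeral_poly)
    then have "a * a = - to_fract (2 * 5)" unfolding defs' by (metis to_fract_mult to_fract_uminus)
    also have "(2 * 5 :: 'a poly) = 2 * (4 + 1)" by simp
    finally show ?thesis by (simp only: to_fract_hom to_fract_1) simp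
  qed
  have a0: "a \<noteq> 0" using \<alpha>0 by (simp add: defs')
  have twelve: "to_fract (12 :: 'a poly) = 12" "to_fract (- 10 :: 'a poly) = - 10"
  proof -
    have "(12 :: 'a poly) = 4 * (2 + 1)" "(- 10 :: 'a poly) = - (2 * (4 + 1))" by simp_all
    then have "to_fract (12 :: 'a poly) = 4 * (2 + 1)" "to_fract (- 10 :: 'a poly) = - (2 * (4 + 1))"
      by (simp_all only: to_fract_hom to_fract_uminus to_fract_1)
    then show "to_fract (12 :: 'a poly) = 12" "to_fract (- 10 :: 'a poly) = - 10" by simp_all
  qed
  have c12: "to_fract [:12 :: 'a:] = 12" using twelve by (simp add: numeral_poly)
  have eq: "- 10 * (n ^ 3 + 12 * n\<^sup>2 * e + to_fract [:18 + 8 * s:] * n * e\<^sup>2) * e = to_fract f * w\<^sup>2"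
    using arg_cong[OF endo_equation, of to_fract] unfolding to_fract_hom twelve defs' .
  have on: "on_curve H"
  proof -
    have "to_fract f * (w / (a * e\<^sup>2))\<^sup>2 = to_fract f * w\<^sup>2 / (a * a * e ^ 4)"
      by (simp add: power2_eq_square power4_eq_xxxx)
    also have "\<dots> = (n ^ 3 + 12 * n\<^sup>2 * e + to_fract [:18 + 8 * s:] * n * e\<^sup>2) / e ^ 3"
    proof -
      have "(10 :: 'a poly fract) \<noteq> 0" using a a0 by (metis minus_zero mult_eq_0_iff)
      then show ?thesis unfolding eq[symmetric] a using e0 by (simp add: field_simps power4_eq_xxxx power3_eq_cube)
    qed
    also have "\<dots> = cubic (n / e)"
    proof -
      have "cubic (n / e) = (n / e) ^ 3 + 12 * (n / e)\<^sup>2 + to_fract [:18 + 8 * s:] * (n / e)"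
        unfolding cubic_def by (simp only: c12)
      then show ?thesis using e0 by (simp add: field_simps power2_eq_square power3_eq_cube)
    qed
    finally show ?thesis unfolding H_def on_curve.simps defs' by (simp only: to_fract_hom)
  qed
  moreover have "multiplier H (to_fract [:\<alpha>:])"
  proof -
    have "fract_deriv (n / e) = w / e\<^sup>2"
      unfolding defs' fract_deriv_divide[OF degree_endo(3)] endo_wronskian_def by (simp only: to_fract_hom)
    also have "\<dots> = a * (w / (a * e\<^sup>2))" using a0 by simp
    finally have "fract_deriv (n / e) = a * (w / (a * e\<^sup>2))" .
    moreover have eqH: "H = Affine (n / e) (w / (a * e\<^sup>2))"
      unfolding H_def defs' by (simp only: to_fract_hom)
    then have "w / (a * e\<^sup>2) \<noteq> 0" using polar_ordinate_nonzero on polar by metis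
    ultimately show ?thesis unfolding eqH multiplier.simps defs' by blast
  qed
  ultimately show "good H (to_fract [:\<alpha>:])" using polar by (simp add: good_def)
qed

end

section \<open>Isogenies and the Hasse invariant\<close>

unbundle fps_syntax

definition eval_fls :: "'a :: field fls \<Rightarrow> 'a poly \<Rightarrow> 'a fls" where
  "eval_fls X q = poly (map_poly fls_const q) X"

lemma eval_fls_pCons [simp]: "eval_fls X (pCons a q) = fls_const a + X * eval_fls X q"
  by (simp add: eval_fls_def Polynomial.map_poly_pCons)

lemma eval_fls_0 [simp]: "eval_fls X 0 = 0"
  by (simp add: eval_fls_def)

lemma eval_fls_add [simp]: "eval_fls X (q + r) = eval_fls X q + eval_fls X r"
  by (induction q r rule: poly_induct2) (simp_all add: algebra_simps fls_plus_const)

lemma eval_fls_smult [simp]: "eval_fls X (smult c q) = fls_const c * eval_fls X q"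
  by (induction q) (simp_all add: algebra_simps fls_const_mult_const)

lemma eval_fls_mult [simp]: "eval_fls X (q * r) = eval_fls X q * eval_fls X r"
  by (induction q) (simp_all add: algebra_simps)

lemma eval_fls_diff [simp]: "eval_fls X (q - r) = eval_fls X q - eval_fls X r"
proof -
  have "eval_fls X (- r) + eval_fls X r = 0" using eval_fls_add[of X "- r" r] by simp
  then have "eval_fls X (- r) = - eval_fls X r" by (simp add: eq_neg_iff_add_eq_0)
  then show ?thesis using eval_fls_add[of X q "- r"] by simp
qed

lemma eval_fls_1 [simp]: "eval_fls X 1 = 1"
  by (simp add: one_pCons)

lemma eval_fls_power [simp]: "eval_fls X (q ^ n) = eval_fls X q ^ n"
  by (induction n) simp_all

lemma eval_fls_altdef: "eval_fls X q = (\<Sum>j\<le>degree q. fls_const (coeff q j) * X ^ j)"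
  unfolding eval_fls_def by (simp add: poly_altdef degree_map_poly coeff_map_poly)

lemma eval_fls_X: "eval_fls fls_X q = fps_to_fls (fps_of_poly q)"
  by (induction q) (simp_all add: fps_of_poly_pCons fls_times_fps_to_fls)

lemma residue_sum: "(\<Sum>i\<in>S. g i) $$ k = (\<Sum>i\<in>S. g i $$ k)" for g :: "'i \<Rightarrow> 'a :: comm_monoid_add fls"
  by (induction S rule: infinite_finite_induct) simp_all

text \<open>X^-p has derivative 0, so X^j X^-p X' is the derivative of X^(j+1) X^-p divided by j +
  1, and derivatives have no residue. The bounds on j keep j + 1 from being a multiple of p.\<close>

lemma residue_power_deriv:
  fixes X :: "'a :: field fls"
  assumes "X \<noteq> 0" "j + 1 < 2 * p" "CHAR('a) = p" "j + 1 \<noteq> p"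
  shows "(X ^ j * inverse X ^ p * fls_deriv X) $$ (-1) = 0"
proof -
  define c where "c = (of_nat (j + 1) :: 'a)"
  have c: "c \<noteq> 0"
  proof
    assume "c = 0"
    then have "p dvd j + 1" using assms(3) unfolding c_def of_nat_eq_0_iff_char_dvd by simp
    then obtain k where "j + 1 = p * k" by (elim dvdE)
    then show False using assms(2,4) by (cases k; cases "k - 1") auto
  qed
  have d0: "fls_deriv (inverse X ^ p) = 0"
  proof (cases "p = 0")
    case False
    then have "(of_nat p :: 'a fls) = 0" using assms(3) by (metis of_nat_CHAR semiring_char_fls)
    then show ?thesis by (simp add: fls_deriv_power)
  qed simp
  have "fls_deriv (X ^ (j + 1) * inverse X ^ p) = of_nat (j + 1) * (X ^ j * inverse X ^ p * fls_deriv X)"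
    unfolding fls_deriv_mult d0 fls_deriv_power[of X] by (simp add: algebra_simps)
  then have "c * ((X ^ j * inverse X ^ p * fls_deriv X) $$ (-1)) = 0"
  proof -
    assume e: "fls_deriv (X ^ (j + 1) * inverse X ^ p) = of_nat (j + 1) * (X ^ j * inverse X ^ p * fls_deriv X)"
    have "(of_nat (j + 1) :: 'a fls) = fls_const c" unfolding c_def by (rule fls_of_nat)
    then have "(fls_const c * (X ^ j * inverse X ^ p * fls_deriv X)) $$ (-1) = 0"
      using fls_deriv_residue[of "X ^ (j + 1) * inverse X ^ p"] unfolding e by (simp only:)
    then show ?thesis by simp
  qed
  then show ?thesis using c by simp
qed

lemma fls_deriv_poly: "fls_deriv (eval_fls fls_X q) = eval_fls fls_X (pderiv q)"
  by (simp add: eval_fls_X fls_deriv_fps_to_fls fps_of_poly_pderiv)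

text \<open>A map \<open>X = N / D\<close> with a simple pole at 0 and \<open>\<kappa> F(X) = F X'\<^sup>2\<close> multiplies the
  differential \<open>dx / y\<close> by \<open>sqrt \<kappa>\<close>. Comparing the residue of
  \<open>F(X)\<^sup>m X\<^sup>-\<^sup>p X'\<close>, computed in \<open>X\<close> and in \<open>x\<close>, shows that the Hasse
  invariant is multiplied by the Legendre symbol of \<open>\<kappa>\<close>.\<close>

lemma hasse_invariant_isogeny:
  fixes F D N :: "'a :: field poly"
  assumes p: "CHAR('a) = p" "prime p" "p = 2 * m + 1"
    and F: "F = [:0, B, A, 1:]"
    and nonzero: "coeff N 0 \<noteq> 0" "coeff D 0 \<noteq> 0"
    and isog: "[:\<kappa>:] * (N ^ 3 + [:A:] * N\<^sup>2 * ([:0, 1:] * D) + [:B:] * N * ([:0, 1:] * D)\<^sup>2) * ([:0, 1:] * D)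
      = F * (pderiv N * ([:0, 1:] * D) - N * pderiv ([:0, 1:] * D))\<^sup>2"
  shows "\<kappa> ^ m * coeff (F ^ m) (p - 1) = coeff (F ^ m) (p - 1)"
proof -
  let ?e = "eval_fls (fls_X :: 'a fls)"
  define T where "T = coeff (F ^ m) (p - 1)"
  define n d n' d' where "n = ?e N" "d = ?e D" "n' = ?e (pderiv N)" "d' = ?e (pderiv D)"
  note eqs = n_d_n'_d'_def
  define rn rd where "rn = fps_to_fls (inverse (fps_of_poly N))" "rd = fps_to_fls (inverse (fps_of_poly D))"
  have inv: "n * rn = 1" "d * rd = 1"
    using nonzero unfolding eqs rn_rd_def eval_fls_X
    by (simp_all add: inverse_mult_eq_1' flip: fls_times_fps_to_fls)
  have nz: "n \<noteq> 0" "d \<noteq> 0" using inv by auto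
  define x where "x = (fls_X :: 'a fls)"
  have x0: "x \<noteq> 0" by (simp add: x_def)
  define X where "X = n / (x * d)"
  have X0: "X \<noteq> 0" using nz x0 by (simp add: X_def)
  define X' where "X' = fls_deriv X"
  define W where "W = n' * (x * d) - n * (d + x * d')"
  have dn: "fls_deriv n = n'" "fls_deriv d = d'" by (simp_all add: eqs fls_deriv_poly)
  have "fls_deriv (X * (x * d)) = n'" unfolding X_def using nz x0 dn by simp
  then have "X * (d + x * d') + X' * (x * d) = n'"
    unfolding fls_deriv_mult dn X'_def by (simp add: x_def algebra_simps)
  then have X': "X' = W / (x * d)\<^sup>2"
    unfolding W_def X_def using nz x0 by (simp add: field_simps power2_eq_square)
  have eX: "?e [:0, 1:] = x" by (simp add: x_def)
  have ec: "?e [:c:] = fls_const c" for c by simp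
  have "?e (pderiv ([:0, 1:] * D)) = d + x * d'"
    unfolding pderiv_mult eval_fls_add eval_fls_mult eX by (simp add: pderiv_pCons eqs flip: one_pCons)
  then have isog': "fls_const \<kappa> * (n ^ 3 + fls_const A * n\<^sup>2 * (x * d) + fls_const B * n * (x * d)\<^sup>2) * (x * d)
      = ?e F * W\<^sup>2"
    using arg_cong[OF isog, of ?e] unfolding W_def eqs
    by (simp only: eval_fls_mult eval_fls_add eval_fls_power eX ec eval_fls_diff)
  have evF: "eval_fls X F = X ^ 3 + fls_const A * X\<^sup>2 + fls_const B * X"
    by (simp add: F algebra_simps power2_eq_square power3_eq_cube)
  have key: "fls_const \<kappa> * eval_fls X F = ?e F * X'\<^sup>2"
  proof -
    have "fls_const \<kappa> * eval_fls X F = fls_const \<kappa> * (n ^ 3 + fls_const A * n\<^sup>2 * (x * d) + fls_const B * n * (x * d)\<^sup>2) * (x * d)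
        / (x * d) ^ 4"
    proof -
      have "k * ((n / (x * d)) ^ 3 + a * (n / (x * d))\<^sup>2 + b * (n / (x * d)))
          = k * (n ^ 3 + a * n\<^sup>2 * (x * d) + b * n * (x * d)\<^sup>2) * (x * d) / (x * d) ^ 4" for k a b
        using nz x0 by (simp add: field_simps power2_eq_square power3_eq_cube power4_eq_xxxx)
      then show ?thesis unfolding evF unfolding X_def .
    qed
    also have "\<dots> = ?e F * X'\<^sup>2" unfolding isog' X' by (simp add: power_divide)
    finally show ?thesis .
  qed
  define G where "G = fps_to_fls (fps_of_poly (pderiv N) * inverse (fps_of_poly N)
      - fps_of_poly (pderiv D) * inverse (fps_of_poly D))"
  have G: "G = n' / n - d' / d"
  proof -
    have "rn = 1 / n" "rd = 1 / d" using inv nz by (simp_all add: field_simps)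
    then show ?thesis unfolding G_def eqs eval_fls_X rn_rd_def by (simp add: fls_times_fps_to_fls)
  qed
  have xi: "fls_X_inv = 1 / x" by (simp add: x_def divide_inverse fls_inverse_X)
  \<comment> \<open>Logarithmic derivative of a series with a simple pole: - 1 / x plus a power
    series.\<close>
  have L: "inverse X * X' = - fls_X_inv + G"
    unfolding X' X_def G W_def xi using nz x0 by (simp add: field_simps power2_eq_square)
  define G0 where "G0 = fps_of_poly (pderiv N) * inverse (fps_of_poly N)
      - fps_of_poly (pderiv D) * inverse (fps_of_poly D)"
  have GG0: "G = fps_to_fls G0" by (simp add: G_def G0_def)
  have odd: "odd p" using p(3) by simp
  have "(- fls_X_inv + G) ^ p = (- fls_X_inv) ^ p + G ^ p"
    using p(1,2) by (intro freshmans_dream) auto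
  then have Lp: "(inverse X * X') ^ p = - (fls_X_inv ^ p) + G ^ p"
    unfolding L using odd by (simp add: power_minus_odd)
  \<comment> \<open>As 2 m + 1 = p, the factors X'^(2 m) from \<open>key\<close> and X' combine to
    X'^p, and a p-th power of X' / X is additive in its two parts.\<close>
  have "(fls_const (\<kappa> ^ m) * eval_fls X (F ^ m) * inverse X ^ p * X') = ?e (F ^ m) * (inverse X * X') ^ p"
  proof -
    have "fls_const (\<kappa> ^ m) * eval_fls X (F ^ m) = (?e F * X'\<^sup>2) ^ m"
      unfolding key[symmetric] by (simp add: power_mult_distrib fls_const_power)
    also have "\<dots> * inverse X ^ p * X' = ?e F ^ m * inverse X ^ p * X' ^ p"
      unfolding p(3) by (simp add: power_mult_distrib power_mult[symmetric] mult_ac)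
    finally show ?thesis by (simp add: power_mult_distrib mult.assoc)
  qed
  then have "(fls_const (\<kappa> ^ m) * (eval_fls X (F ^ m) * inverse X ^ p * X')) $$ (-1)
      = (?e (F ^ m) * (- (fls_X_inv ^ p) + G ^ p)) $$ (-1)"
    unfolding Lp by (simp only: mult.assoc)
  also have "\<dots> = - ((fls_X_inv ^ p * ?e (F ^ m)) $$ (-1)) + (?e (F ^ m) * G ^ p) $$ (-1)"
    by (simp add: algebra_simps)
  also have "(?e (F ^ m) * G ^ p) $$ (-1) = 0"
    unfolding GG0 eval_fls_X fps_to_fls_power[symmetric] fls_times_fps_to_fls[symmetric] by simp
  also have "(fls_X_inv ^ p * ?e (F ^ m)) $$ (-1) = T"
    unfolding fls_X_inv_power_times_conv_shift eval_fls_X T_def using p(3) by (simp add: nat_mult_distrib)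
  finally have R: "\<kappa> ^ m * ((eval_fls X (F ^ m) * inverse X ^ p * X') $$ (-1)) = - T" by simp
  have "degree (F ^ m) = 3 * m" by (subst degree_power_eq) (simp_all add: F)
  then have "(eval_fls X (F ^ m) * inverse X ^ p * X') $$ (-1)
      = (\<Sum>j\<le>3 * m. coeff (F ^ m) j * ((X ^ j * inverse X ^ p * X') $$ (-1)))"
    unfolding eval_fls_altdef by (simp add: sum_distrib_right residue_sum mult.assoc)
  \<comment> \<open>Only the exponent p - 1 leaves a residue, since there X^j X^-p X' is X' /
    X.\<close>
  also have "\<dots> = (\<Sum>j\<in>{p - 1}. coeff (F ^ m) j * ((X ^ j * inverse X ^ p * X') $$ (-1)))"
  proof (rule sum.mono_neutral_right)
    show "\<forall>i\<in>{..3 * m} - {p - 1}. coeff (F ^ m) i * ((X ^ i * inverse X ^ p * X') $$ (-1)) = 0"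
      unfolding X'_def using p X0 by (intro ballI) (subst residue_power_deriv, auto)
  qed (use p(3) in auto)
  also have "\<dots> = T * ((inverse X * X') $$ (-1))"
  proof -
    have "X ^ (p - 1) * inverse X ^ p = inverse X"
      using X0 p(3) by (simp add: field_simps)
    then show ?thesis by (simp add: T_def)
  qed
  also have "(inverse X * X') $$ (-1) = - 1"
    unfolding L GG0 by simp
  finally show ?thesis using R by (simp add: T_def)
qed

section \<open>The Hasse invariant as a hypergeometric sum\<close>

lemma sum_power_UNIV_less:
  assumes "0 < k" "k < CARD('a :: finite_field) - 1"
  shows "(\<Sum>c\<in>UNIV. (c :: 'a) ^ k) = 0"
proof -
  have "\<exists>g :: 'a. g \<noteq> 0 \<and> g ^ k \<noteq> 1"
  proof (rule ccontr)
    assume "\<not> (\<exists>g :: 'a. g \<noteq> 0 \<and> g ^ k \<noteq> 1)"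
    then have sub: "UNIV - {0} \<subseteq> {x :: 'a. poly (monom 1 k - 1) x = 0}" by (auto simp: poly_monom)
    have d: "degree (monom 1 k - 1 :: 'a poly) \<le> k"
      by (intro degree_diff_le) (auto simp: degree_monom_le)
    have "coeff (monom 1 k - 1 :: 'a poly) k = 1" using assms(1) by simp
    then have nz: "monom 1 k - 1 \<noteq> (0 :: 'a poly)" by (metis coeff_0 zero_neq_one)
    have "CARD('a) - 1 = card (UNIV - {0 :: 'a})" by (simp add: card_Diff_subset)
    also have "\<dots> \<le> card {x :: 'a. poly (monom 1 k - 1) x = 0}" using sub by (intro card_mono) auto
    also have "\<dots> \<le> k" using card_poly_roots_bound[OF nz] d by simp
    finally show False using assms(2) by simp
  qed
  then obtain g :: 'a where g: "g \<noteq> 0" "g ^ k \<noteq> 1" by blast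
  have "(\<Sum>c\<in>UNIV. (c :: 'a) ^ k) = (\<Sum>c\<in>UNIV. (g * c) ^ k)"
    by (rule sum.reindex_bij_witness[of _ "\<lambda>c. g * c" "\<lambda>c. c / g"]) (use g in auto)
  also have "\<dots> = g ^ k * (\<Sum>c\<in>UNIV. (c :: 'a) ^ k)" by (simp add: power_mult_distrib sum_distrib_left)
  finally have "(1 - g ^ k) * (\<Sum>c\<in>UNIV. (c :: 'a) ^ k) = 0" by (simp add: algebra_simps)
  then show ?thesis using g by simp
qed

lemma of_nat_CARD [simp]: "of_nat CARD('a) = (0 :: 'a :: finite_field)"
proof -
  have "(\<Sum>c\<in>UNIV. c) = (\<Sum>c\<in>UNIV. c + (1 :: 'a))"
    by (rule sum.reindex_bij_witness[of _ "\<lambda>c. c + 1" "\<lambda>c. c - 1"]) auto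
  then show ?thesis by (simp add: sum.distrib)
qed

lemma CARD_gt_1: "1 < CARD('a :: finite_field)"
  using card_mono[of UNIV "{0, 1 :: 'a}"] by auto

lemma sum_power_UNIV:
  assumes "k < 2 * (CARD('a :: finite_field) - 1)"
  shows "(\<Sum>c\<in>UNIV. (c :: 'a) ^ k) = (if k = CARD('a) - 1 then - 1 else 0)"
proof -
  have n: "1 < CARD('a)" by (rule CARD_gt_1)
  consider "k = 0" | "0 < k" "k < CARD('a) - 1" | "k = CARD('a) - 1" | "k \<ge> CARD('a)"
    by linarith
  then show ?thesis
  proof cases
    case 1
    then show ?thesis using n by simp
  next
    case 2
    then show ?thesis using sum_power_UNIV_less by auto
  next
    case 3
    have "(c :: 'a) ^ k = (if c = 0 then 0 else 1)" for c
    proof (cases "c = 0")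
      case False
      have "c * c ^ k = c" using finite_field_power_card_eq_same[of c] n unfolding 3
        by (simp flip: power_Suc)
      then show ?thesis using False by simp
    qed (use 3 n in simp)
    then have "(\<Sum>c\<in>UNIV. (c :: 'a) ^ k) = (\<Sum>c\<in>UNIV. 1 - (if c = (0 :: 'a) then 1 else 0))"
      by (intro sum.cong) auto
    also have "\<dots> = - 1" unfolding sum_subtractf by simp
    finally show ?thesis using 3 by simp
  next
    case 4
    have "(c :: 'a) ^ k = c ^ (k - (CARD('a) - 1))" for c
    proof -
      have "c ^ k = c ^ CARD('a) * c ^ (k - CARD('a))" using 4 by (simp flip: power_add)
      also have "\<dots> = c ^ Suc (k - CARD('a))" by (simp add: finite_field_power_card_eq_same)
      also have "Suc (k - CARD('a)) = k - (CARD('a) - 1)" using 4 n by simp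
      finally show ?thesis .
    qed
    then have "(\<Sum>c\<in>UNIV. (c :: 'a) ^ k) = (\<Sum>c\<in>UNIV. (c :: 'a) ^ (k - (CARD('a) - 1)))" by simp
    also have "\<dots> = 0" using 4 n assms by (intro sum_power_UNIV_less) auto
    finally show ?thesis using 4 n by simp
  qed
qed

lemma sum_poly_UNIV:
  fixes q :: "'a :: finite_field poly"
  assumes "degree q < 2 * (CARD('a) - 1)"
  shows "(\<Sum>c\<in>UNIV. poly q c) = - coeff q (CARD('a) - 1)"
proof -
  have "(\<Sum>c\<in>UNIV. poly q c) = (\<Sum>i\<le>degree q. coeff q i * (\<Sum>c\<in>UNIV. c ^ i))"
    unfolding poly_altdef sum_distrib_left by (rule sum.swap)
  also have "\<dots> = (\<Sum>i\<le>degree q. if i = CARD('a) - 1 then - coeff q i else 0)"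
    using assms by (intro sum.cong refl) (simp add: sum_power_UNIV)
  also have "\<dots> = - coeff q (CARD('a) - 1)"
    by (simp add: sum.delta coeff_eq_0)
  finally show ?thesis .
qed

section \<open>Binomial coefficients modulo p and the middle coefficient\<close>

lemma central_binomial_Suc:
  "Suc j * ((2 * Suc j) choose (Suc j)) = 2 * (2 * j + 1) * ((2 * j) choose j)"
proof -
  have "Suc j * (Suc j * ((2 * Suc j) choose (Suc j))) = Suc j * (2 * Suc j * (Suc (2 * j) choose j))"
    using Suc_times_binomial_eq[of "Suc (2 * j)" j] by simp
  also have "\<dots> = 2 * Suc j * (Suc j * (Suc (2 * j) choose (Suc j)))"
    using binomial_symmetric[of j "Suc (2 * j)"] by simp
  also have "Suc j * (Suc (2 * j) choose (Suc j)) = Suc (2 * j) * ((2 * j) choose j)"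
    using Suc_times_binomial_eq[of "2 * j" j] by simp
  finally have "Suc j * (Suc j * ((2 * Suc j) choose (Suc j))) = Suc j * (2 * (2 * j + 1) * ((2 * j) choose j))"
    by (simp add: algebra_simps)
  then show ?thesis by (simp only: mult_cancel1) simp
qed

text \<open>(4k)! / (k!^2 (2k)!), the coefficients of 2F1(1/4, 3/4; 1; 64 z).\<close>

definition bcoeff :: "nat \<Rightarrow> nat" where
  "bcoeff k = ((2 * k) choose k) * ((4 * k) choose (2 * k))"

text \<open>In characteristic p the number m = (p - 1) / 2 equals - 1/2, and binom(- 1/2, j) (- 4)^j
  = binom(2j, j). The bound on j keeps the denominators invertible.\<close>

lemma binomial_half:
  fixes p m :: nat
  assumes "CHAR('a :: field) = p" "p = 2 * m + 1" "j < p"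
  shows "of_nat (m choose j) * (- 4) ^ j = (of_nat ((2 * j) choose j) :: 'a)"
  using assms(3)
proof (induction j)
  case (Suc j)
  have nz: "(of_nat (Suc j) :: 'a) \<noteq> 0"
    using Suc.prems assms(1) unfolding of_nat_eq_0_iff_char_dvd by (auto dest: dvd_imp_le)
  have p0: "2 * of_nat m + 1 = (0 :: 'a)"
    using of_nat_CHAR[where 'a = 'a] unfolding assms(1,2) by (simp add: add.commute)
  have "of_nat (Suc j) * of_nat (m choose Suc j) = (of_nat m - of_nat j) * (of_nat (m choose j) :: 'a)"
  proof (cases "j \<le> m")
    case True
    have "Suc j * (m choose Suc j) = (m - j) * (m choose j)"
      using binomial_absorb_comp[of m j] binomial_absorption[of j m] by (cases m) (auto simp: algebra_simps)
    then have "(of_nat (Suc j * (m choose Suc j)) :: 'a) = of_nat ((m - j) * (m choose j))" by (simp only:)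
    then show ?thesis using True by (simp only: of_nat_mult of_nat_diff)
  qed (simp add: binomial_eq_0)
  then have "of_nat (Suc j) * (of_nat (m choose Suc j) * (- 4 * x))
      = (- 4 * (of_nat m - of_nat j)) * (of_nat (m choose j) * x :: 'a)" for x
    by Groebner_Basis.algebra
  then have "of_nat (Suc j) * (of_nat (m choose Suc j) * (- 4) ^ Suc j)
      = (- 4 * (of_nat m - of_nat j)) * (of_nat (m choose j) * (- 4) ^ j :: 'a)"
    unfolding power_Suc .
  also have "- 4 * (of_nat m - of_nat j) = 2 * (2 * of_nat j + 1 :: 'a)" using p0 by Groebner_Basis.algebra
  also have "of_nat (m choose j) * (- 4) ^ j = (of_nat ((2 * j) choose j) :: 'a)" using Suc by simp
  also have "2 * (2 * of_nat j + 1) * (of_nat ((2 * j) choose j) :: 'a) = of_nat (2 * (2 * j + 1) * ((2 * j) choose j))"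
    by (simp add: algebra_simps)
  also have "\<dots> = of_nat (Suc j) * of_nat ((2 * Suc j) choose (Suc j))"
    unfolding central_binomial_Suc[symmetric] by (simp only: of_nat_mult)
  finally show ?case using nz by (metis mult_left_cancel)
qed simp

lemma prime_dvd_central_binomial:
  assumes "prime (p :: nat)" "p \<le> 2 * k" "k < p"
  shows "p dvd ((2 * k) choose k)"
proof -
  have "p dvd fact (2 * k)" using assms by (simp add: prime_dvd_fact_iff)
  also have "fact (2 * k) = fact k * fact k * ((2 * k) choose k)"
    using binomial_fact_lemma[of k "2 * k"] by simp
  finally show ?thesis using assms by (simp add: prime_dvd_mult_iff prime_dvd_fact_iff)
qed

text \<open>The factor x^m splits off, and the coefficient of x^m in (B + x (A + x))^m is expanded
  by two binomial theorems.\<close>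

lemma coeff_trinomial_power:
  fixes A B :: "'a :: comm_ring_1"
  shows "coeff ([:0, B, A, 1:] ^ m) (2 * m)
    = (\<Sum>k\<le>m. of_nat ((m choose (2 * k)) * ((2 * k) choose k)) * B ^ k * A ^ (m - 2 * k))"
proof -
  have e: "[:0, B, A, 1:] = monom 1 1 * ([:B:] + monom 1 1 * [:A, 1:])"
    by (simp add: monom_Suc)
  have "[:0, B, A, 1:] ^ m = monom 1 m * ([:B:] + monom 1 1 * [:A, 1:]) ^ m"
    unfolding e power_mult_distrib by (simp add: monom_power)
  then have "coeff ([:0, B, A, 1:] ^ m) (2 * m) = coeff (([:B:] + monom 1 1 * [:A, 1:]) ^ m) m"
    by (simp add: coeff_monom_mult)
  also have "\<dots> = (\<Sum>k\<le>m. coeff (of_nat (m choose k) * [:B:] ^ k * (monom 1 1 * [:A, 1:]) ^ (m - k)) m)"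
    by (simp add: binomial_ring coeff_sum)
  also have "\<dots> = (\<Sum>k\<le>m. of_nat ((m choose (2 * k)) * ((2 * k) choose k)) * B ^ k * A ^ (m - 2 * k))"
  proof (rule sum.cong[OF refl])
    fix k assume k: "k \<in> {..m}"
    have "of_nat (m choose k) * [:B:] ^ k * (monom 1 1 * [:A, 1:]) ^ (m - k)
        = smult (of_nat (m choose k) * B ^ k) (monom 1 (m - k) * [:A, 1:] ^ (m - k))"
      by (simp only: power_mult_distrib monom_power poly_const_pow of_nat_poly) (simp add: mult.commute)
    then have "coeff (of_nat (m choose k) * [:B:] ^ k * (monom 1 1 * [:A, 1:]) ^ (m - k)) m
        = of_nat (m choose k) * B ^ k * coeff ([:A, 1:] ^ (m - k)) k"
      using k by (simp add: coeff_monom_mult)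
    also have "coeff ([:A, 1:] ^ (m - k)) k = of_nat ((m - k) choose k) * A ^ (m - k - k)"
    proof (cases "k \<le> m - k")
      case False
      moreover have "degree ([:A, 1:] ^ (m - k)) \<le> 1 * (m - k)"
        by (rule degree_power_le[THEN order_trans]) simp
      ultimately show ?thesis by (simp add: coeff_eq_0 binomial_eq_0)
    qed (simp add: coeff_linear_poly_power)
    also have "of_nat (m choose k) * B ^ k * (of_nat ((m - k) choose k) * A ^ (m - k - k))
        = of_nat ((m choose k) * ((m - k) choose k)) * B ^ k * A ^ (m - 2 * k)"
    proof -
      have "m - k - k = m - 2 * k" by simp
      then show ?thesis by (simp only: of_nat_mult mult_ac)
    qed
    also have "(m choose k) * ((m - k) choose k) = (m choose (2 * k)) * ((2 * k) choose k)"
    proof (cases "2 * k \<le> m")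
      case True
      then show ?thesis using choose_mult[of k "2 * k" m] by (simp add: mult_2)
    next
      case False
      then have "m - k < k" by simp
      then show ?thesis using False by (simp add: binomial_eq_0)
    qed
    finally show "coeff (of_nat (m choose k) * [:B:] ^ k * (monom 1 1 * [:A, 1:]) ^ (m - k)) m
      = of_nat ((m choose (2 * k)) * ((2 * k) choose k)) * B ^ k * A ^ (m - 2 * k)" .
  qed
  finally show ?thesis .
qed

lemma hasse_invariant_hypergeometric:
  fixes A B z :: "'a :: field"
  assumes p: "CHAR('a) = p" "prime p" "p = 2 * m + 1"
    and A: "A \<noteq> 0" and z: "B = 16 * A\<^sup>2 * z"
  shows "coeff ([:0, B, A, 1:] ^ m) (p - 1) = A ^ m * (\<Sum>k<p. of_nat (bcoeff k) * z ^ k)"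
proof -
  have "coeff ([:0, B, A, 1:] ^ m) (p - 1)
      = (\<Sum>k\<le>m. of_nat ((m choose (2 * k)) * ((2 * k) choose k)) * B ^ k * A ^ (m - 2 * k))"
    using coeff_trinomial_power[of B A m] p(3) by simp
  also have "\<dots> = (\<Sum>k<p. of_nat ((m choose (2 * k)) * ((2 * k) choose k)) * B ^ k * A ^ (m - 2 * k))"
    using p(3) by (intro sum.mono_neutral_left) (auto simp: binomial_eq_0)
  also have "\<dots> = (\<Sum>k<p. A ^ m * (of_nat (bcoeff k) * z ^ k))"
  proof (rule sum.cong[OF refl])
    fix k assume k: "k \<in> {..<p}"
    show "of_nat ((m choose (2 * k)) * ((2 * k) choose k)) * B ^ k * A ^ (m - 2 * k)
        = A ^ m * (of_nat (bcoeff k) * z ^ k)"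
    proof (cases "2 * k < p")
      case True
      have e: "of_nat (m choose (2 * k)) * 16 ^ k = (of_nat ((4 * k) choose (2 * k)) :: 'a)"
        using binomial_half[OF p(1,3) True] by (simp add: power_mult)
      have "of_nat ((m choose (2 * k)) * ((2 * k) choose k)) * B ^ k * A ^ (m - 2 * k)
         = of_nat ((2 * k) choose k) * (of_nat (m choose (2 * k)) * 16 ^ k) * z ^ k * (A ^ (2 * k) * A ^ (m - 2 * k))"
        unfolding z by (simp add: power_mult_distrib mult_ac flip: power_mult)
      also have "\<dots> = of_nat ((2 * k) choose k) * of_nat ((4 * k) choose (2 * k)) * z ^ k * A ^ m"
      proof (cases "2 * k \<le> m")
        case True
        then show ?thesis unfolding e by (simp flip: power_add)
      next
        \<comment> \<open>Here m - 2 k is truncated to 0, which is harmless because the binomial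
          coefficient vanishes.\<close>
        case False
        then show ?thesis unfolding e[symmetric] by (simp add: binomial_eq_0)
      qed
      finally show ?thesis by (simp add: bcoeff_def mult_ac)
    next
      \<comment> \<open>\<open>binomial_half\<close> stops at p; from there on both sides vanish
        because p divides binom(2k, k).\<close>
      case False
      then have "p dvd ((2 * k) choose k)" using prime_dvd_central_binomial[OF p(2)] k by simp
      then have "(of_nat ((2 * k) choose k) :: 'a) = 0" using p(1) by (simp add: of_nat_eq_0_iff_char_dvd)
      then show ?thesis by (simp add: bcoeff_def)
    qed
  qed
  finally show ?thesis by (simp add: sum_distrib_left)
qed

section \<open>Clausen's identity\<close>

text \<open>The coefficients of 3F2(1/2, 1/4, 3/4; 1, 1; 256 w).\<close>

definition ccoeff :: "nat \<Rightarrow> nat" where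
  "ccoeff k = ((2 * k) choose k)\<^sup>2 * ((4 * k) choose (2 * k))"

lemma bcoeff_Suc: "(Suc k)\<^sup>2 * bcoeff (Suc k) = 4 * (4 * k + 1) * (4 * k + 3) * bcoeff k"
proof -
  define u v where "u = (2 * k) choose k" and "v = (4 * k) choose (2 * k)"
  define u' v' v1 where "u' = (2 * Suc k) choose (Suc k)" and "v' = (4 * Suc k) choose (2 * Suc k)"
    and "v1 = (2 * Suc (2 * k)) choose (Suc (2 * k))"
  have 1: "Suc k * u' = 2 * (2 * k + 1) * u" unfolding u'_def u_def by (rule central_binomial_Suc)
  have 2: "Suc (2 * k) * v1 = 2 * (4 * k + 1) * v"
  proof -
    have v: "v = (2 * (2 * k)) choose (2 * k)" by (simp add: v_def)
    have "Suc (2 * k) * v1 = 2 * (2 * (2 * k) + 1) * v"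
      unfolding v v1_def by (rule central_binomial_Suc)
    then show ?thesis by simp
  qed
  have 3: "2 * Suc k * v' = 2 * (4 * k + 3) * v1"
  proof -
    have e: "4 * Suc k = 2 * Suc (Suc (2 * k))" "2 * Suc k = Suc (Suc (2 * k))" by simp_all
    have "Suc (Suc (2 * k)) * v' = 2 * (2 * Suc (2 * k) + 1) * v1"
      unfolding v'_def v1_def e by (rule central_binomial_Suc)
    then show ?thesis by (simp add: algebra_simps)
  qed
  have "Suc (2 * k) * ((Suc k)\<^sup>2 * (u' * v')) = (Suc k * u') * (Suc k * (Suc (2 * k) * v'))"
    by (simp add: power2_eq_square algebra_simps)
  also have "Suc k * (Suc (2 * k) * v') = (4 * k + 3) * (Suc (2 * k) * v1)" using 3 by (simp add: algebra_simps)
  also have "(Suc k * u') * ((4 * k + 3) * (Suc (2 * k) * v1))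
      = Suc (2 * k) * (4 * (4 * k + 1) * (4 * k + 3) * (u * v))"
    unfolding 1 2 by (simp add: algebra_simps)
  finally have "(Suc k)\<^sup>2 * (u' * v') = 4 * (4 * k + 1) * (4 * k + 3) * (u * v)"
    by (simp only: mult_cancel1) simp
  then show ?thesis by (simp add: bcoeff_def u_def v_def u'_def v'_def)
qed

lemma ccoeff_bcoeff: "ccoeff k = ((2 * k) choose k) * bcoeff k"
  by (simp add: ccoeff_def bcoeff_def power2_eq_square)

lemma ccoeff_Suc: "Suc k ^ 3 * ccoeff (Suc k) = 8 * (2 * k + 1) * (4 * k + 1) * (4 * k + 3) * ccoeff k"
proof -
  have "Suc k ^ 3 * ccoeff (Suc k) = (Suc k * ((2 * Suc k) choose (Suc k))) * ((Suc k)\<^sup>2 * bcoeff (Suc k))"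
    by (simp add: ccoeff_bcoeff power2_eq_square power3_eq_cube algebra_simps)
  also have "\<dots> = 8 * (2 * k + 1) * (4 * k + 1) * (4 * k + 3) * ccoeff k"
    unfolding bcoeff_Suc central_binomial_Suc ccoeff_bcoeff by (simp add: algebra_simps)
  finally show ?thesis .
qed

text \<open>The quadratic substitution w = z (1 - 64 z), that is, 256 w = 4 u (1 - u) with u = 64
  z.\<close>

definition clausen_arg :: "int fps" where "clausen_arg = fps_X - 64 * fps_X\<^sup>2"
definition clausen_jac :: "int fps" where "clausen_jac = Abs_fps (\<lambda>n. 128 ^ n)"

lemma V_inverse: "clausen_jac * (1 - 128 * fps_X) = 1"
proof (rule fps_ext)
  fix n show "(clausen_jac * (1 - 128 * fps_X)) $ n = 1 $ n"
    by (cases n) (simp_all add: clausen_jac_def algebra_simps fps_numeral_fps_const)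
qed

lemma deriv_W: "fps_deriv clausen_arg = 1 - 128 * fps_X"
  by (simp add: clausen_arg_def fps_deriv_power power2_eq_square)

lemma V_deriv_W: "clausen_jac * fps_deriv clausen_arg = 1"
  by (simp add: deriv_W V_inverse)

lemma deriv_V: "fps_deriv clausen_jac = 128 * clausen_jac\<^sup>2"
proof -
  have "fps_deriv (clausen_jac * (1 - 128 * fps_X)) = 0" unfolding V_inverse by simp
  then have "fps_deriv clausen_jac * (1 - 128 * fps_X) = 128 * clausen_jac" by (simp add: algebra_simps)
  moreover have "fps_deriv clausen_jac = fps_deriv clausen_jac * (clausen_jac * (1 - 128 * fps_X))" unfolding V_inverse by simp
  ultimately have "fps_deriv clausen_jac = clausen_jac * (128 * clausen_jac)" by (simp only: mult.left_commute)
  then show ?thesis by (simp add: power2_eq_square)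
qed

text \<open>The third-order equation satisfied both by the square of the series \<open>bcoeff\<close> and by the
  composite of the series \<open>ccoeff\<close> with \<open>clausen_arg\<close>. The Euler operator of the variable \<open>clausen_arg\<close>
  is \<open>clausen_jac * clausen_arg * d/dX\<close>, because \<open>clausen_jac\<close> is the inverse of \<open>clausen_arg'\<close>.\<close>

definition euler_W :: "int fps \<Rightarrow> int fps" where "euler_W U = clausen_jac * clausen_arg * fps_deriv U"

definition clausen_eq :: "int fps \<Rightarrow> bool" where
  "clausen_eq U \<longleftrightarrow> fps_deriv clausen_arg * fps_deriv (euler_W (euler_W U))
     = 384 * euler_W (euler_W U) + 176 * euler_W U + 24 * U"

lemma clausen_eq_diff: "clausen_eq U \<Longrightarrow> clausen_eq U' \<Longrightarrow> clausen_eq (U - U')"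
  unfolding clausen_eq_def euler_W_def by (simp add: algebra_simps)

text \<open>The only exponent at the origin is 0: \<open>euler_W\<close> multiplies a lowest term of
  order n by n, so comparing lowest terms of the equation gives n^3 = 0.\<close>

lemma clausen_eq_unique:
  assumes "clausen_eq U" "U $ 0 = 0"
  shows "U = 0"
proof (rule ccontr)
  assume U: "U \<noteq> 0"
  define n where "n = subdegree U"
  have Un: "U $ n \<noteq> 0" using U by (simp add: n_def)
  have n: "n > 0" using Un assms(2) by (cases n) auto
  define e where "e = fps_shift n U"
  have Ue: "U = fps_X ^ n * e"
    unfolding e_def n_def using subdegree_decompose[of U] by (metis mult.commute)
  have e0: "e $ 0 \<noteq> 0" using Un by (simp add: e_def)
  have dX: "fps_deriv (fps_X ^ n * a) = fps_X ^ (n - 1) * (of_nat n * a + fps_X * fps_deriv a)" for a :: "int fps"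
  proof -
    have "fps_X ^ n = fps_X ^ (n - 1) * (fps_X :: int fps)"
      using n by (metis power_minus_mult)
    moreover have "fps_deriv (fps_X ^ n) = of_nat n * (fps_X ^ (n - 1) :: int fps)"
      by (simp add: fps_deriv_power fps_of_nat)
    ultimately show ?thesis by (simp add: algebra_simps)
  qed
  define u where "u = clausen_jac * (1 - 64 * fps_X)"
  have u0: "u $ 0 = 1" by (simp add: u_def clausen_jac_def)
  have vw: "clausen_jac * clausen_arg = fps_X * u" by (simp add: clausen_arg_def u_def algebra_simps power2_eq_square)
  have eul: "euler_W (fps_X ^ n * a) = fps_X ^ n * (u * (of_nat n * a + fps_X * fps_deriv a))" for a
    unfolding euler_W_def vw dX using n by (cases n) (simp_all add: algebra_simps)
  define a b where "a = u * (of_nat n * e + fps_X * fps_deriv e)" and "b = u * (of_nat n * a + fps_X * fps_deriv a)"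
  have a0: "a $ 0 = of_nat n * e $ 0" by (simp add: a_def u0 fps_of_nat[symmetric] del: fps_of_nat)
  have b0: "b $ 0 = of_nat n * a $ 0" by (simp add: b_def u0 fps_of_nat[symmetric] del: fps_of_nat)
  have P: "euler_W U = fps_X ^ n * a" "euler_W (fps_X ^ n * a) = fps_X ^ n * b"
    unfolding b_def by (simp_all only: Ue eul a_def)
  have "fps_deriv clausen_arg * (fps_X ^ (n - 1) * (of_nat n * b + fps_X * fps_deriv b))
      = 384 * (fps_X ^ n * b) + 176 * (fps_X ^ n * a) + 24 * (fps_X ^ n * e)"
    using assms(1) unfolding clausen_eq_def P dX by (simp add: Ue)
  then have "fps_X ^ (n - 1) * (fps_deriv clausen_arg * (of_nat n * b + fps_X * fps_deriv b))
      = fps_X ^ (n - 1) * (fps_X * (384 * b + 176 * a + 24 * e))"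
    using n by (cases n) (simp_all add: algebra_simps)
  then have "fps_deriv clausen_arg * (of_nat n * b + fps_X * fps_deriv b) = fps_X * (384 * b + 176 * a + 24 * e)"
    by simp
  then have "(fps_deriv clausen_arg * (of_nat n * b + fps_X * fps_deriv b)) $ 0 = 0" by simp
  then have "of_nat n * b $ 0 = 0" by (simp add: deriv_W fps_of_nat[symmetric] del: fps_of_nat)
  then show False using n e0 a0 b0 by simp
qed

text \<open>With W = \<open>clausen_arg\<close>, the hypergeometric equation for F is (W F')' = 12
  F. Hence F^2, F \<phi> and \<phi>^2 with \<phi> = W F' span a system closed under W d/dX, the
  symmetric square of the equation.\<close>

lemma clausen_eq_square: "clausen_eq ((Abs_fps (\<lambda>k. int (bcoeff k)))\<^sup>2)"
proof -
  define F where "F = Abs_fps (\<lambda>k. int (bcoeff k))"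
  define \<phi> where "\<phi> = clausen_arg * fps_deriv F"
  have d\<phi>: "fps_deriv \<phi> = 12 * F"
  proof (rule fps_ext)
    fix n
    have "int ((Suc n)\<^sup>2 * bcoeff (Suc n)) = int (4 * (4 * n + 1) * (4 * n + 3) * bcoeff n)"
      unfolding bcoeff_Suc ..
    then have rec: "(1 + int n)\<^sup>2 * int (bcoeff (Suc n)) = 4 * (4 * int n + 1) * (4 * int n + 3) * int (bcoeff n)"
      by simp
    have phi: "\<phi> $ Suc n = int (Suc n) * int (bcoeff (Suc n)) - 64 * (int n * int (bcoeff n))"
      by (cases n) (simp_all add: \<phi>_def clausen_arg_def F_def algebra_simps power2_eq_square fps_numeral_fps_const)
    have "fps_deriv \<phi> $ n = (1 + int n) * \<phi> $ Suc n" by simp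
    also have "\<dots> = (1 + int n)\<^sup>2 * int (bcoeff (Suc n)) - 64 * (1 + int n) * int n * int (bcoeff n)"
      unfolding phi by (simp add: power2_eq_square algebra_simps)
    also have "\<dots> = 12 * int (bcoeff n)"
      unfolding rec by (simp add: algebra_simps)
    finally show "fps_deriv \<phi> $ n = (12 * F) $ n" by (simp add: F_def fps_numeral_fps_const)
  qed
  have WF: "clausen_arg * fps_deriv F = \<phi>" by (simp add: \<phi>_def)
  define w where "w = fps_deriv clausen_arg"
  have vw: "clausen_jac * w = 1" using V_deriv_W by (simp add: w_def)
  have dw: "fps_deriv w = - 128" by (simp add: w_def deriv_W)
  have P: "euler_W (F\<^sup>2) = 2 * clausen_jac * F * \<phi>"
    unfolding euler_W_def \<phi>_def by (simp add: power2_eq_square algebra_simps)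
  have num: "fps_deriv (2 :: int fps) = 0" "fps_deriv (24 :: int fps) = 0" "fps_deriv (256 :: int fps) = 0"
    by simp_all
  have Q: "euler_W (euler_W (F\<^sup>2)) = 2 * clausen_jac\<^sup>2 * \<phi>\<^sup>2 + 24 * clausen_jac\<^sup>2 * clausen_arg * F\<^sup>2 + 256 * clausen_jac ^ 3 * clausen_arg * F * \<phi>"
  proof -
    have "euler_W (euler_W (F\<^sup>2)) = clausen_jac * clausen_arg * (2 * (128 * clausen_jac\<^sup>2) * F * \<phi> + 2 * clausen_jac * fps_deriv F * \<phi> + 2 * clausen_jac * F * (12 * F))"
      unfolding P unfolding euler_W_def by (simp add: deriv_V d\<phi> algebra_simps)
    also have "\<dots> = clausen_jac * (2 * (128 * clausen_jac\<^sup>2) * clausen_arg * F * \<phi> + 2 * clausen_jac * (clausen_arg * fps_deriv F) * \<phi> + 2 * clausen_jac * clausen_arg * F * (12 * F))"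
      by (simp add: algebra_simps)
    also have "\<dots> = 2 * clausen_jac\<^sup>2 * \<phi>\<^sup>2 + 24 * clausen_jac\<^sup>2 * clausen_arg * F\<^sup>2 + 256 * clausen_jac ^ 3 * clausen_arg * F * \<phi>"
      unfolding WF by Groebner_Basis.algebra
    finally show ?thesis .
  qed
  define D where "D = fps_deriv (euler_W (euler_W (F\<^sup>2)))"
  have "D
    = 2 * (2 * clausen_jac * (128 * clausen_jac\<^sup>2) * \<phi>\<^sup>2 + clausen_jac\<^sup>2 * (2 * \<phi> * (12 * F)))
      + 24 * (2 * clausen_jac * (128 * clausen_jac\<^sup>2) * clausen_arg * F\<^sup>2 + clausen_jac\<^sup>2 * w * F\<^sup>2 + 2 * clausen_jac\<^sup>2 * F * (clausen_arg * fps_deriv F))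
      + 256 * (3 * clausen_jac\<^sup>2 * (128 * clausen_jac\<^sup>2) * clausen_arg * F * \<phi> + clausen_jac ^ 3 * (w * F * \<phi> + (clausen_arg * fps_deriv F) * \<phi> + clausen_arg * F * (12 * F)))"
    unfolding D_def Q by (simp add: deriv_V d\<phi> w_def fps_deriv_power power2_eq_square power3_eq_cube algebra_simps)
  also have "\<dots> = 2 * (2 * clausen_jac * (128 * clausen_jac\<^sup>2) * \<phi>\<^sup>2 + clausen_jac\<^sup>2 * (2 * \<phi> * (12 * F)))
      + 24 * (2 * clausen_jac * (128 * clausen_jac\<^sup>2) * clausen_arg * F\<^sup>2 + clausen_jac\<^sup>2 * w * F\<^sup>2 + 2 * clausen_jac\<^sup>2 * F * \<phi>)
      + 256 * (3 * clausen_jac\<^sup>2 * (128 * clausen_jac\<^sup>2) * clausen_arg * F * \<phi> + clausen_jac ^ 3 * (w * F * \<phi> + \<phi> * \<phi> + clausen_arg * F * (12 * F)))"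
    unfolding WF ..
  finally have "w * D = 384 * euler_W (euler_W (F\<^sup>2)) + 176 * euler_W (F\<^sup>2) + 24 * F\<^sup>2"
    unfolding Q unfolding P using vw by Groebner_Basis.algebra
  then show ?thesis unfolding clausen_eq_def D_def w_def F_def .
qed

text \<open>The constants are those of 8 (2 \<theta> + 1) (4 \<theta> + 1) (4 \<theta> + 3), from
  the recurrence of \<open>ccoeff\<close>; under composition the Euler operator \<theta> turns into
  \<open>euler_W\<close>.\<close>

lemma clausen_eq_compose: "clausen_eq (Abs_fps (\<lambda>k. int (ccoeff k)) oo clausen_arg)"
proof -
  define G where "G = Abs_fps (\<lambda>k. int (ccoeff k))"
  define \<theta> where "\<theta> a = fps_X * fps_deriv a" for a :: "int fps"
  have W0: "clausen_arg $ 0 = 0" by (simp add: clausen_arg_def power2_eq_square)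
  have comp: "\<theta> a oo clausen_arg = euler_W (a oo clausen_arg)" for a
  proof -
    have "\<theta> a oo clausen_arg = clausen_arg * (fps_deriv a oo clausen_arg)"
      unfolding \<theta>_def fps_compose_mult_distrib[OF W0] by (simp add: fps_X_fps_compose_startby0[OF W0])
    moreover have "euler_W (a oo clausen_arg) = clausen_arg * (fps_deriv a oo clausen_arg) * (clausen_jac * fps_deriv clausen_arg)"
      unfolding euler_W_def fps_compose_deriv[OF W0] by (simp add: algebra_simps)
    ultimately show ?thesis by (simp add: V_deriv_W)
  qed
  have "\<theta> (\<theta> (\<theta> G)) = fps_X * (256 * \<theta> (\<theta> (\<theta> G)) + 384 * \<theta> (\<theta> G) + 176 * \<theta> G + 24 * G)"
  proof (rule fps_ext)
    fix n
    have t: "\<theta> a $ n = of_nat n * a $ n" for a n by (cases n) (simp_all add: \<theta>_def)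
    show "\<theta> (\<theta> (\<theta> G)) $ n = (fps_X * (256 * \<theta> (\<theta> (\<theta> G)) + 384 * \<theta> (\<theta> G) + 176 * \<theta> G + 24 * G)) $ n"
    proof (cases n)
      case (Suc k)
      have "int (Suc k ^ 3 * ccoeff (Suc k)) = int (8 * (2 * k + 1) * (4 * k + 1) * (4 * k + 3) * ccoeff k)"
        unfolding ccoeff_Suc ..
      then show ?thesis
        by (simp add: Suc t G_def fps_numeral_fps_const power3_eq_cube algebra_simps)
    qed (simp add: t)
  qed
  then have "\<theta> (\<theta> (\<theta> G)) oo clausen_arg
      = (fps_X * (256 * \<theta> (\<theta> (\<theta> G)) + 384 * \<theta> (\<theta> G) + 176 * \<theta> G + 24 * G)) oo clausen_arg" by simp
  also have "\<dots> = clausen_arg * (256 * (\<theta> (\<theta> (\<theta> G)) oo clausen_arg) + 384 * (\<theta> (\<theta> G) oo clausen_arg) + 176 * (\<theta> G oo clausen_arg) + 24 * (G oo clausen_arg))"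
    by (simp add: fps_compose_mult_distrib[OF W0] fps_compose_add_distrib fps_X_fps_compose_startby0[OF W0]
        fps_numeral_fps_const)
  finally have R: "euler_W (euler_W (euler_W (G oo clausen_arg))) = clausen_arg * (256 * euler_W (euler_W (euler_W (G oo clausen_arg)))
      + 384 * euler_W (euler_W (G oo clausen_arg)) + 176 * euler_W (G oo clausen_arg) + 24 * (G oo clausen_arg))"
    unfolding comp .
  define H where "H = G oo clausen_arg"
  define P where "P = euler_W H"
  define Q where "Q = euler_W P"
  define w where "w = fps_deriv clausen_arg"
  \<comment> \<open>The point of the substitution: 1 - 256 W is a perfect square, one factor of
    which cancels against \<open>clausen_jac\<close>.\<close>
  have w2: "w\<^sup>2 = 1 - 256 * clausen_arg" by (simp add: w_def deriv_W clausen_arg_def power2_eq_square algebra_simps)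
  have vw: "clausen_jac * w = 1" using V_deriv_W by (simp add: w_def)
  have "(1 - 256 * clausen_arg) * (clausen_jac * clausen_arg * fps_deriv Q) = clausen_arg * (384 * Q + 176 * P + 24 * H)"
  proof -
    have "(1 - 256 * clausen_arg) * x = clausen_arg * (a + b + c)" if "x = clausen_arg * (256 * x + a + b + c)" for x a b c
      using that by Groebner_Basis.algebra
    then show ?thesis using R[folded H_def, folded P_def, folded Q_def] unfolding euler_W_def[of Q] .
  qed
  then have "clausen_arg * (w * fps_deriv Q) = clausen_arg * (384 * Q + 176 * P + 24 * H)"
    unfolding w2[symmetric] using vw by Groebner_Basis.algebra
  moreover have "clausen_arg \<noteq> 0"
  proof
    assume "clausen_arg = 0"
    then have "clausen_arg $ 1 = 0" by simp
    then show False by (simp add: clausen_arg_def power2_eq_square fps_numeral_fps_const)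
  qed
  ultimately have "w * fps_deriv Q = 384 * Q + 176 * P + 24 * H" by simp
  then have "clausen_eq H" unfolding clausen_eq_def Q_def P_def w_def .
  then show ?thesis unfolding H_def G_def .
qed

lemma clausen: "(Abs_fps (\<lambda>k. int (bcoeff k)))\<^sup>2 = Abs_fps (\<lambda>k. int (ccoeff k)) oo clausen_arg"
proof -
  have "clausen_eq ((Abs_fps (\<lambda>k. int (bcoeff k)))\<^sup>2 - (Abs_fps (\<lambda>k. int (ccoeff k)) oo clausen_arg))"
    using clausen_eq_diff clausen_eq_square clausen_eq_compose by blast
  moreover have "((Abs_fps (\<lambda>k. int (bcoeff k)))\<^sup>2 - (Abs_fps (\<lambda>k. int (ccoeff k)) oo clausen_arg)) $ 0 = 0"
    by (simp add: power2_eq_square bcoeff_def ccoeff_def)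
  ultimately show ?thesis using clausen_eq_unique by fastforce
qed

section \<open>Congruences for the coefficients\<close>

lemma prime_square_not_dvd_fact:
  assumes "prime (p :: nat)" "r < p"
  shows "\<not> p\<^sup>2 dvd fact (p + r)"
  using assms(2)
proof (induction r)
  case 0
  have "\<not> p dvd fact (p - 1)" using assms(1) prime_gt_0_nat[of p] by (simp add: prime_dvd_fact_iff)
  moreover have "fact p = p * fact (p - 1)" using assms(1) by (simp add: fact_reduce prime_gt_0_nat)
  ultimately show ?case using assms(1) prime_gt_0_nat[of p] by (simp add: power2_eq_square)
next
  case (Suc r)
  have "\<not> p dvd p + Suc r" using Suc.prems by (metis dvd_add_right_iff dvd_refl dvd_imp_le not_le zero_less_Suc)
  then have "coprime (p\<^sup>2) (p + Suc r)" using assms(1) by (simp add: prime_imp_coprime)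
  moreover have "fact (p + Suc r) = (p + Suc r) * (fact (p + r) :: nat)" by simp
  moreover have "\<not> p\<^sup>2 dvd fact (p + r)" using Suc by simp
  ultimately show ?case by (metis coprime_dvd_mult_right_iff)
qed

text \<open>(2n)! contains the multiples p, 2 p and 3 p, whereas n! contains p exactly once, so at
  least one factor p survives in the quotient.\<close>

lemma prime_dvd_central_binomial_upper:
  assumes "prime (p :: nat)" "3 * p \<le> 2 * n" "n < 2 * p"
  shows "p dvd ((2 * n) choose n)"
proof -
  have p0: "p > 0" using assms(1) prime_gt_0_nat by blast
  have "p dvd fact n" using assms by (simp add: prime_dvd_fact_iff)
  then obtain u where u: "fact n = p * u" by (elim dvdE)
  have "\<not> p\<^sup>2 dvd fact (p + (n - p))"
    using assms by (intro prime_square_not_dvd_fact) auto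
  then have "\<not> p\<^sup>2 dvd (fact n :: nat)" using assms by simp
  then have pu: "\<not> p dvd u" unfolding u using p0 by (simp add: power2_eq_square)
  have f: "fact k = k * fact (k - 1)" if "k > 0" for k :: nat using that by (simp add: fact_reduce)
  have "p dvd fact (2 * p - 1)" using assms(1) prime_gt_1_nat[OF assms(1)] by (simp add: prime_dvd_fact_iff)
  then have "(2 * p) * p dvd fact (2 * p)" using p0 by (subst f) auto
  then have "p * p dvd fact (2 * p)" by (metis dvd_mult_left dvd_trans mult.assoc mult.commute)
  moreover have "(fact (2 * p) :: nat) dvd fact (3 * p - 1)" using p0 by (intro fact_dvd) auto
  ultimately have "p * p dvd fact (3 * p - 1)" by (rule dvd_trans)
  then have "(3 * p) * (p * p) dvd fact (3 * p)" using p0 by (subst f) auto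
  then have "p * (p * p) dvd fact (3 * p)" by (metis dvd_mult_left dvd_trans mult.assoc mult.commute)
  moreover have "(fact (3 * p) :: nat) dvd fact (2 * n)" using assms by (intro fact_dvd) auto
  ultimately have "p * (p * p) dvd fact (2 * n)" by (rule dvd_trans)
  also have "fact (2 * n) = fact n * fact n * ((2 * n) choose n)"
    using binomial_fact_lemma[of n "2 * n"] by simp
  also have "\<dots> = (p * p) * (u * u * ((2 * n) choose n))" unfolding u by (simp add: algebra_simps)
  finally have "(p * p) * p dvd (p * p) * (u * u * ((2 * n) choose n))" by (simp add: mult_ac)
  then have "p dvd u * u * ((2 * n) choose n)" using p0 by (subst (asm) nat_mult_dvd_cancel1) auto
  then show ?thesis using pu assms(1) by (simp add: prime_dvd_mult_iff)
qed

lemma prime_dvd_bcoeff: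
  assumes "prime p" "p \<le> 4 * k" "k < p"
  shows "p dvd bcoeff k"
proof (cases "2 * k < p")
  case True
  then show ?thesis using prime_dvd_central_binomial[of p "2 * k"] assms by (simp add: bcoeff_def)
next
  case False
  then show ?thesis using prime_dvd_central_binomial[of p k] assms by (simp add: bcoeff_def)
qed

lemma prime_square_dvd_bcoeff:
  assumes "prime p" "3 * p \<le> 4 * k" "k < p"
  shows "p\<^sup>2 dvd bcoeff k"
proof -
  have "p dvd ((2 * k) choose k)" using prime_dvd_central_binomial[of p k] assms by simp
  moreover have "p dvd ((4 * k) choose (2 * k))"
    using prime_dvd_central_binomial_upper[of p "2 * k"] assms by simp
  ultimately show ?thesis unfolding bcoeff_def power2_eq_square by (rule mult_dvd_mono)
qed

text \<open>Either both indices are at least p/4, and each coefficient contributes one p, or one is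
  smaller, and the other exceeds 3p/4 and contributes p^2 by itself.\<close>

lemma prime_square_dvd_bcoeff_mult:
  assumes "prime p" "k < p" "l < p" "p \<le> k + l"
  shows "p\<^sup>2 dvd bcoeff k * bcoeff l"
proof -
  consider "p \<le> 4 * k" "p \<le> 4 * l" | "3 * p \<le> 4 * l" | "3 * p \<le> 4 * k" using assms(4) by linarith
  then show ?thesis
  proof cases
    case 1
    then show ?thesis unfolding power2_eq_square using assms by (intro mult_dvd_mono prime_dvd_bcoeff)
  qed (use assms prime_square_dvd_bcoeff in auto)
qed

lemma prime_square_dvd_ccoeff:
  assumes "prime p" "p \<le> 2 * k" "k < p"
  shows "p\<^sup>2 dvd ccoeff k"
  using prime_dvd_central_binomial[OF assms] by (simp add: ccoeff_def dvd_power_same)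

text \<open>Both sides are compared as polynomials in z. Below degree p the truncations do not
  matter and Clausen's identity applies; from degree p on each side has coefficients divisible by
  p^2.\<close>

lemma truncated_clausen:
  fixes z :: int
  assumes "prime p"
  shows "[(\<Sum>k<p. int (ccoeff k) * (z * (1 - 64 * z)) ^ k) = (\<Sum>k<p. int (bcoeff k) * z ^ k)\<^sup>2] (mod int (p\<^sup>2))"
proof -
  define w where "w = [:0, 1, - 64 :: int:]"
  define P1 where "P1 = (\<Sum>k<p. smult (int (ccoeff k)) (w ^ k))"
  define P2 where "P2 = (\<Sum>k<p. monom (int (bcoeff k)) k)"
  have clausen_arg: "clausen_arg = fps_of_poly w"
    by (simp add: clausen_arg_def w_def fps_of_poly_pCons power2_eq_square algebra_simps fps_numeral_fps_const fps_const_neg[symmetric] del: fps_const_neg)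
  have w: "w = monom 1 1 * [:1, - 64:]" by (simp add: w_def monom_Suc)
  have c0: "coeff (w ^ k) n = 0" if "n < k" for k n
    using that unfolding w power_mult_distrib monom_power by (simp add: coeff_monom_mult)
  have P2c: "coeff P2 n = (if n < p then int (bcoeff n) else 0)" for n
    by (simp add: P2_def coeff_sum if_distrib[of "\<lambda>f. coeff f n"] cong: if_cong)
  have low: "coeff P1 n = coeff (P2\<^sup>2) n" if n: "n < p" for n
  proof -
    have "coeff P1 n = (\<Sum>k<p. int (ccoeff k) * coeff (w ^ k) n)" by (simp add: P1_def coeff_sum)
    also have "\<dots> = (\<Sum>k=0..n. int (ccoeff k) * coeff (w ^ k) n)"
      using n c0 by (intro sum.mono_neutral_right) auto
    also have "\<dots> = (Abs_fps (\<lambda>k. int (ccoeff k)) oo clausen_arg) $ n"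
      by (simp add: fps_compose_nth clausen_arg fps_of_poly_power[symmetric])
    also have "\<dots> = ((Abs_fps (\<lambda>k. int (bcoeff k)))\<^sup>2) $ n" unfolding clausen ..
    also have "\<dots> = (\<Sum>k\<le>n. int (bcoeff k) * int (bcoeff (n - k)))"
      by (simp add: power2_eq_square fps_mult_nth atMost_atLeast0)
    also have "\<dots> = coeff (P2\<^sup>2) n"
      using n by (auto simp: power2_eq_square coeff_mult P2c intro!: sum.cong)
    finally show ?thesis .
  qed
  have high: "int (p\<^sup>2) dvd coeff P1 n - coeff (P2\<^sup>2) n" if n: "n \<ge> p" for n
  proof (rule dvd_diff)
    have dw: "degree (w ^ k) \<le> 2 * k" for k
      using degree_power_le[of w k] by (simp add: w_def)
    have "int (p\<^sup>2) dvd int (ccoeff k) * coeff (w ^ k) n" if k: "k < p" for k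
    proof (cases "n \<le> 2 * k")
      case True
      then have "p\<^sup>2 dvd ccoeff k" using prime_square_dvd_ccoeff[OF assms _ k] n by simp
      then show ?thesis by (simp only: int_dvd_int_iff dvd_mult2)
    next
      case False
      then have "coeff (w ^ k) n = 0" using dw[of k] by (intro coeff_eq_0) auto
      then show ?thesis by simp
    qed
    then show "int (p\<^sup>2) dvd coeff P1 n"
      unfolding P1_def coeff_sum by (intro dvd_sum) auto
    have "int (p\<^sup>2) dvd coeff P2 k * coeff P2 (n - k)" if "k \<le> n" for k
    proof (cases "k < p \<and> n - k < p")
      case True
      then have "p\<^sup>2 dvd bcoeff k * bcoeff (n - k)"
        using prime_square_dvd_bcoeff_mult[OF assms, of k "n - k"] n that by simp
      then have "int (p\<^sup>2) dvd int (bcoeff k * bcoeff (n - k))" by (simp only: int_dvd_int_iff)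
      then show ?thesis using True by (simp add: P2c)
    qed (auto simp: P2c)
    then show "int (p\<^sup>2) dvd coeff (P2\<^sup>2) n"
      unfolding power2_eq_square[of P2] coeff_mult by (intro dvd_sum) auto
  qed
  have "int (p\<^sup>2) dvd coeff (P1 - P2\<^sup>2) n" for n
    using low[of n] high[of n] by (cases "n < p") auto
  then have "int (p\<^sup>2) dvd poly (P1 - P2\<^sup>2) z"
    unfolding poly_altdef by (intro dvd_sum) auto
  moreover have "poly P1 z = (\<Sum>k<p. int (ccoeff k) * (z * (1 - 64 * z)) ^ k)"
    by (simp add: P1_def poly_sum w_def algebra_simps)
  moreover have "poly P2 z = (\<Sum>k<p. int (bcoeff k) * z ^ k)"
    by (simp add: P2_def poly_sum poly_monom)
  ultimately show ?thesis by (simp add: cong_iff_dvd_diff)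
qed

text \<open>Gauss's lemma with p - 2 as positive representative of - 2. For 1 \<le> x \<le> (p -
  1)/2 the residue of - 2 x is p - 2 x, which lies in the upper half exactly for x \<le> p div
  4.\<close>

lemma power_minus_2_half:
  assumes "prime p" "2 < p" "CHAR('a :: comm_ring_1) = p"
  shows "(- 2 :: 'a) ^ ((p - 1) div 2) = (- 1) ^ (p div 4)"
proof -
  have two: "\<not> int p dvd int p - 2" using assms(2) by (auto dest!: zdvd_imp_le)
  interpret GAUSS p "int p - 2"
    by standard (use assms two in \<open>auto simp: cong_0_iff\<close>)
  have odd: "odd (int p)" using assms prime_odd_nat[of p] by simp
  have mod: "x * (int p - 2) mod int p = int p - 2 * x" if "x \<in> A" for x
  proof -
    have "x * (int p - 2) = (int p - 2 * x) + int p * (x - 1)" by (simp add: algebra_simps)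
    then have "x * (int p - 2) mod int p = (int p - 2 * x) mod int p" by simp
    also have "\<dots> = int p - 2 * x" using that odd by (intro mod_pos_pos_trivial) (auto simp: A_def)
    finally show ?thesis .
  qed
  have "E = (\<lambda>x. int p - 2 * x) ` {1..int (p div 4)}"
  proof -
    have "C = (\<lambda>x. int p - 2 * x) ` A"
      unfolding C_def B_def image_image by (intro image_cong refl) (simp add: mod)
    then have "E = (\<lambda>x. int p - 2 * x) ` {x \<in> A. (int p - 1) div 2 < int p - 2 * x}"
      by (auto simp: E_def)
    also have "{x \<in> A. (int p - 1) div 2 < int p - 2 * x} = {1..int (p div 4)}"
      using odd unfolding A_def by (auto elim!: oddE)
    finally show ?thesis .
  qed
  then have "card E = p div 4" by (simp add: card_image inj_on_def)
  moreover have "nat ((int p - 1) div 2) = (p - 1) div 2" using assms(2) by simp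
  ultimately have "[(int p - 2) ^ ((p - 1) div 2) = (- 1) ^ (p div 4)] (mod int p)"
    using pre_gauss_lemma by simp
  then have "(of_int ((int p - 2) ^ ((p - 1) div 2)) :: 'a) = of_int ((- 1) ^ (p div 4))"
    unfolding of_int_eq_iff_cong_CHAR assms(3) .
  moreover have "(of_nat p :: 'a) = 0" using assms(3) by (metis of_nat_CHAR)
  ultimately show ?thesis by simp
qed

text \<open>Reciprocity for 5, which is 1 modulo 4, gives a root modulo p; one Newton step lifts it
  to p^2.\<close>

lemma sqrt5_mod_prime_square:
  assumes "prime p" "[int p = 1] (mod 5) \<or> [int p = - 1] (mod 5)" "2 < p" "p \<noteq> 5"
  obtains s :: int where "[s\<^sup>2 = 5] (mod int (p\<^sup>2))"
proof -
  have "QuadRes 5 (int p)"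
  proof -
    have "[1\<^sup>2 = int p] (mod 5) \<or> [2\<^sup>2 = int p] (mod 5)"
      using assms(2) by (auto simp: cong_def)
    then show ?thesis unfolding QuadRes_def by blast
  qed
  moreover have "\<not> [int p = 0] (mod 5)" using assms(2) by (auto simp: cong_def)
  ultimately have "Legendre (int p) (int 5) = 1" by (simp add: Legendre_def)
  moreover have "Legendre (int p) (int 5) * Legendre (int 5) (int p) = (- 1) ^ ((p - 1) div 2 * ((5 - 1) div 2))"
    by (rule Quadratic_Reciprocity) (use assms in auto)
  ultimately have "Legendre 5 (int p) = 1" by simp
  then have "QuadRes (int p) 5" by (auto simp: Legendre_def split: if_splits)
  then obtain s0 where s0: "[s0\<^sup>2 = 5] (mod int p)" by (auto simp: QuadRes_def)
  have ip: "prime (int p)" using assms(1) by simp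
  have "\<not> p dvd 5" using primes_dvd_imp_eq[OF assms(1), of 5] assms(4) by auto
  then have "\<not> int p dvd int 5" by (simp only: int_dvd_int_iff not_False_eq_True)
  then have n5: "\<not> int p dvd s0\<^sup>2" using cong_dvd_iff[OF s0] by simp
  have "\<not> int p dvd 2" using assms(3) by (auto dest: zdvd_imp_le)
  then have "\<not> int p dvd 2 * s0" using n5 by (simp add: prime_dvd_mult_iff[OF ip] power2_eq_square)
  then have "coprime (int p) (2 * s0)" by (rule prime_imp_coprime[OF ip])
  then have "coprime (2 * s0) (int p)" by (simp only: coprime_commute)
  then obtain i where i: "[2 * s0 * i = 1] (mod int p)" using cong_solve_coprime_int by blast
  obtain q where q: "s0\<^sup>2 - 5 = int p * q" using s0 by (auto simp: cong_iff_dvd_diff)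
  obtain r where r: "2 * s0 * i - 1 = int p * r" using i by (auto simp: cong_iff_dvd_diff)
  \<comment> \<open>The Newton correction (s0^2 - 5) / (2 s0), with \<open>i\<close> in place of the
    inverse of 2 s0.\<close>
  have "(s0 - int p * q * i)\<^sup>2 - 5 = (s0\<^sup>2 - 5) - int p * q * (2 * s0 * i) + int p * int p * (q\<^sup>2 * i\<^sup>2)"
    by (simp add: power2_eq_square algebra_simps)
  also have "2 * s0 * i = 1 + int p * r" using r by simp
  also note q
  finally have "(s0 - int p * q * i)\<^sup>2 - 5 = int p * int p * (q\<^sup>2 * i\<^sup>2 - q * r)"
    by (simp add: algebra_simps)
  then have "[(s0 - int p * q * i)\<^sup>2 = 5] (mod int (p\<^sup>2))"
    unfolding cong_iff_dvd_diff by (simp add: power2_eq_square)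
  then show ?thesis by (rule that)
qed

section \<open>The theorem\<close>

lemma p_integral_divide:
  assumes "coprime u (int p)" "u \<noteq> 0"
  shows "of_int n / of_int u \<in> p_integral p"
proof -
  obtain a d where q: "quotient_of (of_int n / of_int u) = (a, d)" by (cases "quotient_of (of_int n / of_int u)")
  have d: "d > 0" and cop: "coprime a d"
    using quotient_of_denom_pos[OF q] quotient_of_coprime[OF q] by auto
  have "(of_int n / of_int u :: rat) = of_int a / of_int d" by (rule quotient_of_div[OF q])
  then have "(of_int (n * d) :: rat) = of_int (a * u)" using d assms(2) by (simp add: field_simps)
  then have "n * d = a * u" by (simp only: of_int_eq_iff)
  then have "d dvd u" using cop by (metis coprime_commute coprime_dvd_mult_right_iff dvd_triv_right)
  then have "coprime d (int p)" using assms(1) by (meson coprime_divisors dvd_refl)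
  then show ?thesis by (simp add: p_integral_def q)
qed

lemma rat_congI:
  assumes "S * of_int u = of_int n" "coprime u (int p)" "u \<noteq> 0" "[n = u * t] (mod int M)"
  shows "rat_cong p M S (of_int t)"
proof -
  obtain c where c: "n - u * t = int M * c" using assms(4) by (auto simp: cong_iff_dvd_diff)
  have S: "S = of_int n / of_int u" using assms(1,3) by (simp add: field_simps)
  have "of_int t = (of_int t / of_int 1 :: rat)" by simp
  then have "of_int t \<in> p_integral p" using p_integral_divide[of 1 p t] by simp
  moreover have "S - of_int t = of_nat M * (of_int c / of_int u)"
  proof -
    have "S - of_int t = of_int (n - u * t) / of_int u" using assms(3) by (simp add: S field_simps)
    then show ?thesis unfolding c by simp
  qed
  ultimately show ?thesis
    unfolding rat_cong_def using p_integral_divide[OF assms(2,3)] S by blast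
qed

definition hypergeometric_sum :: "nat \<Rightarrow> int \<Rightarrow> int" where
  "hypergeometric_sum p z = (\<Sum>k<p. int (bcoeff k) * z ^ k)"

text \<open>Multiplying by 12^(4 (p - 1)) makes the statement one about integers, where w = z (1 -
  64 z) plays the role of 12^-4.\<close>

lemma sum_cong_hyp_square:
  assumes "prime p" "[s\<^sup>2 = 5] (mod int (p\<^sup>2))" "[1152 * z = 9 + 4 * s] (mod int (p\<^sup>2))"
  shows "\<exists>n. (\<Sum>k = 0..p - 1. (of_nat ((2 * k) choose k))\<^sup>2 * of_nat ((4 * k) choose (2 * k)) / 12 ^ (4 * k) :: rat)
      * of_int (12 ^ (4 * (p - 1))) = of_int n \<and> [n = 12 ^ (4 * (p - 1)) * (hypergeometric_sum p z)\<^sup>2] (mod int (p\<^sup>2))"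
proof (intro exI conjI)
  define n where "n = (\<Sum>k<p. int (ccoeff k) * (12 ^ 4) ^ (p - 1 - k))"
  have set: "{0..p - 1} = {..<p}" using prime_gt_0_nat[OF assms(1)] by auto
  have "(\<Sum>k<p. (of_nat ((2 * k) choose k))\<^sup>2 * of_nat ((4 * k) choose (2 * k)) / 12 ^ (4 * k) :: rat)
      * of_int (12 ^ (4 * (p - 1))) = (\<Sum>k<p. of_int (int (ccoeff k) * (12 ^ 4) ^ (p - 1 - k)))"
    unfolding sum_distrib_right
  proof (rule sum.cong[OF refl])
    fix k assume "k \<in> {..<p}"
    then have "4 * (p - 1) = 4 * k + 4 * (p - 1 - k)" by auto
    then have "(12 :: rat) ^ (4 * (p - 1)) = 12 ^ (4 * k) * (12 ^ 4) ^ (p - 1 - k)"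
      by (metis power_add power_mult)
    then show "(of_nat ((2 * k) choose k))\<^sup>2 * of_nat ((4 * k) choose (2 * k)) / 12 ^ (4 * k)
        * of_int (12 ^ (4 * (p - 1))) = (of_int (int (ccoeff k) * (12 ^ 4) ^ (p - 1 - k)) :: rat)"
      by (simp add: ccoeff_def)
  qed
  then show "(\<Sum>k = 0..p - 1. (of_nat ((2 * k) choose k))\<^sup>2 * of_nat ((4 * k) choose (2 * k)) / 12 ^ (4 * k) :: rat)
      * of_int (12 ^ (4 * (p - 1))) = of_int n"
    unfolding set n_def by simp
  define w where "w = z * (1 - 64 * z)"
  have w: "[12 ^ 4 * w = 1] (mod int (p\<^sup>2))"
  proof -
    \<comment> \<open>Because 12^4 = 18 * 1152 and 64 * 12^4 = 1152^2. The product then becomes (9 +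
      4 s) (9 - 4 s) = 81 - 80.\<close>
    have "12 ^ 4 * w = (1152 * z) * (18 - 1152 * z)" by (simp add: w_def algebra_simps)
    also have "[\<dots> = (9 + 4 * s) * (18 - (9 + 4 * s))] (mod int (p\<^sup>2))"
      by (intro cong_mult cong_diff assms(3) cong_refl)
    also have "(9 + 4 * s) * (18 - (9 + 4 * s)) = 81 - 16 * s\<^sup>2" by (simp add: power2_eq_square algebra_simps)
    also have "[\<dots> = 81 - 16 * 5] (mod int (p\<^sup>2))"
      by (intro cong_mult cong_diff assms(2) cong_refl)
    finally show ?thesis by simp
  qed
  have "[n = (\<Sum>k<p. int (ccoeff k) * ((12 ^ 4) ^ (p - 1 - k) * (12 ^ 4 * w) ^ k))] (mod int (p\<^sup>2))"
    unfolding n_def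
  proof (rule cong_sum)
    fix k
    have "[int (ccoeff k) * ((12 ^ 4) ^ (p - 1 - k) * 1 ^ k)
        = int (ccoeff k) * ((12 ^ 4) ^ (p - 1 - k) * (12 ^ 4 * w) ^ k)] (mod int (p\<^sup>2))"
      by (intro cong_mult cong_pow cong_refl cong_sym[OF w])
    then show "[int (ccoeff k) * (12 ^ 4) ^ (p - 1 - k)
        = int (ccoeff k) * ((12 ^ 4) ^ (p - 1 - k) * (12 ^ 4 * w) ^ k)] (mod int (p\<^sup>2))" by simp
  qed
  also have "(\<Sum>k<p. int (ccoeff k) * ((12 ^ 4) ^ (p - 1 - k) * (12 ^ 4 * w) ^ k))
      = 12 ^ (4 * (p - 1)) * (\<Sum>k<p. int (ccoeff k) * w ^ k)"
    unfolding sum_distrib_left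
  proof (rule sum.cong[OF refl])
    fix k assume "k \<in> {..<p}"
    then have "4 * (p - 1) = 4 * (p - 1 - k) + 4 * k" by auto
    then have "(12 :: int) ^ (4 * (p - 1)) = (12 ^ 4) ^ (p - 1 - k) * (12 ^ 4) ^ k"
      by (metis power_add power_mult)
    then show "int (ccoeff k) * ((12 ^ 4) ^ (p - 1 - k) * (12 ^ 4 * w) ^ k)
        = 12 ^ (4 * (p - 1)) * (int (ccoeff k) * w ^ k)"
      by (simp only: power_mult_distrib mult_ac)
  qed
  also have "[12 ^ (4 * (p - 1)) * (\<Sum>k<p. int (ccoeff k) * w ^ k) = 12 ^ (4 * (p - 1)) * (hypergeometric_sum p z)\<^sup>2] (mod int (p\<^sup>2))"
    unfolding w_def hypergeometric_sum_def by (intro cong_mult cong_refl truncated_clausen assms(1))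
  finally show "[n = 12 ^ (4 * (p - 1)) * (hypergeometric_sum p z)\<^sup>2] (mod int (p\<^sup>2))" .
qed

lemma to_fract_of_nat: "to_fract [:of_nat k:] = (of_nat k :: 'a :: field_gcd poly fract)"
  by (simp add: to_fract_def of_nat_fract of_nat_poly)

text \<open>The first equation gives e = 4 (c - 1). If e is nonzero, the second leaves B = 48
  (invariant j = 0) or c = - 1, whence B = 32 (j = 1728). Then 4 s is 15 or 7, and 16 s^2 = 80 gives
  145 = 0 or 31 = 0.\<close>

lemma rigid_curve_sqrt5:
  fixes s c e :: "'a :: field"
  assumes "s * s = 5" "c \<noteq> 0" "(2 :: 'a) \<noteq> 0" "(3 :: 'a) \<noteq> 0" "(31 :: 'a) \<noteq> 0" "(145 :: 'a) \<noteq> 0"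
    and 1: "3 * c\<^sup>2 * e + 12 * c\<^sup>2 = c ^ 3 * 12"
    and 2: "3 * c * e\<^sup>2 + 2 * 12 * c * e + (18 + 8 * s) * c = c ^ 3 * (18 + 8 * s)"
    and 3: "e ^ 3 + 12 * e\<^sup>2 + (18 + 8 * s) * e = 0"
  shows "c = 1 \<and> e = 0"
proof -
  define B where "B = 18 + 8 * s"
  have "3 * (c * c) * (e - 4 * (c - 1)) = 0" using 1 by (simp add: power2_eq_square power3_eq_cube algebra_simps)
  then have e: "e = 4 * (c - 1)" using assms(2,4) by simp
  have "c * (3 * e\<^sup>2 + 24 * e + B - c\<^sup>2 * B) = 0"
    using 2 unfolding B_def[symmetric] by (simp add: power2_eq_square power3_eq_cube algebra_simps)
  then have eq2: "3 * e\<^sup>2 + 24 * e + B - c\<^sup>2 * B = 0" using assms(2) by simp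
  have "2 * 2 \<noteq> (0 :: 'a)" using assms(3) by (metis mult_eq_0_iff)
  then have 4: "(4 :: 'a) \<noteq> 0" by simp
  have "e = 0"
  proof (rule ccontr)
    assume e0: "e \<noteq> 0"
    then have c1: "c - 1 \<noteq> 0" using e by auto
    have "e * (e\<^sup>2 + 12 * e + B) = 0" using 3 unfolding B_def[symmetric]
      by (simp add: power2_eq_square power3_eq_cube algebra_simps)
    then have eq3: "e\<^sup>2 + 12 * e + B = 0" using e0 by simp
    have "(c - 1) * ((48 - B) * (c + 1)) = 3 * e\<^sup>2 + 24 * e + B - c\<^sup>2 * B"
      unfolding e by (simp add: power2_eq_square algebra_simps)
    then have "(c - 1) * ((48 - B) * (c + 1)) = 0" unfolding eq2 .
    then consider "B = 48" | "c = - 1" using c1 by (auto simp: eq_neg_iff_add_eq_0)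
    then show False
    proof cases
      case 1
      then have "2 * (4 * s - 15) = 0" unfolding B_def by (simp add: algebra_simps)
      then have "4 * s - 15 = 0" using assms(3) by (metis mult_eq_0_iff)
      then have s: "4 * s = 15" by simp
      have "(4 * s) * (4 * s) = 16 * (s * s)" by (simp add: algebra_simps)
      then have "(4 * s) * (4 * s) = 80" unfolding assms(1) by simp
      then have "(225 :: 'a) - 80 = 0" unfolding s by simp
      then have "(145 :: 'a) = 0" by simp
      then show False using assms(6) by simp
    next
      case 2
      then have "B = 32" using eq3 unfolding e by (simp add: power2_eq_square algebra_simps)
      then have "2 * (4 * s - 7) = 0" unfolding B_def by (simp add: algebra_simps)
      then have "4 * s - 7 = 0" using assms(3) by (metis mult_eq_0_iff)
      then have s: "4 * s = 7" by simp
      have "(4 * s) * (4 * s) = 16 * (s * s)" by (simp add: algebra_simps)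
      then have "(4 * s) * (4 * s) = 80" unfolding assms(1) by simp
      then have "(80 :: 'a) - 49 = 0" unfolding s by simp
      then have "(31 :: 'a) = 0" by simp
      then show False using assms(5) by simp
    qed
  qed
  then show ?thesis using e 4 by simp
qed

lemma hyp_mod_prime:
  fixes s z :: int
  defines "p \<equiv> CARD('n :: prime_card)"
  assumes s: "[s\<^sup>2 = 5] (mod int p)" and z: "[1152 * z = 9 + 4 * s] (mod int p)" and p5: "p > 5"
  shows "p mod 40 \<in> {21, 29, 31, 39} \<Longrightarrow> int p dvd hypergeometric_sum p z"
    and "p mod 40 \<in> {1, 9, 11, 19} \<Longrightarrow> p = x\<^sup>2 + 10 * y\<^sup>2 \<Longrightarrow> x > 0 \<Longrightarrow> y > 0
      \<Longrightarrow> [(hypergeometric_sum p z)\<^sup>2 = 4 * (int x)\<^sup>2] (mod int p)"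
proof -
  have prime: "prime p" unfolding p_def by (rule prime_card)
  have char: "CHAR('n mod_ring) = p" by (simp add: p_def)
  have card: "CARD('n mod_ring) = p" by (simp add: p_def)
  note eq_iff = of_int_eq_iff_cong_CHAR[where 'a = "'n mod_ring", unfolded char]
  define S Z where "S = (of_int s :: 'n mod_ring)" and "Z = (of_int z :: 'n mod_ring)"
  have "(of_int (s\<^sup>2) :: 'n mod_ring) = of_int 5" using s unfolding eq_iff .
  then have S: "S * S = 5" by (simp add: S_def power2_eq_square)
  have "(of_int (1152 * z) :: 'n mod_ring) = of_int (9 + 4 * s)" using z unfolding eq_iff .
  then have Z: "1152 * Z = 9 + 4 * S" by (simp add: S_def Z_def)
  have num: "(of_nat k :: 'n mod_ring) \<noteq> 0" if "\<not> p dvd k" for k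
    using that unfolding of_nat_eq_0_iff_char_dvd char .
  have small: "\<not> p dvd k" if "0 < k" "k < p" for k using that by (auto dest: dvd_imp_le)
  have nz: "(2 :: 'n mod_ring) \<noteq> 0" "(3 :: 'n mod_ring) \<noteq> 0" "(5 :: 'n mod_ring) \<noteq> 0"
    using num[OF small, of 2] num[OF small, of 3] num[OF small, of 5] p5 by simp_all
  have "(12 :: 'n mod_ring) = 2 * 2 * 3" by simp
  then have nz12: "(12 :: 'n mod_ring) \<noteq> 0" using nz by (metis mult_eq_0_iff)
  interpret curve_sqrt5 S by standard (use S nz in auto)
  define m where "m = (p - 1) div 2"
  have pm: "p = 2 * m + 1" using prime_odd_nat[OF prime] p5 by (auto simp: m_def elim!: oddE)
  have pow: "c ^ p = c" for c :: "'n mod_ring"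
    using finite_field_power_card_eq_same[of c] card by simp
  have pow2m: "(c ^ m)\<^sup>2 = 1" if "c \<noteq> 0" for c :: "'n mod_ring"
  proof -
    have "c * (c ^ m)\<^sup>2 = c" using pow[of c] unfolding pm by (simp add: mult.commute flip: power_mult)
    then show ?thesis using that by simp
  qed
  define t where "t = coeff (f ^ m) (p - 1)"
  have B: "18 + 8 * S = 16 * 12\<^sup>2 * Z"
  proof -
    have "16 * 12\<^sup>2 * Z = 2 * (1152 * Z)" by simp
    then show ?thesis unfolding Z by simp
  qed
  have t: "t = 12 ^ m * of_int (hypergeometric_sum p z)"
    using hasse_invariant_hypergeometric[OF char prime pm nz12 B]
    by (simp add: t_def f_def hypergeometric_sum_def Z_def)
  show "int p dvd hypergeometric_sum p z" if mod40: "p mod 40 \<in> {21, 29, 31, 39}"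
  proof -
    have c: "[:12 :: 'n mod_ring:] = 12" "[:- 10 :: 'n mod_ring:] = - 10" by (simp_all add: numeral_poly)
    have "(- 10) ^ m * t = t" unfolding t_def
    proof (rule hasse_invariant_isogeny[OF char prime pm f_def coeff_0_endo])
      show "[:- 10:] * (endo_num ^ 3 + [:12:] * endo_num\<^sup>2 * ([:0, 1:] * (2 * q1\<^sup>2 * q2\<^sup>2))
          + [:18 + 8 * S:] * endo_num * ([:0, 1:] * (2 * q1\<^sup>2 * q2\<^sup>2))\<^sup>2) * ([:0, 1:] * (2 * q1\<^sup>2 * q2\<^sup>2))
        = f * (pderiv endo_num * ([:0, 1:] * (2 * q1\<^sup>2 * q2\<^sup>2))
          - endo_num * pderiv ([:0, 1:] * (2 * q1\<^sup>2 * q2\<^sup>2)))\<^sup>2"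
        unfolding endo_den_eq[symmetric] c using endo_equation unfolding endo_wronskian_def .
    qed
    moreover have "(- 10 :: 'n mod_ring) ^ m = - 1"
    proof -
      have "p mod 40 = 21 \<or> p mod 40 = 29 \<or> p mod 40 = 31 \<or> p mod 40 = 39" using mod40 by simp
      \<comment> \<open>For p = 40 k + r the quotient is 10 k + r div 4, and r div 4 is 5, 7, 7 or
        9.\<close>
      then have "odd (p div 4)" by presburger
      then have "(- 2 :: 'n mod_ring) ^ m = - 1"
        using power_minus_2_half[OF prime _ char] p5 by (simp add: m_def)
      moreover have "(5 :: 'n mod_ring) ^ m = 1"
      proof -
        have "(5 :: 'n mod_ring) ^ m = (S ^ m)\<^sup>2" unfolding S[symmetric] by (simp add: power_mult_distrib power2_eq_square)
        then show ?thesis using pow2m[OF s_nonzero] by simp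
      qed
      moreover have "(- 10 :: 'n mod_ring) = (- 2) * 5" by simp
      ultimately show ?thesis by (simp only: power_mult_distrib mult_1_right)
    qed
    ultimately have "- t = t" by simp
    then have "2 * t = 0" by (metis add.left_inverse mult_2)
    then have "t = 0" using nz by simp
    then have "(of_int (hypergeometric_sum p z) :: 'n mod_ring) = of_int 0" unfolding t using nz12 by simp
    then show ?thesis unfolding eq_iff by (simp add: cong_0_iff)
  qed
  show "[(hypergeometric_sum p z)\<^sup>2 = 4 * (int x)\<^sup>2] (mod int p)"
    if mod40: "p mod 40 \<in> {1, 9, 11, 19}" and rep: "p = x\<^sup>2 + 10 * y\<^sup>2" "x > 0" "y > 0"
  proof -
    \<comment> \<open>The primes to avoid for rigidity are 31 and the factors 5 and 29 of 145; both
      29 and 31 belong to the other residue classes modulo 40.\<close>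
    have p31: "\<not> p dvd 31"
      using primes_dvd_imp_eq[OF prime, of 31] mod40 by auto
    have p145: "\<not> p dvd 145"
    proof
      assume "p dvd 145"
      then have "p dvd 5 * 29" by simp
      then have "p dvd 5 \<or> p dvd 29" using prime by (simp only: prime_dvd_mult_iff)
      then show False
        using primes_dvd_imp_eq[OF prime, of 5] primes_dvd_imp_eq[OF prime, of 29] mod40 p5 by auto
    qed
    have n31: "(31 :: 'n mod_ring) \<noteq> 0" and n145: "(145 :: 'n mod_ring) \<noteq> 0"
      using num[OF p31] num[OF p145] by simp_all
    interpret rigid_curve 12 "18 + 8 * S" p
    proof
      fix c e :: "'n mod_ring"
      assume h: "c \<noteq> 0" "3 * c\<^sup>2 * e + 12 * c\<^sup>2 = c ^ 3 * 12"
        "3 * c * e\<^sup>2 + 2 * 12 * c * e + (18 + 8 * S) * c = c ^ 3 * (18 + 8 * S)"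
        "e ^ 3 + 12 * e\<^sup>2 + (18 + 8 * S) * e = 0"
      show "c = 1 \<and> e = 0"
        by (rule rigid_curve_sqrt5[OF S h(1) nz(1,2) n31 n145 h(2-4)])
    qed (use card char p5 in auto)
    \<comment> \<open>The square root of - 10 whose sign makes x + y \<alpha> vanish.\<close>
    define \<alpha> where "\<alpha> = - (of_nat x / of_nat y :: 'n mod_ring)"
    have "y * 1 \<le> y * y" "y * y < p" using rep by (simp_all add: power2_eq_square)
    then have "y < p" by linarith
    then have y0: "(of_nat y :: 'n mod_ring) \<noteq> 0" using num[OF small] rep(3) by simp
    have lin: "of_nat x + of_nat y * \<alpha> = 0" using y0 by (simp add: \<alpha>_def)
    have "(of_nat p :: 'n mod_ring) = 0" by (metis of_nat_CHAR char)
    then have "(of_nat x)\<^sup>2 + 10 * (of_nat y)\<^sup>2 = (0 :: 'n mod_ring)" unfolding rep(1) by simp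
    then have \<alpha>: "\<alpha> * \<alpha> = - 10"
      using y0 by (simp add: \<alpha>_def field_simps power2_eq_square eq_neg_iff_add_eq_0)
    note H = endo_point[OF \<alpha>]
    have "to_fract [:of_nat x + of_nat y * \<alpha>:] = 0" unfolding lin by simp
    moreover have "[:of_nat x + of_nat y * \<alpha>:] = [:of_nat x:] + [:of_nat y:] * [:\<alpha>:]" by simp
    ultimately have lin': "of_nat x + of_nat y * to_fract [:\<alpha>:] = 0"
      by (simp only: to_fract_add to_fract_mult to_fract_of_nat)
    have "char_sum\<^sup>2 = of_nat (4 * x\<^sup>2)"
      by (rule char_sum_square[OF H rep(1,2,3) lin'])
    moreover have "char_sum = - t"
    proof -
      have "degree (f ^ m) = m * 3" by (simp add: degree_power_eq f_nonzero degree_f)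
      then have "degree (f ^ m) < 2 * (CARD('n mod_ring) - 1)" using pm p5 unfolding card by simp
      then have "(\<Sum>c\<in>UNIV. poly (f ^ m) c) = - t" unfolding t_def card[symmetric] by (rule sum_poly_UNIV)
      then show ?thesis by (simp add: char_sum_def m_def)
    qed
    ultimately have "t\<^sup>2 = of_nat (4 * x\<^sup>2)" by simp
    \<comment> \<open>The unit 12^m is a sign and disappears in the square.\<close>
    then have "(of_int (hypergeometric_sum p z))\<^sup>2 = (of_nat (4 * x\<^sup>2) :: 'n mod_ring)"
      unfolding t power_mult_distrib pow2m[OF nz12] by simp
    then have "(of_int ((hypergeometric_sum p z)\<^sup>2) :: 'n mod_ring) = of_int (4 * (int x)\<^sup>2)" by simp
    then show ?thesis unfolding eq_iff .
  qed
qed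

text \<open>A type cannot depend on the term \<open>p\<close>. It suffices to have a field whose
  characteristic is a counterexample to the theorem, if there is one.\<close>

definition claim :: "nat \<Rightarrow> bool" where
  "claim p \<longleftrightarrow> (let S = (\<Sum>k = 0..p - 1.
      (of_nat ((2 * k) choose k))\<^sup>2 * of_nat ((4 * k) choose (2 * k)) / 12 ^ (4 * k) :: rat) in
    [int p = 1] (mod 5) \<or> [int p = - 1] (mod 5) \<longrightarrow>
    (\<forall>x y :: int. int p = x\<^sup>2 + 10 * y\<^sup>2 \<and> p mod 40 \<in> {1, 9, 11, 19}
            \<longrightarrow> rat_cong p p S (of_int (4 * x\<^sup>2)))
       \<and> (p mod 40 \<in> {21, 29, 31, 39} \<longrightarrow> rat_cong p (p\<^sup>2) S 0))"

lemma claim_for_card: "claim CARD('n :: prime_card)"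
  unfolding claim_def Let_def
proof (intro impI)
  define p where "p = CARD('n)"
  define S where "S = (\<Sum>k = 0..p - 1.
      (of_nat ((2 * k) choose k))\<^sup>2 * of_nat ((4 * k) choose (2 * k)) / 12 ^ (4 * k) :: rat)"
  assume five: "[int CARD('n) = 1] (mod 5) \<or> [int CARD('n) = - 1] (mod 5)"
  then have five': "[int p = 1] (mod 5) \<or> [int p = - 1] (mod 5)" by (simp add: p_def)
  have prime: "prime p" unfolding p_def by (rule prime_card)
  have p5: "p > 5"
  proof (rule ccontr)
    assume "\<not> p > 5"
    then have "p \<in> {0, 1, 2, 3, 4, 5}" by auto
    then show False using five' prime by (auto simp: cong_def)
  qed
  obtain s where s: "[s\<^sup>2 = 5] (mod int (p\<^sup>2))"
    using sqrt5_mod_prime_square[OF prime five'] p5 by auto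
  have small: "\<not> p dvd 2" "\<not> p dvd 3" using p5 by (auto dest: dvd_imp_le)
  have cop12: "coprime 12 p"
  proof -
    have "\<not> p dvd 2 * 2 * 3" using small prime by (metis prime_dvd_mult_iff)
    then have "\<not> p dvd 12" by simp
    then show ?thesis using prime_imp_coprime[OF prime] coprime_commute by blast
  qed
  have "coprime 1152 p"
  proof -
    have "\<not> p dvd 2 ^ 7 * 3 ^ 2"
      using small prime prime_dvd_power[OF prime] by (metis prime_dvd_mult_iff)
    then have "\<not> p dvd 1152" by simp
    then show ?thesis using prime_imp_coprime[OF prime] coprime_commute by blast
  qed
  then have "coprime (int 1152) (int (p\<^sup>2))" by (simp only: coprime_int_iff coprime_power_right_iff) simp
  then obtain i where "[1152 * i = 1] (mod int (p\<^sup>2))" using cong_solve_coprime_int[of 1152 "int (p\<^sup>2)"] by auto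
  then have "[1152 * i * (9 + 4 * s) = 1 * (9 + 4 * s)] (mod int (p\<^sup>2))" by (rule cong_scalar_right)
  then obtain z where z: "[1152 * z = 9 + 4 * s] (mod int (p\<^sup>2))" by (metis mult.assoc mult_1)
  have pp: "int p dvd int (p\<^sup>2)" by simp
  note modp = cong_dvd_modulus[OF _ pp]
  note hyp = hyp_mod_prime[where 'n = 'n, folded p_def, OF modp[OF s] modp[OF z] p5]
  obtain n where n: "S * of_int (12 ^ (4 * (p - 1))) = of_int n"
    "[n = 12 ^ (4 * (p - 1)) * (hypergeometric_sum p z)\<^sup>2] (mod int (p\<^sup>2))"
    using sum_cong_hyp_square[OF prime s z] unfolding S_def by blast
  have u: "coprime (12 ^ (4 * (p - 1))) (int p)" "(12 :: int) ^ (4 * (p - 1)) \<noteq> 0"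
  proof -
    have "coprime (int 12) (int p)" using cop12 by (simp only: coprime_int_iff)
    then show "coprime (12 ^ (4 * (p - 1))) (int p)" by simp
  qed simp
  have inert: "rat_cong p (p\<^sup>2) S 0" if "p mod 40 \<in> {21, 29, 31, 39}"
  proof -
    have "int p dvd hypergeometric_sum p z" by (rule hyp(1)[OF that])
    then have "int (p\<^sup>2) dvd (hypergeometric_sum p z)\<^sup>2" by (simp add: dvd_power_same)
    then have "[12 ^ (4 * (p - 1)) * (hypergeometric_sum p z)\<^sup>2 = 12 ^ (4 * (p - 1)) * 0] (mod int (p\<^sup>2))"
      by (simp add: cong_0_iff)
    then have "[n = 12 ^ (4 * (p - 1)) * 0] (mod int (p\<^sup>2))" using n(2) cong_trans by blast
    then show ?thesis using rat_congI[OF n(1) u] by fastforce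
  qed
  have split: "rat_cong p p S (of_int (4 * x\<^sup>2))"
    if xy: "int p = x\<^sup>2 + 10 * y\<^sup>2" and mod40: "p mod 40 \<in> {1, 9, 11, 19}" for x y :: int
  proof -
    define x' y' where "x' = nat \<bar>x\<bar>" and "y' = nat \<bar>y\<bar>"
    have x2: "(int x')\<^sup>2 = x\<^sup>2" "(int y')\<^sup>2 = y\<^sup>2" by (simp_all add: x'_def y'_def)
    then have "int p = int (x'\<^sup>2 + 10 * y'\<^sup>2)" using xy by simp
    then have p: "p = x'\<^sup>2 + 10 * y'\<^sup>2" by (simp only: of_nat_eq_iff)
    have "x' > 0"
    proof (rule ccontr)
      assume "\<not> x' > 0"
      then have "p = 2 * (5 * y'\<^sup>2)" using p by simp
      then have "2 dvd p" by simp
      then show False using prime_odd_nat[OF prime] p5 by simp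
    qed
    moreover have "y' > 0"
    proof (rule ccontr)
      assume "\<not> y' > 0"
      then have p: "p = x' * x'" using p by (simp add: power2_eq_square)
      then have "x' = 1 \<or> x' = p" using prime by (metis dvd_triv_left prime_nat_iff)
      then show False using p p5 by auto
    qed
    ultimately have "[(hypergeometric_sum p z)\<^sup>2 = 4 * x\<^sup>2] (mod int p)" using hyp(2)[OF mod40 p] x2 by simp
    then have "[12 ^ (4 * (p - 1)) * (hypergeometric_sum p z)\<^sup>2 = 12 ^ (4 * (p - 1)) * (4 * x\<^sup>2)] (mod int p)"
      by (rule cong_scalar_left)
    then have "[n = 12 ^ (4 * (p - 1)) * (4 * x\<^sup>2)] (mod int p)" using modp[OF n(2)] cong_trans by blast
    then show ?thesis by (rule rat_congI[OF n(1) u])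
  qed
  show "(\<forall>x y :: int. int CARD('n) = x\<^sup>2 + 10 * y\<^sup>2 \<and> CARD('n) mod 40 \<in> {1, 9, 11, 19}
            \<longrightarrow> rat_cong CARD('n) CARD('n) (\<Sum>k = 0..CARD('n) - 1.
      (of_nat ((2 * k) choose k))\<^sup>2 * of_nat ((4 * k) choose (2 * k)) / 12 ^ (4 * k)) (of_int (4 * x\<^sup>2)))
       \<and> (CARD('n) mod 40 \<in> {21, 29, 31, 39} \<longrightarrow> rat_cong CARD('n) (CARD('n)\<^sup>2) (\<Sum>k = 0..CARD('n) - 1.
      (of_nat ((2 * k) choose k))\<^sup>2 * of_nat ((4 * k) choose (2 * k)) / 12 ^ (4 * k)) 0)"
    unfolding p_def[symmetric] S_def[symmetric] using inert split by blast
qed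

text \<open>The default 2 keeps \<open>exception\<close> prime if there is no counterexample, so the
  type built on it has prime cardinality in any case.\<close>

definition exception :: nat where
  "exception = (if \<exists>p. prime p \<and> \<not> claim p then SOME p. prime p \<and> \<not> claim p else 2)"

lemma prime_exception: "prime exception"
  unfolding exception_def using someI_ex[of "\<lambda>p. prime p \<and> \<not> claim p"] by auto

text \<open>Any counterexample would make \<open>exception\<close> one as well, so the claim for
  this single prime yields it for all.\<close>

lemma claim_exception: "claim exception \<Longrightarrow> prime p \<Longrightarrow> claim p"
  unfolding exception_def using someI_ex[of "\<lambda>p. prime p \<and> \<not> claim p"] by (auto split: if_splits)

typedef exception_index = "{..<exception}"
  using prime_gt_0_nat[OF prime_exception] by auto

lemma card_exception_index: "CARD(exception_index) = exception"
  using type_definition.card[OF type_definition_exception_index] by simp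

instance exception_index :: prime_card
  by standard (simp add: card_exception_index prime_exception)

theorem theorem3p6:
  fixes p :: nat
  assumes "prime p"
    and "[int p = 1] (mod 5) \<or> [int p = - 1] (mod 5)"
  defines "S \<equiv> (\<Sum>k = 0..p - 1.
      (of_nat ((2 * k) choose k))\<^sup>2 * of_nat ((4 * k) choose (2 * k)) / 12 ^ (4 * k) :: rat)"
  shows "(\<forall>x y :: int. int p = x\<^sup>2 + 10 * y\<^sup>2 \<and> p mod 40 \<in> {1, 9, 11, 19}
            \<longrightarrow> rat_cong p p S (of_int (4 * x\<^sup>2)))
       \<and> (p mod 40 \<in> {21, 29, 31, 39} \<longrightarrow> rat_cong p (p\<^sup>2) S 0)"
proof -
  have "claim exception"
    using claim_for_card[where 'n = exception_index] by (simp only: card_exception_index)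
  then have "claim p" using claim_exception assms(1) by blast
  then show ?thesis using assms(2) unfolding claim_def S_def Let_def by blast
qed

end
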